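(* Let $u_0\in \mathrm{BV}(0,1)$ and $\alpha,\beta\in\mathrm{BV}(0,T)$, and fix $\lambda=\frac{\Delta t}{\Delta x}$ such that the discrete flux $F(u,v)=F_1(u)+F_2(v)$ of the scheme satisfies $F(u,u)=f(u)$, $F_1'\ge 0$, $F_2'\le 0$ and $\max_u \lambda(F_1'(u)-F_2'(u))\le 1$. Then for any sequence $(\Delta t_n)_n$ of time steps with $\Delta t_n\to 0$ there is a subsequence $(\Delta t_{n_k})_k$ such that the piecewise constant interpolations $u_{\Delta t_{n_k}}$ defined by the numerical scheme converge in $\mathcal{C}([0,T];\mathrm{L}^1(0,1))$, as $k\to\infty$, towards an entropy solution of the initial-boundary value problem for the Ostrovsky--Hunter equation with data $u_0,\alpha,\beta$.
   Context: **Problem.** Let $T>0$, $f\in\mathcal{C}^2(\mathbb{R})$, $\gamma>0$. The initial-boundary value problem for the Ostrovsky--Hunter equation on $[0,1]\times[0,T]$ is $$u_t+f(u)_x=\gamma P[u],\quad P[u](x,t)=\int_0^x u(y,t)\,dy,\quad u(x,0)=u_0(x),\quad u(0,t)=\alpha(t),\quad u(1,t)=\beta(t).$$ **Entropy solution.** A function $u\in \mathcal{C}([0,T];\mathrm{L}^1(0,1))\cap \mathrm{L}^\infty((0,1)\times(0,T))$ is an entropy solution of this problem if for all entropy pairs $(\eta,q)$, i.e. $\eta\in\mathcal{C}^2(\mathbb{R})$ convex and $q$ with $q'=\eta'f'$, $$\int_0^T\!\!\int_0^1\big(\eta(u)\phi_t+q(u)\phi_x+\gamma\eta'(u)P[u]\phi\big)\,dx\,dt+\int_0^1\eta(u_0(x))\phi(x,0)\,dx-\int_0^1\eta(u(x,T))\phi(x,T)\,dx\ge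 0$$ for all nonnegative $\phi\in\mathcal{C}_c^\infty((0,1)\times\mathbb{R})$, and $$q(u_0^\tau(t))-q(\alpha(t))-\eta'(\alpha(t))\big(f(u_0^\tau(t))-f(\alpha(t))\big)\le 0\le q(u_1^\tau(t))-q(\beta(t))-\eta'(\beta(t))\big(f(u_1^\tau(t))-f(\beta(t))\big)$$ for a.e. $t\in(0,T)$. Here $u_0^\tau$ and $u_1^\tau$ denote the strong ($\mathrm{L}^1$ in time) traces of $u$ at $x=0$ and $x=1$ respectively. **Grid.** $\Delta x=1/N$, $\Delta t=T/(M+1)$ with positive integer $N$ and nonnegative integer $M$; $\lambda=\Delta t/\Delta x$; $x_j=j\Delta x$ $(j=0,\dots,N)$, $t^n=n\Delta t$ $(n=0,\dots,M+1)$. Set $x_{j+1/2}=(j+\frac12)\Delta x$ for $j=0,\dots,N-1$, $x_{-1/2}=0$, $x_{N+1/2}=1$, and $I_j=[x_{j-1/2},x_{j+1/2})$, $I^n=[t^n,t^{n+1})$. When $\lambda$ is fixed, only time steps $\Delta t$ for which $\Delta t$ and $\Delta x=\Delta t/\lambda$ are of this form are considered. **Scheme.** $u_j^0=\frac1{\Delta x}\int_{I_j}u_0(x)\,dx$ for $j=0,\dots,N$, and for $n\ge 0$ $$u_0^{n+1}=\frac1{\Delta t}\int_{t^n}^{t^{n+1}}\alpha(s)\,ds,\qquad u_N^{n+1}=\frac1{\Delta t}\int_{t^n}^{t^{n+1}}\beta(s)\,ds,$$ $$u_j^{n+1}=u_j^n-\lambda\big(F_{j+1/2}^n-F_{j-1/2}^n\big)+\gamma\Delta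 t\,P_j^n\quad (j=1,\dots,N-1),$$ where $P_j^n=\Delta x\big(\frac12u_0^n+\sum_{i=1}^{j-1}u_i^n+\frac12u_j^n\big)$ and $F_{j+1/2}^n=F(u_j^n,u_{j+1}^n)$. The discrete flux $F$ is Lipschitz continuous and of the form $F(u,v)=F_1(u)+F_2(v)$ with $F_1,F_2\in\mathcal{C}^1(\mathbb{R})$. **Interpolation.** $u_{\Delta t}(x,t)=u_j^n$ for $(x,t)\in I_j\times I^n$ (so that $u_{\Delta t}(\cdot,T)$ is given by $u^{M+1}$). Convergence of $u_{\Delta t}$ to $u$ in $\mathcal{C}([0,T];\mathrm{L}^1(0,1))$ means $\sup_{t\in[0,T]}\|u_{\Delta t}(\cdot,t)-u(\cdot,t)\|_{\mathrm{L}^1(0,1)}\to0$. *)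

theory Defs
  imports "HOL-Analysis.Analysis"
begin

text \<open>\<open>Ck k f\<close> says that \<open>f\<close> is \<open>k\<close> times continuously differentiable on the whole space:
  \<open>f\<close> is differentiable and all its partial derivatives are of class \<open>k - 1\<close>. On the reals the only
  basis vector is \<open>1\<close>, and \<open>frechet_derivative f (at x) 1\<close> is the ordinary derivative.\<close>

primrec Ck :: "nat \<Rightarrow> ('a::euclidean_space \<Rightarrow> real) \<Rightarrow> bool" where
  "Ck 0 f \<longleftrightarrow> continuous_on UNIV f"
| "Ck (Suc k) f \<longleftrightarrow> (\<forall>x. f differentiable (at x)) \<and>
     (\<forall>b\<in>Basis. Ck k (\<lambda>x. frechet_derivative f (at x) b))"

text \<open>Elements of \<open>L\<^sup>1\<close> and \<open>BV\<close> are represented by Borel functions on the real line whose values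
  outside the interval are irrelevant. A class is in \<open>BV(a,b)\<close> iff some function equal to it almost
  everywhere has finite total variation, i.e. bounded variation sums over all finite partitions.\<close>

definition finite_total_variation :: "real \<Rightarrow> real \<Rightarrow> (real \<Rightarrow> real) \<Rightarrow> bool" where
  "finite_total_variation a b g \<longleftrightarrow>
     (\<exists>C. \<forall>m. \<forall>p :: nat \<Rightarrow> real. (\<forall>i\<le>m. p i \<in> {a<..<b}) \<and> (\<forall>i<m. p i < p (Suc i)) \<longrightarrow>
        (\<Sum>i<m. \<bar>g (p (Suc i)) - g (p i)\<bar>) \<le> C)"

definition BV :: "real \<Rightarrow> real \<Rightarrow> (real \<Rightarrow> real) set" where
  "BV a b = {v. set_integrable lborel {a<..<b} v \<and>
     (\<exists>g. finite_total_variation a b g \<and> (AE x in lborel. x \<in> {a<..<b} \<longrightarrow> v x = g x))}"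

definition L1_dist :: "real \<Rightarrow> real \<Rightarrow> (real \<Rightarrow> real) \<Rightarrow> (real \<Rightarrow> real) \<Rightarrow> ennreal" where
  "L1_dist a b v w = (\<integral>\<^sup>+x\<in>{a<..<b}. ennreal \<bar>v x - w x\<bar> \<partial>lborel)"

text \<open>Functions of space and time are written \<open>u x t\<close>.\<close>

definition continuous_L1 :: "real \<Rightarrow> (real \<Rightarrow> real \<Rightarrow> real) \<Rightarrow> bool" where
  "continuous_L1 T u \<longleftrightarrow>
     (\<forall>t\<in>{0..T}. set_integrable lborel {0<..<1} (\<lambda>x. u x t)) \<and>
     (\<forall>t\<in>{0..T}. ((\<lambda>s. L1_dist 0 1 (\<lambda>x. u x s) (\<lambda>x. u x t)) \<longlongrightarrow> 0) (at t within {0..T}))"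

definition Linfty :: "real \<Rightarrow> (real \<Rightarrow> real \<Rightarrow> real) \<Rightarrow> bool" where
  "Linfty T u \<longleftrightarrow>
     set_borel_measurable lborel ({0<..<1} \<times> {0<..<T}) (\<lambda>(x, t). u x t) \<and>
     (\<exists>C. AE (x, t) in lborel. x \<in> {0<..<1} \<and> t \<in> {0<..<T} \<longrightarrow> \<bar>u x t\<bar> \<le> C)"

definition P_int :: "(real \<Rightarrow> real \<Rightarrow> real) \<Rightarrow> real \<Rightarrow> real \<Rightarrow> real" where
  "P_int u x t = (LBINT y:{0..x}. u y t)"

text \<open>The limit \<open>x \<rightarrow> a\<close> is an essential one (outside a null set \<open>Z\<close>), since \<open>u\<close> is only defined up
  to null sets.\<close>

definition strong_trace :: "real \<Rightarrow> (real \<Rightarrow> real \<Rightarrow> real) \<Rightarrow> real \<Rightarrow> (real \<Rightarrow> real) \<Rightarrow> bool" where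
  "strong_trace T u a w \<longleftrightarrow> set_integrable lborel {0<..<T} w \<and>
     (\<exists>Z\<in>null_sets lborel. ((\<lambda>x. L1_dist 0 T (u x) w) \<longlongrightarrow> 0) (at a within ({0<..<1} - Z)))"

definition entropy_pair ::
    "(real \<Rightarrow> real) \<Rightarrow> (real \<Rightarrow> real) \<Rightarrow> (real \<Rightarrow> real) \<Rightarrow> bool" where
  "entropy_pair f \<eta> q \<longleftrightarrow> Ck 2 \<eta> \<and> convex_on UNIV \<eta> \<and>
     (\<forall>v. (q has_real_derivative deriv \<eta> v * deriv f v) (at v))"

text \<open>Test functions on \<open>(0,1) \<times> \<real>\<close>, extended by zero to the plane.\<close>

definition test_function :: "(real \<times> real \<Rightarrow> real) \<Rightarrow> bool" where
  "test_function \<phi> \<longleftrightarrow> (\<forall>k. Ck k \<phi>) \<and>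
     (\<exists>K. compact K \<and> K \<subseteq> {0<..<1} \<times> UNIV \<and> (\<forall>z. z \<notin> K \<longrightarrow> \<phi> z = 0))"

definition entropy_solution ::
    "real \<Rightarrow> (real \<Rightarrow> real) \<Rightarrow> real \<Rightarrow> (real \<Rightarrow> real) \<Rightarrow> (real \<Rightarrow> real) \<Rightarrow> (real \<Rightarrow> real)
      \<Rightarrow> (real \<Rightarrow> real \<Rightarrow> real) \<Rightarrow> bool" where
  "entropy_solution T f \<gamma> u0 \<alpha> \<beta> u \<longleftrightarrow>
     continuous_L1 T u \<and> Linfty T u \<and>
     (\<forall>\<eta> q \<phi>. entropy_pair f \<eta> q \<and> test_function \<phi> \<and> (\<forall>z. 0 \<le> \<phi> z) \<longrightarrow>
        (LBINT t:{0<..<T}. LBINT x:{0<..<1}.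
            (\<eta> (u x t) * deriv (\<lambda>s. \<phi> (x, s)) t + q (u x t) * deriv (\<lambda>y. \<phi> (y, t)) x
            + \<gamma> * deriv \<eta> (u x t) * P_int u x t * \<phi> (x, t)))
        + (LBINT x:{0<..<1}. \<eta> (u0 x) * \<phi> (x, 0))
        - (LBINT x:{0<..<1}. \<eta> (u x T) * \<phi> (x, T)) \<ge> 0) \<and>
     (\<exists>w0 w1. strong_trace T u 0 w0 \<and> strong_trace T u 1 w1 \<and>
        (\<forall>\<eta> q. entropy_pair f \<eta> q \<longrightarrow> (AE t in lborel. t \<in> {0<..<T} \<longrightarrow>
            q (w0 t) - q (\<alpha> t) - deriv \<eta> (\<alpha> t) * (f (w0 t) - f (\<alpha> t)) \<le> 0 \<and>
            0 \<le> q (w1 t) - q (\<beta> t) - deriv \<eta> (\<beta> t) * (f (w1 t) - f (\<beta> t)))))"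

text \<open>The cells \<open>I\<^sub>0\<close> and \<open>I\<^sub>N\<close> at the boundary have half the length of the others; the initial
  averages below are nevertheless all normalised by \<open>\<Delta>x = 1/N\<close>.\<close>

definition cell :: "nat \<Rightarrow> nat \<Rightarrow> real set" where
  "cell N j = {max 0 ((real j - 1/2) / real N) ..< min 1 ((real j + 1/2) / real N)}"

definition P_disc :: "nat \<Rightarrow> (nat \<Rightarrow> real) \<Rightarrow> nat \<Rightarrow> real" where
  "P_disc N v j = 1 / real N * (v 0 / 2 + (\<Sum>i = 1..j - 1. v i) + v j / 2)"

text \<open>\<open>scheme F \<gamma> dt N u0 \<alpha> \<beta> n j\<close> is the approximation \<open>u\<^sub>j\<^sup>n\<close>; it is meaningful for \<open>j \<le> N\<close> only.\<close>

primrec scheme ::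
    "(real \<Rightarrow> real \<Rightarrow> real) \<Rightarrow> real \<Rightarrow> real \<Rightarrow> nat \<Rightarrow> (real \<Rightarrow> real) \<Rightarrow> (real \<Rightarrow> real) \<Rightarrow> (real \<Rightarrow> real)
      \<Rightarrow> nat \<Rightarrow> nat \<Rightarrow> real" where
  "scheme F \<gamma> dt N u0 \<alpha> \<beta> 0 = (\<lambda>j. 1 / (1 / real N) * (LBINT x:cell N j. u0 x))"
| "scheme F \<gamma> dt N u0 \<alpha> \<beta> (Suc n) =
     (let v = scheme F \<gamma> dt N u0 \<alpha> \<beta> n in
      (\<lambda>j. if j = 0 then 1 / dt * (LBINT s:{real n * dt..real (Suc n) * dt}. \<alpha> s)
          else if j = N then 1 / dt * (LBINT s:{real n * dt..real (Suc n) * dt}. \<beta> s)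
          else v j - dt / (1 / real N) * (F (v j) (v (j + 1)) - F (v (j - 1)) (v j))
               + \<gamma> * dt * P_disc N v j))"

text \<open>At most one summand is nonzero. The last time slab \<open>n = M + 1\<close> starts at
  \<open>T = (M + 1) dt\<close>.\<close>

definition interpolant :: "real \<Rightarrow> nat \<Rightarrow> nat \<Rightarrow> (nat \<Rightarrow> nat \<Rightarrow> real) \<Rightarrow> real \<Rightarrow> real \<Rightarrow> real" where
  "interpolant dt N M v x t =
     (\<Sum>n\<le>M + 1. \<Sum>j\<le>N. v n j * indicator (cell N j) x
        * indicator {real n * dt..<real (Suc n) * dt} t)"

end

theory Submission
  imports Defs "HOL-Probability.Helly_Selection"
begin

text \<open>
The scheme is monotone, and everything rests on one decomposition. With
\<open>G u = u - lam * (F1 u - F2 u)\<close> an interior update reads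

  \<open>v (n+1) j = G (v n j) + lam * F1 (v n (j-1)) - lam * F2 (v n (j+1)) + source\<close>,

and the sign conditions on \<open>F1\<close> and \<open>F2\<close> together with the CFL condition say that \<open>G\<close>,
\<open>lam * F1\<close> and \<open>- lam * F2\<close> are nondecreasing; their sum is the identity.

Stability. The update maps constants to themselves up to the source, so the maximum grows by a
factor \<open>1 + \<gamma> * dt\<close> per step at most. The increments of the three parts of \<open>u\<close> have the same sign
as the increment of \<open>u\<close>, so the spatial variation only grows by what the boundary values and the
source contribute. The bounds are uniform in the grid (\<open>bound\<close>, \<open>variation\<close>), and they make
the approximations Lipschitz in time with values in \<open>L\<^sup>1\<close>, up to one time step (\<open>time_lipschitz\<close>).

Compactness. Helly's theorem at a dense set of times, a diagonal sequence and the equicontinuity in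
time give a subsequence that converges in \<open>L\<^sup>1\<close> uniformly in time (\<open>space_time_compactness\<close>).
The limit \<open>u(\<cdot>,t)\<close> is a difference of bounded monotone functions for every \<open>t\<close>, so it has
pointwise traces at \<open>x = 0\<close> and \<open>x = 1\<close>. The boundary values converge in \<open>L\<^sup>1\<close> as well.

Entropy inequality. Convexity, applied to each of the three monotone parts separately, gives an
entropy inequality in every interior cell, with a numerical entropy flux \<open>Q x y = Q1 x + Q2 y\<close> that is
split like \<open>F\<close> (\<open>cell_entropy_inequality\<close>). It is tested with functions that need not vanish at the
boundary. The fluxes through the two outermost faces depend on one interior value each, over
which nothing is known in the limit; they are replaced by bounds \<open>c0\<close> and \<open>c1\<close> that depend on the
boundary value only. The limit is \<open>entropy_inequality_with_boundary\<close>. For test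
functions supported in the interior the boundary terms disappear, and it is the entropy inequality
of the definition.

Boundary conditions. The same inequality is tested with \<open>p(t) * (1 - x)^(m+1)\<close> and
\<open>p(t) * x^(m+1)\<close>. As \<open>m\<close> tends to infinity only terms at the boundary survive, and they
compare the entropy flux of the trace with \<open>c0\<close> of the boundary datum. The entropy is taken to be \<open>\<eta>\<close>
minus its tangent at \<open>k\<close>: it is minimal at \<open>k\<close>, and by the monotonicity of \<open>F1\<close> and \<open>F2\<close> its numerical
flux satisfies \<open>Q k y \<le> Q x y \<le> Q x k\<close>. These are bounds of the kind wanted. Since the
resulting inequality holds for all \<open>k\<close> outside one common null set of times, \<open>k = \<alpha>(t)\<close> may be
inserted, and then \<open>c0 (\<alpha>(t))\<close> collapses to the entropy flux of \<open>\<alpha>(t)\<close>: this is the boundary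
condition (\<open>boundary_entropy_inequalities\<close>).

The data enter through bounds and variations only. A cell average is a mean of values along
translated equidistant partitions, so the averages do not vary more than the data do
(\<open>variation_of_averages\<close>).
\<close>

section \<open>Step functions and bounded variation\<close>

text \<open>The number of the cell that contains \<open>x\<close>, for cells of width \<open>h\<close> of which the first one starts
  at \<open>- c\<close>. Space cells are centred at the grid points (\<open>c = h / 2\<close>), time slabs start at them
  (\<open>c = 0\<close>). The truncation to \<open>{0..L}\<close> extends a step function \<open>s (idx h c L x)\<close> to the whole
  line without new jumps.\<close>
definition idx :: "real \<Rightarrow> real \<Rightarrow> nat \<Rightarrow> real \<Rightarrow> nat" where
  "idx h c L x = min L (nat \<lfloor>(x + c) / h\<rfloor>)"

lemma idx_le: "idx h c L x \<le> L"
  by (simp add: idx_def)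

lemma idx_mono: "h > 0 \<Longrightarrow> x \<le> y \<Longrightarrow> idx h c L x \<le> idx h c L y"
  unfolding idx_def by (intro min.mono order.refl nat_mono floor_mono divide_right_mono) auto

lemma idx_measurable [measurable]: "idx h c L \<in> measurable borel (count_space UNIV)"
  unfolding idx_def by measurable

lemma idx_eqI:
  assumes "h > 0" "real i * h \<le> x + c" "x + c < real (Suc i) * h" "i \<le> L"
  shows "idx h c L x = i"
proof -
  have "\<lfloor>(x + c) / h\<rfloor> = int i"
    using assms by (intro floor_unique) (auto simp: field_simps)
  then show ?thesis using assms by (simp add: idx_def)
qed

lemma idx_bounds:
  assumes "h > 0" "0 \<le> x + c" "x + c < real (Suc L) * h"
  shows "real (idx h c L x) * h \<le> x + c" "x + c < real (Suc (idx h c L x)) * h"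
proof -
  define m where "m = nat \<lfloor>(x + c) / h\<rfloor>"
  have ge: "0 \<le> (x + c) / h" using assms by simp
  have "(x + c) / h < real (Suc L)" using assms by (simp add: field_simps)
  then have "\<lfloor>(x + c) / h\<rfloor> < int (Suc L)" by (simp add: floor_less_iff)
  then have i: "idx h c L x = m" by (simp add: idx_def m_def)
  have m: "real m = of_int \<lfloor>(x + c) / h\<rfloor>" using ge by (simp add: m_def)
  have "real m \<le> (x + c) / h" "(x + c) / h < real m + 1" unfolding m by linarith+
  then show "real (idx h c L x) * h \<le> x + c" "x + c < real (Suc (idx h c L x)) * h"
    using assms(1) unfolding i by (auto simp: field_simps)
qed

text \<open>Cells are closed on the left, so step functions are right continuous.\<close>
lemma idx_right_const:
  assumes "h > 0"
  shows "\<forall>\<^sub>F y in at_right x. idx h c L y = idx h c L x"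
proof -
  have "(\<lambda>y. (y + c) / h) \<midarrow>x\<rightarrow> (x + c) / h"
    by (intro tendsto_intros) (use assms in auto)
  then have 1: "((\<lambda>y. (y + c) / h) \<longlongrightarrow> (x + c) / h) (at_right x)"
    by (rule filterlim_mono) (simp_all add: at_le)
  have "(x + c) / h < of_int \<lfloor>(x + c) / h\<rfloor> + 1" by linarith
  from order_tendstoD(2)[OF 1 this] have "\<forall>\<^sub>F y in at_right x. (y + c) / h < of_int \<lfloor>(x + c) / h\<rfloor> + 1" .
  moreover have "\<forall>\<^sub>F y in at_right x. x < y" by (simp add: eventually_at_right_less)
  ultimately show ?thesis
  proof eventually_elim
    case (elim y)
    have "(x + c) / h \<le> (y + c) / h" using elim assms by (simp add: divide_right_mono)
    then have "\<lfloor>(y + c) / h\<rfloor> = \<lfloor>(x + c) / h\<rfloor>" using elim by linarith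
    then show ?case by (simp add: idx_def)
  qed
qed

text \<open>Bounded variation in the form to which Helly's theorem applies. Right continuity makes the
  values of \<open>f\<close>, and not only its class modulo null sets, a matter of integrals of \<open>f\<close>; the trace at the
  left boundary and the joint measurability of limits depend on this.\<close>
definition bvr :: "real \<Rightarrow> (real \<Rightarrow> real) \<Rightarrow> bool" where
  "bvr C f \<longleftrightarrow> (\<exists>p q. mono p \<and> mono q \<and> (\<forall>x. continuous (at_right x) p) \<and>
     (\<forall>x. continuous (at_right x) q) \<and> (\<forall>x. \<bar>p x\<bar> \<le> C) \<and> (\<forall>x. \<bar>q x\<bar> \<le> C) \<and> (\<forall>x. f x = p x - q x))"

lemma bvr_measurable: "bvr C f \<Longrightarrow> f \<in> borel_measurable borel"
  unfolding bvr_def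
proof (elim exE conjE)
  fix p q assume "mono p" "mono q" "\<forall>x. f x = p x - q x"
  then have "f = (\<lambda>x. p x - q x)" and [measurable]: "p \<in> borel_measurable borel" "q \<in> borel_measurable borel"
    by (auto intro: borel_measurable_mono)
  then show ?thesis by simp
qed

lemma bvr_bounded: "bvr C f \<Longrightarrow> \<bar>f x\<bar> \<le> 2 * C"
  unfolding bvr_def
proof (elim exE conjE)
  fix p q assume "\<forall>x. \<bar>p x\<bar> \<le> C" "\<forall>x. \<bar>q x\<bar> \<le> C" "\<forall>x. f x = p x - q x"
  then have "\<bar>p x\<bar> \<le> C" "\<bar>q x\<bar> \<le> C" "f x = p x - q x" by auto
  then show ?thesis by linarith
qed

lemma bvr_right: "bvr C f \<Longrightarrow> (f \<longlongrightarrow> f x) (at_right x)"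
proof -
  assume "bvr C f"
  then obtain p q where "continuous (at_right x) p" "continuous (at_right x) q" "f = (\<lambda>x. p x - q x)"
    unfolding bvr_def by (auto simp: fun_eq_iff)
  then show ?thesis by (auto simp: continuous_within intro: tendsto_diff)
qed

lemma mono_bounded_left_limit:
  fixes p :: "real \<Rightarrow> real"
  assumes "mono p" "\<And>x. \<bar>p x\<bar> \<le> C"
  shows "\<exists>l. (p \<longlongrightarrow> l) (at_left x)"
proof
  have bdd: "bdd_above (p ` {..<x})" 
    by (rule bdd_aboveI2[where M=C]) (use assms(2) abs_le_iff in blast)
  show "(p \<longlongrightarrow> Sup (p ` {..<x})) (at_left x)"
  proof (rule order_tendstoI)
    fix a assume "a < Sup (p ` {..<x})"
    then obtain y where y: "y < x" "a < p y"
      using less_cSupD[of "p ` {..<x}" a] by (metis imageE image_is_empty lessThan_iff lessThan_non_empty)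
    from eventually_at_left_real[OF y(1)] show "\<forall>\<^sub>F z in at_left x. a < p z"
    proof eventually_elim
      case (elim z)
      then have "p y \<le> p z" using monoD[OF assms(1), of y z] by auto
      then show ?case using y by linarith
    qed
  next
    fix a assume a: "Sup (p ` {..<x}) < a"
    from eventually_at_left_real[of "x - 1" x] have "\<forall>\<^sub>F z in at_left x. z \<in> {x-1<..<x}" by simp
    then show "\<forall>\<^sub>F z in at_left x. p z < a"
    proof eventually_elim
      case (elim z)
      then have "p z \<le> Sup (p ` {..<x})" by (intro cSup_upper bdd) auto
      then show ?case using a by linarith
    qed
  qed
qed

lemma bvr_left: "bvr C f \<Longrightarrow> \<exists>l. (f \<longlongrightarrow> l) (at_left x)"
proof -
  assume "bvr C f"
  then obtain p q where pq: "mono p" "mono q" "\<And>x. \<bar>p x\<bar> \<le> C" "\<And>x. \<bar>q x\<bar> \<le> C" "f = (\<lambda>x. p x - q x)"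
    unfolding bvr_def by (auto simp: fun_eq_iff)
  obtain l m where "(p \<longlongrightarrow> l) (at_left x)" "(q \<longlongrightarrow> m) (at_left x)"
    using mono_bounded_left_limit pq by metis
  then show ?thesis using pq(5) by (auto intro: tendsto_diff)
qed

text \<open>The two monotone functions are the positive and the negative variation of \<open>s\<close>; \<open>K\<close> is the
  contribution of \<open>s 0\<close>.\<close>
lemma bvr_step:
  assumes h: "h > 0" and K: "\<And>j. j \<le> L \<Longrightarrow> \<bar>s j\<bar> \<le> K" and V: "(\<Sum>j<L. \<bar>s (Suc j) - s j\<bar>) \<le> V"
  shows "bvr (K + V) (\<lambda>x. s (idx h c L x))"
proof -
  define P where "P j = s 0 + (\<Sum>i<j. max 0 (s (Suc i) - s i))" for j
  define Q where "Q j = (\<Sum>i<j. max 0 (s i - s (Suc i)))" for j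
  have PQ: "s j = P j - Q j" for j
    by (induction j) (auto simp: P_def Q_def)
  have "mono P" "mono Q" unfolding P_def Q_def by (auto intro!: incseq_SucI)
  have K0: "K \<ge> 0" using K[of 0] by auto
  have V0: "0 \<le> V" using V by (meson abs_ge_zero order_trans sum_nonneg)
  have bd: "(\<Sum>i<j. max 0 (s (Suc i) - s i)) \<le> V \<and> (\<Sum>i<j. max 0 (s i - s (Suc i))) \<le> V" if "j \<le> L" for j
  proof -
    have "(\<Sum>i<j. max 0 (s (Suc i) - s i)) \<le> (\<Sum>i<j. \<bar>s (Suc i) - s i\<bar>)"
         "(\<Sum>i<j. max 0 (s i - s (Suc i))) \<le> (\<Sum>i<j. \<bar>s (Suc i) - s i\<bar>)" by (auto intro!: sum_mono)
    moreover have "(\<Sum>i<j. \<bar>s (Suc i) - s i\<bar>) \<le> (\<Sum>i<L. \<bar>s (Suc i) - s i\<bar>)"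
      using that by (intro sum_mono2) auto
    ultimately show ?thesis using V by linarith
  qed
  have nn: "0 \<le> (\<Sum>i<j. max 0 (s (Suc i) - s i))" "0 \<le> (\<Sum>i<j. max 0 (s i - s (Suc i)))" for j
    by (auto intro!: sum_nonneg)
  have Pb: "\<bar>P j\<bar> \<le> K + V" if "j \<le> L" for j
    using bd[OF that] nn[of j] K[of 0] unfolding P_def by linarith
  have Qb: "\<bar>Q j\<bar> \<le> K + V" if "j \<le> L" for j
    using bd[OF that] nn[of j] K0 unfolding Q_def by linarith
  have rc: "continuous (at_right x) (\<lambda>x. g (idx h c L x))" for g :: "nat \<Rightarrow> real" and x
    unfolding continuous_within
    by (rule tendsto_eventually) (use idx_right_const[OF h, of c L x] in \<open>auto elim: eventually_mono\<close>)
  show ?thesis unfolding bvr_def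
  proof (intro exI conjI allI)
    show "mono (\<lambda>x. P (idx h c L x))" "mono (\<lambda>x. Q (idx h c L x))"
      using \<open>mono P\<close> \<open>mono Q\<close> idx_mono[OF h] by (auto simp: mono_def)
  qed (use Pb Qb rc idx_le PQ in auto)
qed

lemma emeasure_Ioo_finite: "emeasure lborel {a<..<b::real} < top"
  using emeasure_bounded_finite[of "{a<..<b}"] by (simp add: less_top)

lemma set_integrable_bounded_interval:
  fixes f :: "real \<Rightarrow> real"
  assumes [measurable]: "f \<in> borel_measurable borel" and "\<And>x. x \<in> {a<..<b} \<Longrightarrow> \<bar>f x\<bar> \<le> B"
  shows "set_integrable lborel {a<..<b} f"
proof -
  have "integrable lborel (\<lambda>x. indicator {a<..<b} x *\<^sub>R max B 0)"
    by (rule integrable_real_indicator[THEN integrable_scaleR_left]) (auto simp: emeasure_Ioo_finite)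
  then show ?thesis unfolding set_integrable_def
    by (rule Bochner_Integration.integrable_bound) (use assms(2) in \<open>auto simp: indicator_def intro!: AE_I2 order.trans[OF assms(2)]\<close>)
qed

lemma set_dominated_convergence_interval:
  fixes f :: "nat \<Rightarrow> real \<Rightarrow> real"
  assumes m: "\<And>k. f k \<in> borel_measurable borel" "g \<in> borel_measurable borel"
    and B: "\<And>k x. x \<in> {a<..<b} \<Longrightarrow> \<bar>f k x\<bar> \<le> B"
    and c: "AE x in lborel. x \<in> {a<..<b} \<longrightarrow> (\<lambda>k. f k x) \<longlonglongrightarrow> g x"
  shows "(\<lambda>k. LBINT x:{a<..<b}. f k x) \<longlonglongrightarrow> (LBINT x:{a<..<b}. g x)"
  unfolding set_lebesgue_integral_def
proof (rule integral_dominated_convergence)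
  show "integrable lborel (\<lambda>x. indicator {a<..<b} x *\<^sub>R max B 0)"
    by (rule integrable_real_indicator[THEN integrable_scaleR_left]) (auto simp: emeasure_Ioo_finite)
  show "AE x in lborel. (\<lambda>k. indicator {a<..<b} x *\<^sub>R f k x) \<longlonglongrightarrow> indicator {a<..<b} x *\<^sub>R g x"
    using c by eventually_elim (auto simp: indicator_def)
  show "AE x in lborel. norm (indicator {a<..<b} x *\<^sub>R f i x) \<le> indicator {a<..<b} x *\<^sub>R max B 0" for i
    by (auto simp: indicator_def intro!: AE_I2 order.trans[OF B])
qed (use m in measurable)

text \<open>The distance \<open>L1_dist\<close> with values in the reals, where limits and linear arithmetic are easier to
  handle; \<open>L1_dist_eq_dist1\<close> connects the two.\<close>
definition dist1 :: "real \<Rightarrow> real \<Rightarrow> (real \<Rightarrow> real) \<Rightarrow> (real \<Rightarrow> real) \<Rightarrow> real" where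
  "dist1 a b f g = (LBINT x:{a<..<b}. \<bar>f x - g x\<bar>)"

text \<open>Helly's theorem is applied to both monotone parts in turn. The limits have only countably many
  discontinuities, so that the convergence is almost everywhere, and bounded convergence yields \<open>L\<^sup>1\<close>.\<close>
lemma Helly_L1:
  assumes "\<And>k. bvr C (f k)"
  shows "\<exists>r g. strict_mono (r :: nat \<Rightarrow> nat) \<and> bvr C g \<and>
     (\<forall>a b. (\<lambda>k. dist1 a b (f (r k)) g) \<longlonglongrightarrow> 0)"
proof -
  have "\<forall>k. \<exists>pq. mono (fst pq) \<and> mono (snd pq) \<and> (\<forall>x. continuous (at_right x) (fst pq)) \<and>
     (\<forall>x. continuous (at_right x) (snd pq)) \<and> (\<forall>x. \<bar>fst pq x\<bar> \<le> C) \<and> (\<forall>x. \<bar>snd pq x\<bar> \<le> C)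
      \<and> (\<forall>x. f k x = fst pq x - snd pq x)"
    using assms unfolding bvr_def by force
  from choice[OF this] obtain pq where pq: "\<And>k. mono (fst (pq k))" "\<And>k. mono (snd (pq k))"
     "\<And>k x. continuous (at_right x) (fst (pq k))" "\<And>k x. continuous (at_right x) (snd (pq k))"
     "\<And>k x. \<bar>fst (pq k) x\<bar> \<le> C" "\<And>k x. \<bar>snd (pq k) x\<bar> \<le> C" "\<And>k x. f k x = fst (pq k) x - snd (pq k) x"
    by blast
  obtain s p where s: "strict_mono s" "\<And>x. continuous (at_right x) p" "mono p" "\<And>x. \<bar>p x\<bar> \<le> C"
      "\<And>x. continuous (at x) p \<Longrightarrow> (\<lambda>n. fst (pq (s n)) x) \<longlonglongrightarrow> p x"
    using Helly_selection[of "\<lambda>k. fst (pq k)" C] pq by blast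
  obtain s' q where s': "strict_mono s'" "\<And>x. continuous (at_right x) q" "mono q" "\<And>x. \<bar>q x\<bar> \<le> C"
      "\<And>x. continuous (at x) q \<Longrightarrow> (\<lambda>n. snd (pq (s (s' n))) x) \<longlonglongrightarrow> q x"
    using Helly_selection[of "\<lambda>k. snd (pq (s k))" C] pq by blast
  define g where "g x = p x - q x" for x
  have g: "bvr C g" unfolding bvr_def g_def using s s' by blast
  have cnt: "countable ({x. \<not> continuous (at x) p} \<union> {x. \<not> continuous (at x) q})"
    using mono_ctble_discont[OF s(3)] mono_ctble_discont[OF s'(3)] by (simp add: Collect_neg_eq)
  have "AE x in lborel. x \<notin> {x. \<not> continuous (at x) p} \<union> {x. \<not> continuous (at x) q}"
    by (rule AE_not_in) (rule countable_imp_null_set_lborel[OF cnt])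
  then have ae: "AE x in lborel. (\<lambda>k. f (s (s' k)) x) \<longlonglongrightarrow> g x"
  proof eventually_elim
    case (elim x)
    then have "(\<lambda>n. fst (pq (s n)) x) \<longlonglongrightarrow> p x" "(\<lambda>n. snd (pq (s (s' n))) x) \<longlonglongrightarrow> q x"
      using s(5) s'(5) by auto
    then have "(\<lambda>n. fst (pq (s (s' n))) x - snd (pq (s (s' n))) x) \<longlonglongrightarrow> p x - q x"
      using LIMSEQ_subseq_LIMSEQ[OF _ s'(1), of "\<lambda>n. fst (pq (s n)) x"] by (intro tendsto_diff) (auto simp: o_def)
    then show ?case by (simp add: pq(7) g_def)
  qed
  have [measurable]: "f k \<in> borel_measurable borel" "g \<in> borel_measurable borel" for k
    using bvr_measurable assms g by blast+
  have "(\<lambda>k. LBINT x:{a<..<b}. \<bar>f (s (s' k)) x - g x\<bar>) \<longlonglongrightarrow> (LBINT x:{a<..<b}. 0)" for a b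
  proof (rule set_dominated_convergence_interval)
    show "\<bar>\<bar>f (s (s' k)) x - g x\<bar>\<bar> \<le> 4 * C" for k x
      using bvr_bounded[OF assms, of "s (s' k)" x] bvr_bounded[OF g, of x] by linarith
    show "AE x in lborel. x \<in> {a<..<b} \<longrightarrow> (\<lambda>k. \<bar>f (s (s' k)) x - g x\<bar>) \<longlonglongrightarrow> 0"
      using ae by eventually_elim (auto intro!: tendsto_rabs_zero LIM_zero)
  qed auto
  then show ?thesis using s(1) s'(1) g unfolding dist1_def
    by (intro exI[of _ "\<lambda>k. s (s' k)"] exI[of _ g]) (auto intro: strict_mono_o[unfolded o_def])
qed

section \<open>Compactness\<close>

lemma set_integrable_bvr: "bvr C f \<Longrightarrow> set_integrable lborel {a<..<b} f"
  by (rule set_integrable_bounded_interval[OF bvr_measurable bvr_bounded])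

lemma dist1_nonneg: "0 \<le> dist1 a b f g"
  unfolding dist1_def set_lebesgue_integral_def by (intro integral_nonneg_AE) auto

lemma dist1_commute: "dist1 a b f g = dist1 a b g f"
  by (simp add: dist1_def abs_minus_commute)

lemma dist1_triangle:
  assumes "set_integrable lborel {a<..<b} f" "set_integrable lborel {a<..<b} g" "set_integrable lborel {a<..<b} h"
  shows "dist1 a b f h \<le> dist1 a b f g + dist1 a b g h"
proof -
  have i: "set_integrable lborel {a<..<b} (\<lambda>x. \<bar>u x - v x\<bar>)"
    if "set_integrable lborel {a<..<b} u" "set_integrable lborel {a<..<b} v" for u v :: "real \<Rightarrow> real"
    using set_integrable_abs[OF set_integral_diff(1)[OF that]] .
  have "dist1 a b f h \<le> (LBINT x:{a<..<b}. \<bar>f x - g x\<bar> + \<bar>g x - h x\<bar>)"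
    unfolding dist1_def by (rule set_integral_mono) (use assms i in auto)
  also have "\<dots> = dist1 a b f g + dist1 a b g h"
    unfolding dist1_def by (rule set_integral_add(2)) (use assms i in auto)
  finally show ?thesis .
qed

lemma set_integral_diff_le_dist1:
  assumes f: "set_integrable lborel {a<..<b} f" and g: "set_integrable lborel {a<..<b} g"
    and x: "a \<le> x" "z \<le> b"
  shows "\<bar>(LBINT y:{x<..<z}. f y) - (LBINT y:{x<..<z}. g y)\<bar> \<le> dist1 a b f g"
proof -
  have sub: "{x<..<z} \<subseteq> {a<..<b}" using x by auto
  have f': "set_integrable lborel {x<..<z} f" "set_integrable lborel {x<..<z} g"
    using f g sub by (auto intro: set_integrable_subset)
  have "(LBINT y:{x<..<z}. f y) - (LBINT y:{x<..<z}. g y) = (LBINT y:{x<..<z}. f y - g y)"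
    using f' by (rule set_integral_diff(2)[symmetric])
  also have "\<bar>\<dots>\<bar> \<le> (LBINT y:{x<..<z}. \<bar>f y - g y\<bar>)"
    using set_integral_norm_bound[OF set_integral_diff(1)[OF f']] by simp
  also have "\<dots> \<le> dist1 a b f g"
    unfolding dist1_def
    unfolding set_lebesgue_integral_def
  proof (rule integral_mono)
    show "integrable lborel (\<lambda>y. indicator {x<..<z} y *\<^sub>R \<bar>f y - g y\<bar>)"
      using set_integrable_abs[OF set_integral_diff(1)[OF f']] by (simp add: set_integrable_def)
    show "integrable lborel (\<lambda>y. indicator {a<..<b} y *\<^sub>R \<bar>f y - g y\<bar>)"
      using set_integrable_abs[OF set_integral_diff(1)[OF f g]] by (simp add: set_integrable_def)
  qed (use sub in \<open>auto simp: indicator_def\<close>)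
  finally show ?thesis .
qed

text \<open>The positive and the negative part of \<open>h\<close> are densities of finite measures that agree on all
  half-lines and hence coincide.\<close>
lemma AE_eq_0_if_primitive_0:
  assumes "a < b" and h: "set_integrable lborel {a<..<b} (h :: real \<Rightarrow> real)"
    and z: "\<And>x. x \<in> {a<..b} \<Longrightarrow> (LBINT y:{a<..<x}. h y) = 0"
  shows "AE x in lborel. x \<in> {a<..<b} \<longrightarrow> h x = 0"
proof -
  define k where "k x = indicator {a<..<b} x *\<^sub>R h x" for x
  have k: "integrable lborel k" using h by (simp add: k_def[abs_def] set_integrable_def)
  then have [measurable]: "k \<in> borel_measurable borel" by simp
  have tail: "(LINT y|lborel. indicator {x<..} y * k y) = 0" for x
  proof -
    have int: "integrable lborel (\<lambda>y. indicator {c<..<d} y * k y)" for c d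
      using integrable_mult_indicator[OF _ k, of "{c<..<d}"] by simp
    have e1: "(LINT y|lborel. indicator {a<..<d} y * k y) = 0" if "d \<in> {a<..b}" for d
      using z[OF that] that unfolding set_lebesgue_integral_def k_def
      by (subst (asm) Bochner_Integration.integral_cong[OF refl, where g="\<lambda>y. indicator {a<..<d} y * (indicator {a<..<b} y *\<^sub>R h y)"])
         (auto simp: indicator_def)
    consider "x \<le> a" | "x \<ge> b" | "a < x" "x < b" by linarith
    then show ?thesis
    proof cases
      case 1
      have "(LINT y|lborel. indicator {x<..} y * k y) = (LINT y|lborel. indicator {a<..<b} y * k y)"
        by (rule Bochner_Integration.integral_cong) (use 1 in \<open>auto simp: k_def indicator_def\<close>)
      then show ?thesis using e1[of b] \<open>a < b\<close> by simp
    next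
      case 2
      then have "(\<lambda>y. indicator {x<..} y * k y) = (\<lambda>y. 0)"
        by (auto simp: k_def indicator_def)
      then show ?thesis by simp
    next
      case 3
      have "(LINT y|lborel. indicator {x<..} y * k y)
          = (LINT y|lborel. indicator {a<..<b} y * k y - indicator {a<..<x} y * k y)"
      proof (rule integral_cong_AE)
        show "AE y in lborel. indicator {x<..} y * k y = indicator {a<..<b} y * k y - indicator {a<..<x} y * k y"
          using AE_lborel_singleton[of x] by eventually_elim (use 3 in \<open>auto simp: k_def indicator_def\<close>)
      qed auto
      also have "\<dots> = 0" using 3 \<open>a < b\<close> by (subst Bochner_Integration.integral_diff) (auto simp: e1 int)
      finally show ?thesis .
    qed
  qed
  have eq: "(\<integral>\<^sup>+y. ennreal (indicator {x<..} y * k y) \<partial>lborel) = (\<integral>\<^sup>+y. ennreal (- (indicator {x<..} y * k y)) \<partial>lborel)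
       \<and> (\<integral>\<^sup>+y. ennreal (indicator {x<..} y * k y) \<partial>lborel) < \<infinity>" for x
  proof -
    have i: "integrable lborel (\<lambda>y. indicator {x<..} y * k y)"
      using integrable_mult_indicator[OF _ k, of "{x<..}"] by simp
    have fin: "(\<integral>\<^sup>+y. ennreal (indicator {x<..} y * k y) \<partial>lborel) \<noteq> \<infinity>" "(\<integral>\<^sup>+y. ennreal (- (indicator {x<..} y * k y)) \<partial>lborel) \<noteq> \<infinity>"
      using i by (auto simp: real_integrable_def)
    have "enn2real (\<integral>\<^sup>+y. ennreal (indicator {x<..} y * k y) \<partial>lborel) = enn2real (\<integral>\<^sup>+y. ennreal (- (indicator {x<..} y * k y)) \<partial>lborel)"
      using tail[of x] real_lebesgue_integral_def[OF i] by simp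
    with fin show ?thesis by (metis ennreal_enn2real less_top infinity_ennreal_def)
  qed
  have em: "emeasure (density lborel (\<lambda>y. ennreal (g y))) {x<..} = (\<integral>\<^sup>+y. ennreal (indicator {x<..} y * g y) \<partial>lborel)"
    if [measurable]: "g \<in> borel_measurable borel" for g :: "real \<Rightarrow> real" and x
    by (subst emeasure_density) (auto intro!: nn_integral_cong simp: indicator_def)
  have "density lborel (\<lambda>y. ennreal (k y)) = density lborel (\<lambda>y. ennreal (- k y))"
  proof (rule measure_eqI_lessThan)
    fix x show "emeasure (density lborel (\<lambda>y. ennreal (k y))) {x<..} < \<infinity>"
      using eq[THEN conjunct2, of x] by (simp add: em)
    show "emeasure (density lborel (\<lambda>y. ennreal (k y))) {x<..} = emeasure (density lborel (\<lambda>y. ennreal (- k y))) {x<..}"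
      using eq[of x] em[of k x] em[of "\<lambda>y. - k y" x] by simp
  qed auto
  then have "AE x in lborel. ennreal (k x) = ennreal (- k x)"
    by (intro sigma_finite_measure.density_unique[OF sigma_finite_lborel]) auto
  then show ?thesis
  proof eventually_elim
    case (elim x)
    have "k x = 0"
      using elim by (metis ennreal_eq_0_iff ennreal_neg linorder_le_cases neg_0_le_iff_le neg_le_0_iff_le order_antisym)
    then show ?case by (auto simp: k_def)
  qed
qed

text \<open>A uniform bound in BV turns weak convergence into convergence in \<open>L\<^sup>1\<close>: by Helly's theorem every
  subsequence has a further one that converges, and primitives show that its limit is always \<open>v\<close>.
  For step functions built from averages of \<open>v\<close> the hypothesis \<open>prim\<close> is immediate.\<close>
lemma L1_limit_from_primitives:
  assumes "a < b" and bv: "\<And>k. bvr C (f k)" and v: "set_integrable lborel {a<..<b} v"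
    and prim: "\<And>x. x \<in> {a<..b} \<Longrightarrow> (\<lambda>k. LBINT y:{a<..<x}. f k y) \<longlonglongrightarrow> (LBINT y:{a<..<x}. v y)"
  shows "\<exists>g. bvr C g \<and> (AE x in lborel. x \<in> {a<..<b} \<longrightarrow> v x = g x) \<and> (\<lambda>k. dist1 a b (f k) g) \<longlonglongrightarrow> 0"
proof -
  have ident: "AE x in lborel. x \<in> {a<..<b} \<longrightarrow> v x - g x = 0"
    if s: "strict_mono s" and g: "bvr C g" and lim: "(\<lambda>k. dist1 a b (f (s k)) g) \<longlonglongrightarrow> 0" for s g
  proof (rule AE_eq_0_if_primitive_0[OF \<open>a < b\<close>])
    show "set_integrable lborel {a<..<b} (\<lambda>x. v x - g x)"
      by (intro set_integral_diff v set_integrable_bvr[OF g])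
    fix x assume x: "x \<in> {a<..b}"
    have "(\<lambda>k. (LBINT y:{a<..<x}. f (s k) y) - (LBINT y:{a<..<x}. g y)) \<longlonglongrightarrow> 0"
      by (rule Lim_null_comparison[OF _ lim])
         (use x set_integral_diff_le_dist1[OF set_integrable_bvr[OF bv] set_integrable_bvr[OF g], of a a x b] in auto)
    then have "(\<lambda>k. LBINT y:{a<..<x}. f (s k) y) \<longlonglongrightarrow> (LBINT y:{a<..<x}. g y)"
      by (simp add: LIM_zero_iff)
    moreover have "(\<lambda>k. LBINT y:{a<..<x}. f (s k) y) \<longlonglongrightarrow> (LBINT y:{a<..<x}. v y)"
      using LIMSEQ_subseq_LIMSEQ[OF prim[OF x] s] by (simp add: o_def)
    ultimately have "(LBINT y:{a<..<x}. g y) = (LBINT y:{a<..<x}. v y)" by (rule LIMSEQ_unique)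
    then show "(LBINT y:{a<..<x}. v y - g y) = 0"
      using x v by (subst set_integral_diff(2)) (auto intro: set_integrable_subset set_integrable_bvr[OF g])
  qed
  obtain r g where r: "strict_mono r" "bvr C g" "(\<lambda>k. dist1 a b (f (r k)) g) \<longlonglongrightarrow> 0"
    using Helly_L1[of C f, OF bv] by blast
  have "(\<lambda>k. dist1 a b (f k) g) \<longlonglongrightarrow> 0"
  proof (rule ccontr)
    assume "\<not> ?thesis"
    then obtain e where e: "e > 0" "\<not> (\<forall>\<^sub>F k in sequentially. dist (dist1 a b (f k) g) 0 < e)"
      unfolding tendsto_iff by blast
    then have "infinite {k. \<not> dist1 a b (f k) g < e}"
      by (simp add: dist1_nonneg cofinite_eq_sequentially[symmetric] eventually_cofinite)
    then obtain s :: "nat \<Rightarrow> nat" where s: "strict_mono s" "\<forall>k. s k \<in> {k. \<not> dist1 a b (f k) g < e}"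
      using infinite_enumerate[of "{k. \<not> dist1 a b (f k) g < e}"] by blast
    obtain r' g' where r': "strict_mono r'" "bvr C g'" "(\<lambda>k. dist1 a b (f (s (r' k))) g') \<longlonglongrightarrow> 0"
      using Helly_L1[of C "\<lambda>k. f (s k)", OF bv] by blast
    have "AE x in lborel. x \<in> {a<..<b} \<longrightarrow> g x = g' x"
      using ident[OF r] ident[of "\<lambda>k. s (r' k)", OF _ r'(2,3)] strict_mono_o[OF s(1) r'(1)]
      by (auto simp: o_def)
    then have "dist1 a b (f (s (r' k))) g = dist1 a b (f (s (r' k))) g'" for k
      unfolding dist1_def using bvr_measurable[OF r(2)] bvr_measurable[OF r'(2)] bvr_measurable[OF bv]
      by (intro set_lebesgue_integral_cong_AE) auto
    then have "(\<lambda>k. dist1 a b (f (s (r' k))) g) \<longlonglongrightarrow> 0" using r'(3) by simp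
    then have "\<forall>\<^sub>F k in sequentially. dist1 a b (f (s (r' k))) g < e"
      using e(1) order_tendstoD(2) by blast
    then show False using s(2) by (auto simp: eventually_sequentially)
  qed
  then show ?thesis using r(2) ident[OF r] by (intro exI[of _ g]) (auto elim: eventually_mono)
qed

text \<open>The Arzela-Ascoli argument for functions of \<open>t\<close> with values in \<open>L\<^sup>1\<close>, with Helly's theorem providing
  compactness at a fixed time. The functions jump in time, so equicontinuity can only be
  asked for up to \<open>\<tau> k\<close>.\<close>
lemma space_time_compactness:
  fixes U :: "nat \<Rightarrow> real \<Rightarrow> real \<Rightarrow> real"
  assumes T: "T > 0" and D: "D \<ge> 0" and bv: "\<And>k t. t \<in> {0..T} \<Longrightarrow> bvr C (\<lambda>x. U k x t)"
    and lip: "\<And>k s t. s \<in> {0..T} \<Longrightarrow> t \<in> {0..T} \<Longrightarrow>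
        dist1 0 1 (\<lambda>x. U k x t) (\<lambda>x. U k x s) \<le> D * (\<bar>t - s\<bar> + \<tau> k)"
    and \<tau>: "\<tau> \<longlonglongrightarrow> 0"
  shows "\<exists>r u. strict_mono (r :: nat \<Rightarrow> nat) \<and> (\<forall>t\<in>{0..T}. bvr C (\<lambda>x. u x t)) \<and>
     (\<forall>e>0. \<forall>\<^sub>F k in sequentially. \<forall>t\<in>{0..T}. dist1 0 1 (\<lambda>x. U (r k) x t) (\<lambda>x. u x t) \<le> e)"
proof -
  define grid where "grid i m = T * real (min i (Suc m)) / real (Suc m)" for i m :: nat
  have grid_in: "grid i m \<in> {0..T}" for i m
  proof -
    have "T * real (min i (Suc m)) \<le> T * real (Suc m)" using T by (intro mult_left_mono) auto
    then show ?thesis using T by (auto simp: grid_def pos_divide_le_eq simp del: of_nat_Suc)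
  qed
  \<comment> \<open>The times \<open>q n\<close> enumerate the grids with \<open>m + 2\<close> points, for all \<open>m\<close> at once.\<close>
  define q where "q n = (case prod_decode n of (i, m) \<Rightarrow> grid i m)" for n
  have q_in: "q n \<in> {0..T}" for n by (cases "prod_decode n") (simp add: q_def grid_in del: atLeastAtMost_iff)
  define P where "P n s = (\<exists>g. bvr C g \<and> (\<lambda>k. dist1 0 1 (\<lambda>x. U (s k) x (q n)) g) \<longlonglongrightarrow> 0)"
    for n :: nat and s :: "nat \<Rightarrow> nat"
  interpret subseqs P
  proof
    fix n :: nat and s :: "nat \<Rightarrow> nat" assume "strict_mono s"
    show "\<exists>r'. strict_mono r' \<and> P n (s \<circ> r')"
      using Helly_L1[of C "\<lambda>k x. U (s k) x (q n)", OF bv[OF q_in]] unfolding P_def o_def by blast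
  qed
  define d where "d = diagseq"
  have d: "strict_mono d" unfolding d_def by (rule subseq_diagseq)
  have Pd: "P n (d \<circ> ((+) (Suc n)))" for n
    unfolding d_def
  proof (rule diagseq_holds)
    fix r s n assume "strict_mono (r :: nat \<Rightarrow> nat)" "P n s"
    then show "P n (s \<circ> r)" unfolding P_def using LIMSEQ_subseq_LIMSEQ by (fastforce simp: o_def)
  qed
  have conv: "\<exists>g. bvr C g \<and> (\<lambda>k. dist1 0 1 (\<lambda>x. U (d k) x (q n)) g) \<longlonglongrightarrow> 0" for n
  proof -
    obtain g where "bvr C g" "(\<lambda>k. dist1 0 1 (\<lambda>x. U (d (k + Suc n)) x (q n)) g) \<longlonglongrightarrow> 0"
      using Pd[of n] unfolding P_def by (auto simp: o_def add.commute)
    then show ?thesis using LIMSEQ_offset[of "\<lambda>k. dist1 0 1 (\<lambda>x. U (d k) x (q n)) g" "Suc n" 0] by auto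
  qed
  have si: "set_integrable lborel {0<..<1} (\<lambda>x. U k x t)" if "t \<in> {0..T}" for k t
    by (rule set_integrable_bvr[OF bv[OF that]])
  have tri: "dist1 0 1 (\<lambda>x. U a x r) (\<lambda>x. U c x p) \<le> dist1 0 1 (\<lambda>x. U a x r) (\<lambda>x. U b x s) + dist1 0 1 (\<lambda>x. U b x s) (\<lambda>x. U c x p)"
    if "r \<in> {0..T}" "s \<in> {0..T}" "p \<in> {0..T}" for a b c r s p
    using that by (intro dist1_triangle si)
  have cauchy_q: "\<exists>N. \<forall>k\<ge>N. \<forall>l\<ge>N. dist1 0 1 (\<lambda>x. U (d k) x (q n)) (\<lambda>x. U (d l) x (q n)) < e"
    if "e > 0" for e n
  proof -
    obtain g where g: "bvr C g" "(\<lambda>k. dist1 0 1 (\<lambda>x. U (d k) x (q n)) g) \<longlonglongrightarrow> 0"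
      using conv by blast
    have "\<forall>\<^sub>F k in sequentially. dist1 0 1 (\<lambda>x. U (d k) x (q n)) g < e / 2"
      using order_tendstoD(2)[OF g(2), of "e / 2"] that by simp
    then obtain N where N: "\<And>k. k \<ge> N \<Longrightarrow> dist1 0 1 (\<lambda>x. U (d k) x (q n)) g < e / 2"
      unfolding eventually_sequentially by blast
    have "dist1 0 1 (\<lambda>x. U (d k) x (q n)) (\<lambda>x. U (d l) x (q n)) < e" if "k \<ge> N" "l \<ge> N" for k l
      using dist1_triangle[OF si[OF q_in] set_integrable_bvr[OF g(1)] si[OF q_in], of "d k" n "d l" n]
        N[OF that(1)] N[OF that(2)] dist1_commute[of 0 1 g] by fastforce
    then show ?thesis by blast
  qed
  have cauchy: "\<exists>N. \<forall>k\<ge>N. \<forall>l\<ge>N. \<forall>t\<in>{0..T}. dist1 0 1 (\<lambda>x. U (d k) x t) (\<lambda>x. U (d l) x t) \<le> e"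
    if e: "e > 0" for e
  proof -
    obtain m where m: "D * T * 8 / e < real (Suc m)"
      using reals_Archimedean2 by (metis less_trans lessI of_nat_less_iff)
    then have m': "D * (T / real (Suc m)) \<le> e / 8" using e by (simp add: field_simps)
    have "(\<lambda>k. D * \<tau> (d k)) \<longlonglongrightarrow> D * 0"
      using LIMSEQ_subseq_LIMSEQ[OF \<tau> d] by (intro tendsto_intros) (simp add: o_def)
    then have "\<forall>\<^sub>F k in sequentially. D * \<tau> (d k) < e / 8"
      using e by (intro order_tendstoD(2)) auto
    then obtain N0 where N0: "\<And>k. k \<ge> N0 \<Longrightarrow> D * \<tau> (d k) < e / 8"
      unfolding eventually_sequentially by blast
    have "\<forall>n. \<exists>N. \<forall>k\<ge>N. \<forall>l\<ge>N. dist1 0 1 (\<lambda>x. U (d k) x (q n)) (\<lambda>x. U (d l) x (q n)) < e / 4"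
      using cauchy_q[of "e / 4"] e by simp
    then obtain N1 where N1: "\<And>n k l. k \<ge> N1 n \<Longrightarrow> l \<ge> N1 n \<Longrightarrow>
        dist1 0 1 (\<lambda>x. U (d k) x (q n)) (\<lambda>x. U (d l) x (q n)) < e / 4" by metis
    define N where "N = N0 + (\<Sum>i\<le>Suc m. N1 (prod_encode (i, m)))"
    have "dist1 0 1 (\<lambda>x. U (d k) x t) (\<lambda>x. U (d l) x t) \<le> e" if kl: "k \<ge> N" "l \<ge> N" and t: "t \<in> {0..T}" for k l t
    proof -
      define i where "i = nat \<lfloor>t * real (Suc m) / T\<rfloor>"
      have tT: "0 \<le> t * real (Suc m) / T" "t * real (Suc m) / T \<le> real (Suc m)"
        using t T mult_right_mono[of t T "real (Suc m)"] by (auto simp: pos_divide_le_eq mult.commute simp del: of_nat_Suc)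
      have i: "real i \<le> t * real (Suc m) / T" "t * real (Suc m) / T < real i + 1"
        using tT(1) unfolding i_def by linarith+
      have im: "i \<le> Suc m" using i(1) tT(2) by linarith
      define n where "n = prod_encode (i, m)"
      have qn: "q n = T * real i / real (Suc m)" using im by (simp add: q_def n_def grid_def min_absorb1)
      have "\<bar>t - q n\<bar> \<le> T / real (Suc m)" 
      proof -
        have "T * real i \<le> t * real (Suc m)" "t * real (Suc m) \<le> T * real i + T"
          using i T by (auto simp: field_simps simp del: of_nat_Suc)
        then have "q n \<le> t" "t \<le> q n + T / real (Suc m)"
          unfolding qn by (auto simp: pos_divide_le_eq pos_le_divide_eq add_divide_distrib[symmetric] simp del: of_nat_Suc)
        then show ?thesis by simp
      qed
      then have "D * \<bar>t - q n\<bar> \<le> e / 8" using m' D by (meson mult_left_mono order_trans)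
      then have near: "dist1 0 1 (\<lambda>x. U (d k) x t) (\<lambda>x. U (d k) x (q n)) \<le> e / 4" if "k \<ge> N0" for k
        using lip[OF q_in t, of "d k" n] N0[OF that] by (simp add: algebra_simps)
      have "N1 n \<le> N" unfolding N_def n_def using im
        by (intro trans_le_add2 member_le_sum) auto
      then have "dist1 0 1 (\<lambda>x. U (d k) x (q n)) (\<lambda>x. U (d l) x (q n)) < e / 4"
        using kl by (intro N1) auto
      moreover have "k \<ge> N0" "l \<ge> N0" using kl by (auto simp: N_def)
      ultimately show ?thesis
        using near[of k] near[of l] tri[OF t q_in t, of "d k" "d l" "d k" n] tri[OF q_in q_in t, of "d k" n "d l" "d l" n]
          dist1_commute[of 0 1 "\<lambda>x. U (d l) x (q n)" "\<lambda>x. U (d l) x t"] e by linarith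
    qed
    then show ?thesis by blast
  qed
  \<comment> \<open>The Cauchy sequence at time \<open>t\<close> has a convergent subsequence,
    which may depend on \<open>t\<close>, and therefore converges itself.\<close>
  have "\<exists>g. bvr C g \<and> (\<exists>r. strict_mono (r::nat\<Rightarrow>nat) \<and> (\<lambda>k. dist1 0 1 (\<lambda>x. U (d (r k)) x t) g) \<longlonglongrightarrow> 0)"
    if "t \<in> {0..T}" for t
    using Helly_L1[of C "\<lambda>k x. U (d k) x t", OF bv[OF that]] by blast
  then obtain g where g: "\<And>t. t \<in> {0..T} \<Longrightarrow> bvr C (g t)"
    "\<And>t. t \<in> {0..T} \<Longrightarrow> \<exists>r. strict_mono (r::nat\<Rightarrow>nat) \<and> (\<lambda>k. dist1 0 1 (\<lambda>x. U (d (r k)) x t) (g t)) \<longlonglongrightarrow> 0"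
    by metis
  have "\<forall>\<^sub>F k in sequentially. \<forall>t\<in>{0..T}. dist1 0 1 (\<lambda>x. U (d k) x t) (g t) \<le> e" if e: "e > 0" for e
  proof -
    obtain N where N: "\<And>k l t. k \<ge> N \<Longrightarrow> l \<ge> N \<Longrightarrow> t \<in> {0..T} \<Longrightarrow>
        dist1 0 1 (\<lambda>x. U (d k) x t) (\<lambda>x. U (d l) x t) \<le> e"
      using cauchy[OF e] by blast
    have "dist1 0 1 (\<lambda>x. U (d k) x t) (g t) \<le> e" if k: "k \<ge> N" and t: "t \<in> {0..T}" for k t
    proof -
      obtain r where r: "strict_mono r" "(\<lambda>k. dist1 0 1 (\<lambda>x. U (d (r k)) x t) (g t)) \<longlonglongrightarrow> 0"
        using g(2)[OF t] by blast
      have "(\<lambda>l. e + dist1 0 1 (\<lambda>x. U (d (r l)) x t) (g t)) \<longlonglongrightarrow> e + 0"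
        by (intro tendsto_intros r)
      moreover have "\<exists>N. \<forall>l\<ge>N. dist1 0 1 (\<lambda>x. U (d k) x t) (g t) \<le> e + dist1 0 1 (\<lambda>x. U (d (r l)) x t) (g t)"
      proof (intro exI[of _ N] impI allI)
        fix l assume "N \<le> l"
        then have "r l \<ge> N" using seq_suble[OF r(1), of l] by linarith
        then show "dist1 0 1 (\<lambda>x. U (d k) x t) (g t) \<le> e + dist1 0 1 (\<lambda>x. U (d (r l)) x t) (g t)"
          using N[OF k _ t, of "r l"] dist1_triangle[OF si[OF t] si[OF t] set_integrable_bvr[OF g(1)[OF t]], of "d k" "d (r l)"]
          by linarith
      qed
      ultimately show ?thesis using LIMSEQ_le_const by fastforce
    qed
    then show ?thesis unfolding eventually_sequentially by blast
  qed
  then show ?thesis using d g(1) by (intro exI[of _ d] exI[of _ "\<lambda>x t. g t x"]) auto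
qed

text \<open>This recovers the values of a right continuous function from its integrals.\<close>
lemma right_average_tendsto:
  assumes f: "bvr C f" and x: "x < 1"
  shows "(\<lambda>m. (real m + 1) * (LBINT y:{x<..<min 1 (x + 1 / (real m + 1))}. f y)) \<longlonglongrightarrow> f x"
proof (rule LIMSEQ_I)
  fix e :: real assume e: "e > 0"
  have "\<forall>\<^sub>F y in at_right x. dist (f y) (f x) < e / 2"
    using bvr_right[OF f, of x] e unfolding tendsto_iff by (metis half_gt_zero)
  then obtain b where b: "b > x" "\<And>y. x < y \<Longrightarrow> y < b \<Longrightarrow> \<bar>f y - f x\<bar> < e / 2"
    unfolding eventually_at_right_field dist_real_def by blast
  obtain n :: nat where n: "real n > 1 / (min 1 b - x)" using reals_Archimedean2 by blast
  show "\<exists>no. \<forall>m\<ge>no. norm ((real m + 1) * (LBINT y:{x<..<min 1 (x + 1 / (real m + 1))}. f y) - f x) < e"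
  proof (intro exI[of _ n] allI impI)
    fix m assume "n \<le> m"
    then have gt: "real m + 1 > 1 / (min 1 b - x)" using n by linarith
    have m: "1 / (real m + 1) < min 1 b - x"
    proof -
      have "min 1 b - x > 0" using b(1) x by simp
      then have "1 < (real m + 1) * (min 1 b - x)" using gt by (simp only: pos_divide_less_eq)
      then show ?thesis by (simp add: pos_divide_less_eq mult.commute)
    qed
    define z where "z = x + 1 / (real m + 1)"
    have xz: "x < z" "z \<le> 1" "z \<le> b" using m by (auto simp: z_def)
    have c: "(LBINT y:{x<..<z}. c) = c / (real m + 1)" for c :: real
      using xz by (simp add: set_lebesgue_integral_def z_def)
    have ic: "set_integrable lborel {x<..<z} (\<lambda>_. c)" for c :: real
      by (rule set_integrable_bounded_interval[of _ _ _ "\<bar>c\<bar>"]) auto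
    have "(LBINT y:{x<..<z}. f y) - f x / (real m + 1) = (LBINT y:{x<..<z}. f y - f x)"
      using set_integral_diff(2)[OF set_integrable_bvr[OF f] ic[of "f x"]] c by simp
    also have "\<bar>\<dots>\<bar> \<le> (LBINT y:{x<..<z}. \<bar>f y - f x\<bar>)"
      using set_integral_norm_bound[OF set_integral_diff(1)[OF set_integrable_bvr[OF f] ic]] by simp
    also have "\<dots> \<le> (LBINT y:{x<..<z}. e / 2)"
      by (rule set_integral_mono)
         (use xz b(2) in \<open>auto intro!: ic set_integrable_abs set_integral_diff set_integrable_bvr[OF f] less_imp_le\<close>)
    also have "\<dots> < e / (real m + 1)" using c e by (simp add: field_simps)
    finally have "\<bar>(LBINT y:{x<..<z}. f y) - f x / (real m + 1)\<bar> * (real m + 1) < e"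
      by (simp add: field_simps)
    then have "\<bar>((LBINT y:{x<..<z}. f y) - f x / (real m + 1)) * (real m + 1)\<bar> < e"
      by (simp add: abs_mult)
    moreover have "((LBINT y:{x<..<z}. f y) - f x / (real m + 1)) * (real m + 1)
        = (real m + 1) * (LBINT y:{x<..<z}. f y) - f x"
      by (simp add: left_diff_distrib)
    moreover have "min 1 z = z" using xz by simp
    ultimately show "norm ((real m + 1) * (LBINT y:{x<..<min 1 (x + 1 / (real m + 1))}. f y) - f x) < e"
      unfolding z_def[symmetric] by simp
  qed
qed

text \<open>Convergence in \<open>L\<^sup>1\<close> at each single \<open>t\<close> leaves null sets that may depend on \<open>t\<close> and so says nothing
  about measurability in \<open>(x, t)\<close>. Averages over short intervals to the right of \<open>x\<close> do converge
  at every point: those of \<open>U k\<close> to those of \<open>u\<close>, and these to \<open>u\<close> itself by right continuity.\<close>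
lemma joint_measurability_of_limit:
  fixes U :: "nat \<Rightarrow> real \<Rightarrow> real \<Rightarrow> real"
  assumes [measurable]: "\<And>k. (\<lambda>(x, t). U k x t) \<in> borel_measurable (borel \<Otimes>\<^sub>M borel)"
    and U: "\<And>k t. t \<in> {0..T} \<Longrightarrow> bvr C (\<lambda>x. U k x t)" and u: "\<And>t. t \<in> {0..T} \<Longrightarrow> bvr C (\<lambda>x. u x t)"
    and lim: "\<And>t. t \<in> {0..T} \<Longrightarrow> (\<lambda>k. dist1 0 1 (\<lambda>x. U k x t) (\<lambda>x. u x t)) \<longlonglongrightarrow> 0"
  shows "(\<lambda>(x, t). if x \<in> {0..<1} \<and> t \<in> {0..T} then u x t else 0) \<in> borel_measurable (borel \<Otimes>\<^sub>M borel)"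
proof -
  define F where "F m k z = (if fst z \<in> {0..<1} \<and> snd z \<in> {0..T} then
     (real m + 1) * (LBINT y:{fst z<..<min 1 (fst z + 1 / (real m + 1))}. U k y (snd z)) else 0)" for m k and z :: "real \<times> real"
  define G where "G m z = (if fst z \<in> {0..<1} \<and> snd z \<in> {0..T} then
     (real m + 1) * (LBINT y:{fst z<..<min 1 (fst z + 1 / (real m + 1))}. u y (snd z)) else 0)" for m and z :: "real \<times> real"
  have F: "F m k \<in> borel_measurable (borel \<Otimes>\<^sub>M borel)" for m k
  proof -
    have "(\<lambda>(z, y). indicator {fst z<..<min 1 (fst z + 1 / (real m + 1))} y *\<^sub>R U k y (snd z))
       = (\<lambda>(z, y). (if fst z < y \<and> y < min 1 (fst z + 1 / (real m + 1)) then U k y (snd z) else 0))"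
      by (auto simp: fun_eq_iff indicator_def)
    also have "\<dots> \<in> borel_measurable ((borel \<Otimes>\<^sub>M borel) \<Otimes>\<^sub>M lborel)" by measurable
    finally have "(\<lambda>z. LBINT y:{fst z<..<min 1 (fst z + 1 / (real m + 1))}. U k y (snd z)) \<in> borel_measurable (borel \<Otimes>\<^sub>M borel)"
      unfolding set_lebesgue_integral_def by (rule lborel.borel_measurable_lebesgue_integral)
    then show ?thesis unfolding F_def[abs_def] by measurable
  qed
  have G: "G m \<in> borel_measurable (borel \<Otimes>\<^sub>M borel)" for m
  proof (rule borel_measurable_LIMSEQ_real[OF _ F])
    fix z :: "real \<times> real"
    show "(\<lambda>k. F m k z) \<longlonglongrightarrow> G m z"
    proof (cases "fst z \<in> {0..<1} \<and> snd z \<in> {0..T}")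
      case True
      let ?I = "{fst z<..<min 1 (fst z + 1 / (real m + 1))}"
      have "(\<lambda>k. (LBINT y:?I. U k y (snd z)) - (LBINT y:?I. u y (snd z))) \<longlonglongrightarrow> 0"
        by (rule Lim_null_comparison[OF _ lim[of "snd z"]])
           (use True in \<open>auto intro!: always_eventually set_integral_diff_le_dist1 set_integrable_bvr[OF U] set_integrable_bvr[OF u]\<close>)
      then have "(\<lambda>k. LBINT y:?I. U k y (snd z)) \<longlonglongrightarrow> (LBINT y:?I. u y (snd z))"
        by (simp add: LIM_zero_iff)
      then show ?thesis using True unfolding F_def G_def by (auto intro!: tendsto_intros)
    qed (auto simp: F_def G_def)
  qed
  show ?thesis
  proof (rule borel_measurable_LIMSEQ_real[OF _ G])
    fix z :: "real \<times> real"
    show "(\<lambda>m. G m z) \<longlonglongrightarrow> (case z of (x, t) \<Rightarrow> if x \<in> {0..<1} \<and> t \<in> {0..T} then u x t else 0)"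
    proof (cases "fst z \<in> {0..<1} \<and> snd z \<in> {0..T}")
      case True
      then show ?thesis using right_average_tendsto[OF u, of "snd z" "fst z"]
        by (auto simp: G_def split: prod.splits)
    qed (auto simp: G_def split: prod.splits)
  qed
qed

section \<open>Passing to the limit and localising in integrals\<close>

lemma continuous_imp_bounded_on_interval:
  fixes f :: "real \<Rightarrow> real"
  assumes "continuous_on UNIV f"
  shows "\<exists>g\<ge>0. \<forall>x\<in>{-r..r}. \<bar>f x\<bar> \<le> g"
proof -
  have "compact (f ` {-r..r})" by (intro compact_continuous_image continuous_on_subset[OF assms]) auto
  then obtain g where "\<forall>y\<in>f ` {-r..r}. norm y \<le> g" using compact_imp_bounded bounded_iff by metis
  then show ?thesis by (intro exI[of _ "max g 0"]) (auto simp: le_max_iff_disj)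
qed

lemma C1_imp_lipschitz_on_interval:
  fixes G G' :: "real \<Rightarrow> real"
  assumes d: "\<And>x. (G has_real_derivative G' x) (at x)" and c: "continuous_on UNIV G'"
  shows "\<exists>L\<ge>0. \<forall>x\<in>{-B..B}. \<forall>y\<in>{-B..B}. \<bar>G x - G y\<bar> \<le> L * \<bar>x - y\<bar>"
proof -
  have "compact (G' ` {-B..B})" by (intro compact_continuous_image continuous_on_subset[OF c]) auto
  then obtain L where L: "\<And>x. x \<in> {-B..B} \<Longrightarrow> \<bar>G' x\<bar> \<le> L"
    using compact_imp_bounded bounded_iff by (metis image_eqI real_norm_def)
  have "\<bar>G x - G y\<bar> \<le> max L 0 * \<bar>x - y\<bar>" if "x \<in> {-B..B}" "y \<in> {-B..B}" for x y
  proof -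
    have "norm (G x - G y) \<le> max L 0 * norm (x - y)"
      by (rule field_differentiable_bound[of "{-B..B}" G G'])
         (use d L that in \<open>auto intro: has_field_derivative_at_within order.trans[OF L]\<close>)
    then show ?thesis by simp
  qed
  then show ?thesis by (intro exI[of _ "max L 0"]) auto
qed

text \<open>The coefficients converge pointwise and the states in \<open>L\<^sup>1\<close>, so both are replaced by their limits
  one after the other: the states by the Lipschitz bound, the coefficients by bounded convergence.\<close>
lemma tendsto_integral_product:
  fixes A :: "nat \<Rightarrow> real \<Rightarrow> real"
  assumes mA: "\<And>k. A k \<in> borel_measurable borel" "A' \<in> borel_measurable borel"
    and bA: "\<And>k x. x \<in> {a<..<b} \<Longrightarrow> \<bar>A k x\<bar> \<le> K" and lA: "\<And>x. x \<in> {a<..<b} \<Longrightarrow> (\<lambda>k. A k x) \<longlonglongrightarrow> A' x"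
    and mU: "\<And>k. U k \<in> borel_measurable borel" "u \<in> borel_measurable borel"
    and bU: "\<And>k x. x \<in> {a<..<b} \<Longrightarrow> \<bar>U k x\<bar> \<le> B" "\<And>x. x \<in> {a<..<b} \<Longrightarrow> \<bar>u x\<bar> \<le> B"
    and lU: "(\<lambda>k. dist1 a b (U k) u) \<longlonglongrightarrow> 0"
    and G: "continuous_on UNIV G" "\<And>x y. x \<in> {-B..B} \<Longrightarrow> y \<in> {-B..B} \<Longrightarrow> \<bar>G x - G y\<bar> \<le> L * \<bar>x - y\<bar>"
    and L0: "L \<ge> 0"
  shows "(\<lambda>k. LBINT x:{a<..<b}. A k x * G (U k x)) \<longlonglongrightarrow> (LBINT x:{a<..<b}. A' x * G (u x))"
proof (cases "a < b")
  case False
  then show ?thesis by (simp add: set_lebesgue_integral_def)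
next
  case True
  have [measurable]: "G \<in> borel_measurable borel" using G(1) by (rule borel_measurable_continuous_onI)
  note [measurable] = mA mU
  have B0: "B \<ge> 0" using bU(2)[of "(a + b) / 2"] True by auto
  have K0: "K \<ge> 0" using bA[of "(a + b) / 2" 0] True by auto
  define g where "g = \<bar>G 0\<bar> + L * B"
  have gb: "\<bar>G x\<bar> \<le> g" if "\<bar>x\<bar> \<le> B" for x
  proof -
    have "\<bar>G x - G 0\<bar> \<le> L * \<bar>x\<bar>" using G(2)[of x 0] that B0 by (auto simp: abs_le_iff)
    moreover have "L * \<bar>x\<bar> \<le> L * B" using that L0 by (rule mult_left_mono)
    ultimately show ?thesis by (auto simp: g_def)
  qed
  have g0: "g \<ge> 0" using gb[of 0] B0 by auto
  have bA': "\<bar>A' x\<bar> \<le> K" if "x \<in> {a<..<b}" for x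
    using tendsto_rabs[OF lA[OF that]] bA[OF that] by (intro LIMSEQ_le_const2) auto
  have 1: "(\<lambda>k. LBINT x:{a<..<b}. A k x * G (u x)) \<longlonglongrightarrow> (LBINT x:{a<..<b}. A' x * G (u x))"
    by (rule set_dominated_convergence_interval[where B="K * g"])
       (use bA lA bU gb K0 in \<open>auto simp: abs_mult intro!: mult_mono tendsto_intros\<close>)
  have 2: "(\<lambda>k. (LBINT x:{a<..<b}. A k x * G (U k x)) - (LBINT x:{a<..<b}. A k x * G (u x))) \<longlonglongrightarrow> 0"
  proof (rule Lim_null_comparison)
    show "(\<lambda>k. K * L * dist1 a b (U k) u) \<longlonglongrightarrow> 0" using tendsto_mult_left[OF lU] by simp
    show "\<forall>\<^sub>F k in sequentially. norm ((LBINT x:{a<..<b}. A k x * G (U k x)) - (LBINT x:{a<..<b}. A k x * G (u x)))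
        \<le> K * L * dist1 a b (U k) u"
    proof (intro always_eventually allI)
      fix k
      have i1: "set_integrable lborel {a<..<b} (\<lambda>x. A k x * G (U k x))"
        by (rule set_integrable_bounded_interval[where B="K * g"])
           (use bA bU gb K0 in \<open>auto simp: abs_mult intro!: mult_mono\<close>)
      have i2: "set_integrable lborel {a<..<b} (\<lambda>x. A k x * G (u x))"
        by (rule set_integrable_bounded_interval[where B="K * g"])
           (use bA bU gb K0 in \<open>auto simp: abs_mult intro!: mult_mono\<close>)
      have i3: "set_integrable lborel {a<..<b} (\<lambda>x. \<bar>U k x - u x\<bar>)"
      proof (rule set_integrable_bounded_interval[where B="2 * B"])
        show "\<bar>\<bar>U k x - u x\<bar>\<bar> \<le> 2 * B" if "x \<in> {a<..<b}" for x
          using bU(1)[OF that, of k] bU(2)[OF that] by linarith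
      qed measurable
      have "(LBINT x:{a<..<b}. A k x * G (U k x)) - (LBINT x:{a<..<b}. A k x * G (u x))
          = (LBINT x:{a<..<b}. A k x * G (U k x) - A k x * G (u x))"
        by (rule set_integral_diff(2)[symmetric, OF i1 i2])
      also have "norm \<dots> \<le> (LBINT x:{a<..<b}. norm (A k x * G (U k x) - A k x * G (u x)))"
        by (rule set_integral_norm_bound[OF set_integral_diff(1)[OF i1 i2]])
      also have "\<dots> \<le> (LBINT x:{a<..<b}. K * L * \<bar>U k x - u x\<bar>)"
      proof (rule set_integral_mono)
        fix x assume x: "x \<in> {a<..<b}"
        have "\<bar>A k x\<bar> * \<bar>G (U k x) - G (u x)\<bar> \<le> K * (L * \<bar>U k x - u x\<bar>)"
          by (intro mult_mono bA x G(2)) (use bU x K0 in \<open>auto simp: abs_le_iff minus_le_iff\<close>)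
        then show "norm (A k x * G (U k x) - A k x * G (u x)) \<le> K * L * \<bar>U k x - u x\<bar>"
          by (simp add: right_diff_distrib[symmetric] abs_mult mult.assoc)
      next
        show "set_integrable lborel {a<..<b} (\<lambda>x. norm (A k x * G (U k x) - A k x * G (u x)))"
          using set_integrable_abs[OF set_integral_diff(1)[OF i1 i2]] by simp
        show "set_integrable lborel {a<..<b} (\<lambda>x. K * L * \<bar>U k x - u x\<bar>)"
          using i3 by (rule set_integrable_mult_right)
      qed
      also have "\<dots> = K * L * dist1 a b (U k) u" by (simp add: dist1_def)
      finally show "norm ((LBINT x:{a<..<b}. A k x * G (U k x)) - (LBINT x:{a<..<b}. A k x * G (u x)))
        \<le> K * L * dist1 a b (U k) u" .
    qed
  qed
  from tendsto_add[OF 2 1] show ?thesis by simp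
qed

text \<open>Nonnegative polynomials approximate nonnegative continuous functions (Stone-Weierstrass), and these
  approximate indicators of compact sets. Hence every compact subset of \<open>{h < 0}\<close> is null, and by inner
  regularity so is \<open>{h < 0}\<close>. Polynomials are convenient as weights in time because they are smooth.\<close>
lemma AE_nonneg_if_polynomial_tests_nonneg:
  fixes h :: "real \<Rightarrow> real"
  assumes ab: "a < b" and [measurable]: "h \<in> borel_measurable borel"
    and B: "\<And>t. t \<in> {a<..<b} \<Longrightarrow> \<bar>h t\<bar> \<le> B"
    and test: "\<And>p. real_polynomial_function p \<Longrightarrow> (\<And>t. t \<in> {a..b} \<Longrightarrow> 0 \<le> p t) \<Longrightarrow> 0 \<le> (LBINT t:{a<..<b}. p t * h t)"
  shows "AE t in lborel. t \<in> {a<..<b} \<longrightarrow> 0 \<le> h t"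
proof -
  have B0: "B \<ge> 0" using B[of "(a + b) / 2"] ab by auto
  have len: "(LBINT t:{a<..<b}. c) = c * (b - a)" for c :: real
    using ab by (simp add: set_lebesgue_integral_def)
  have cont: "0 \<le> (LBINT t:{a<..<b}. \<psi> t * h t)"
    if c: "continuous_on UNIV \<psi>" and nn: "\<And>t. 0 \<le> \<psi> t" and bd: "\<And>t. \<psi> t \<le> 1" for \<psi> :: "real \<Rightarrow> real"
  proof (rule ccontr)
    have [measurable]: "\<psi> \<in> borel_measurable borel" using c by (rule borel_measurable_continuous_onI)
    assume "\<not> ?thesis"
    then have neg: "(LBINT t:{a<..<b}. \<psi> t * h t) < 0" by simp
    define e where "e = - (LBINT t:{a<..<b}. \<psi> t * h t) / (4 * (B + 1) * (b - a))"
    have e: "e > 0" unfolding e_def using neg B0 ab by (intro divide_pos_pos mult_pos_pos) auto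
    \<comment> \<open>Lifting \<open>\<psi>\<close> by \<open>e\<close> keeps a polynomial that is \<open>e\<close>-close to it nonnegative; the value of \<open>e\<close> is
      chosen such that the error is at most half of the supposedly negative integral.\<close>
    have "continuous_on {a..b} (\<lambda>t. \<psi> t + e)" by (intro continuous_intros continuous_on_subset[OF c]) auto
    then obtain p where p: "real_polynomial_function p" "\<And>t. t \<in> {a..b} \<Longrightarrow> \<bar>\<psi> t + e - p t\<bar> < e"
      using Stone_Weierstrass_real_polynomial_function[of "{a..b}" "\<lambda>t. \<psi> t + e" e] e by auto
    have p0: "0 \<le> p t" if "t \<in> {a..b}" for t using p(2)[OF that] nn[of t] by linarith
    have [measurable]: "p \<in> borel_measurable borel"
      using p(1) real_polynomial_function_eq continuous_on_polymonial_function
      by (intro borel_measurable_continuous_onI) blast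
    have i1: "set_integrable lborel {a<..<b} (\<lambda>t. p t * h t)"
    proof (rule set_integrable_bounded_interval)
      fix t assume t: "t \<in> {a<..<b}"
      have "\<bar>p t\<bar> \<le> 1 + 2 * e" using p(2)[of t] t nn[of t] bd[of t] by auto
      then show "\<bar>p t * h t\<bar> \<le> (1 + 2 * e) * B" unfolding abs_mult using B[OF t] e by (intro mult_mono) auto
    qed auto
    have i2: "set_integrable lborel {a<..<b} (\<lambda>t. \<psi> t * h t + 2 * e * B)"
    proof (rule set_integrable_bounded_interval)
      fix t assume t: "t \<in> {a<..<b}"
      have "\<bar>\<psi> t\<bar> * \<bar>h t\<bar> \<le> 1 * B" using B[OF t] nn[of t] bd[of t] by (intro mult_mono) auto
      moreover have "0 \<le> 2 * e * B" using e B0 by simp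
      ultimately show "\<bar>\<psi> t * h t + 2 * e * B\<bar> \<le> B + 2 * e * B"
        using abs_triangle_ineq[of "\<psi> t * h t" "2 * e * B"] unfolding abs_mult[of "\<psi> t"] by linarith
    qed auto
    have i3: "set_integrable lborel {a<..<b} (\<lambda>t. \<psi> t * h t)" "set_integrable lborel {a<..<b} (\<lambda>t. 2 * e * B)"
    proof -
      show "set_integrable lborel {a<..<b} (\<lambda>t. 2 * e * B)"
        by (rule set_integrable_bounded_interval[where B="\<bar>2 * e * B\<bar>"]) auto
      from set_integral_diff(1)[OF i2 this] show "set_integrable lborel {a<..<b} (\<lambda>t. \<psi> t * h t)" by simp
    qed
    have "0 \<le> (LBINT t:{a<..<b}. p t * h t)" by (rule test[OF p(1) p0])
    also have "\<dots> \<le> (LBINT t:{a<..<b}. \<psi> t * h t + 2 * e * B)"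
    proof (rule set_integral_mono[OF i1 i2])
      fix t assume t: "t \<in> {a<..<b}"
      have "\<bar>p t - \<psi> t\<bar> \<le> 2 * e" using p(2)[of t] t by auto
      then have "\<bar>p t - \<psi> t\<bar> * \<bar>h t\<bar> \<le> 2 * e * B" using B[OF t] e by (intro mult_mono) auto
      then have "(p t - \<psi> t) * h t \<le> 2 * e * B" by (simp add: abs_mult[symmetric] abs_le_iff)
      then show "p t * h t \<le> \<psi> t * h t + 2 * e * B" by (simp add: algebra_simps)
    qed
    also have "\<dots> = (LBINT t:{a<..<b}. \<psi> t * h t) + 2 * e * B * (b - a)"
      using set_integral_add(2)[OF i3] len by simp
    also have "2 * e * B * (b - a) \<le> 2 * e * (B + 1) * (b - a)"
      using e B0 ab by (intro mult_right_mono mult_left_mono) auto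
    also have "2 * e * (B + 1) * (b - a) = - (LBINT t:{a<..<b}. \<psi> t * h t) / 2"
    proof -
      have "4 * (B + 1) * (b - a) \<noteq> 0" using B0 ab by auto
      then have "e * (4 * (B + 1) * (b - a)) = - (LBINT t:{a<..<b}. \<psi> t * h t)"
        unfolding e_def by (rule nonzero_eq_divide_eq[THEN iffD1]) simp
      then show ?thesis by (simp add: algebra_simps)
    qed
    finally show False using neg by simp
  qed
  have compact_nonneg: "0 \<le> (LBINT t:{a<..<b}. indicator K t * h t)" if K: "compact K" "K \<noteq> {}" for K
  proof -
    have [measurable]: "K \<in> sets borel" using K by (simp add: borel_compact)
    define \<psi> where "\<psi> m t = max 0 (1 - real m * infdist t K)" for m t
    have cm: "continuous_on UNIV (\<psi> m)" for m unfolding \<psi>_def[abs_def] by (intro continuous_intros)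
    have [measurable]: "\<psi> m \<in> borel_measurable borel" for m using cm by (rule borel_measurable_continuous_onI)
    have b01: "0 \<le> \<psi> m t" "\<psi> m t \<le> 1" for m t by (auto simp: \<psi>_def infdist_nonneg)
    have lim: "(\<lambda>m. \<psi> m t) \<longlonglongrightarrow> indicator K t" for t
    proof (cases "t \<in> K")
      case False
      then have d: "infdist t K > 0"
        using in_closed_iff_infdist_zero[of K t] K infdist_nonneg[of t K] by (auto simp: compact_imp_closed less_le)
      obtain n :: nat where n: "1 / infdist t K < real n" using reals_Archimedean2 by blast
      have "\<psi> m t = 0" if "m \<ge> n" for m
      proof -
        have "1 / infdist t K \<le> real m" using n that by linarith
        then show ?thesis using d by (simp add: \<psi>_def field_simps)
      qed
      then have "\<forall>\<^sub>F m in sequentially. \<psi> m t = indicator K t"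
        using False unfolding eventually_sequentially by (intro exI[of _ n]) simp
      then show ?thesis by (rule tendsto_eventually)
    qed (simp add: \<psi>_def)
    have "(\<lambda>m. LBINT t:{a<..<b}. \<psi> m t * h t) \<longlonglongrightarrow> (LBINT t:{a<..<b}. indicator K t * h t)"
    proof (rule set_dominated_convergence_interval[where B=B])
      show "\<bar>\<psi> m t * h t\<bar> \<le> B" if "t \<in> {a<..<b}" for m t
        using B[OF that] b01[of m t] mult_mono[of "\<bar>\<psi> m t\<bar>" 1 "\<bar>h t\<bar>" B] by (simp add: abs_mult)
    qed (auto intro!: tendsto_mult lim)
    then show ?thesis using cont[OF cm b01] by (intro LIMSEQ_le_const) auto
  qed
  define A where "A = {t \<in> {a<..<b}. h t < 0}"
  have A[measurable]: "A \<in> sets borel" unfolding A_def by measurable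
  define M where "M = density lborel (indicator {a<..<b} :: real \<Rightarrow> ennreal)"
  have eM: "emeasure M X = emeasure lborel ({a<..<b} \<inter> X)" if "X \<in> sets borel" for X
    using that unfolding M_def by (subst emeasure_density) (auto simp: indicator_inter_arith[symmetric] simp del: indicator_inter_arith)
  have null: "emeasure M K = 0" if K: "K \<subseteq> A" "compact K" for K
  proof (cases "K = {}")
    case False
    have [measurable]: "K \<in> sets borel" using K by (simp add: borel_compact)
    have int: "integrable lborel (\<lambda>t. indicator {a<..<b} t *\<^sub>R (indicator K t * h t))"
      using set_integrable_bounded_interval[of "\<lambda>t. indicator K t * h t" a b B] B B0
      by (auto simp: set_integrable_def indicator_def)
    have "0 \<le> (LINT t|lborel. indicator {a<..<b} t *\<^sub>R (indicator K t * h t))"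
      using compact_nonneg[OF K(2) False] by (simp add: set_lebesgue_integral_def)
    moreover have "0 \<le> (LINT t|lborel. - (indicator {a<..<b} t *\<^sub>R (indicator K t * h t)))"
      by (rule integral_nonneg_AE) (use K A_def in \<open>auto simp: indicator_def less_imp_le subset_iff intro!: AE_I2\<close>)
    ultimately have "(LINT t|lborel. - (indicator {a<..<b} t *\<^sub>R (indicator K t * h t))) = 0" by simp
    then have "AE t in lborel. - (indicator {a<..<b} t *\<^sub>R (indicator K t * h t)) = 0"
      by (subst (asm) integral_nonneg_eq_0_iff_AE)
         (use int K A_def in \<open>auto simp: indicator_def mult_nonneg_nonpos less_imp_le subset_iff intro!: AE_I2\<close>)
    then have "AE t in lborel. t \<notin> K"
      by eventually_elim (use K A_def in \<open>auto simp: indicator_def split: if_splits\<close>)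
    then have "emeasure lborel K = 0" by (simp add: AE_iff_measurable[OF _ refl])
    moreover have "{a<..<b} \<inter> K = K" using K A_def by auto
    ultimately show ?thesis by (simp add: eM)
  qed simp
  have "emeasure M A = (SUP K\<in>{K. K \<subseteq> A \<and> compact K}. emeasure M K)"
    by (rule inner_regular) (use eM[of UNIV] emeasure_Ioo_finite[of a b] in \<open>auto simp: M_def\<close>)
  also have "\<dots> = (SUP K\<in>{K. K \<subseteq> A \<and> compact K}. 0)" by (intro SUP_cong refl null) auto
  also have "\<dots> = 0" by (simp add: SUP_constant bot_ennreal)
  finally have "emeasure lborel A = 0"
    by (simp add: eM A_def Int_absorb1 Int_def conj_ac cong: conj_cong)
  then have "A \<in> null_sets lborel" by auto
  from AE_not_in[OF this] show ?thesis by eventually_elim (auto simp: A_def)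
qed

text \<open>The kernel is minus the derivative of the cut-off function \<open>(1 - x)^(m+1)\<close>, which drops from 1 to 0.\<close>
lemma integral_power_kernel: "(LBINT x:{0<..<1}. (real m + 1) * (1 - x) ^ m) = (1 :: real)"
proof -
  have d: "((\<lambda>x. - ((1 - x) ^ Suc m)) has_real_derivative (real m + 1) * (1 - x) ^ m) (at x)" for x :: real
    by (rule derivative_eq_intros refl | simp)+
  have "interval_lebesgue_integral lborel (ereal 0) (ereal 1) (\<lambda>x. (real m + 1) * (1 - x) ^ m)
      = - ((1 - 1) ^ Suc m) - (- ((1 - 0) ^ Suc m))"
  proof (rule interval_integral_FTC_finite)
    fix x :: real
    show "((\<lambda>x. - ((1 - x) ^ Suc m)) has_vector_derivative (real m + 1) * (1 - x) ^ m) (at x within {min 0 1..max 0 1})"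
      using has_field_derivative_at_within[OF d] by (simp add: has_real_derivative_iff_has_vector_derivative)
  qed (intro continuous_intros)
  then show ?thesis by (simp add: interval_integral_Ioo)
qed

text \<open>The kernel has mass 1 and tends to 0 uniformly away from 0.\<close>
lemma power_kernel_concentrates_at_0:
  assumes [measurable]: "g \<in> borel_measurable borel" and B: "\<And>x. x \<in> {0<..<1} \<Longrightarrow> \<bar>g x\<bar> \<le> B"
    and lim: "(g \<longlongrightarrow> l) (at_right 0)"
  shows "(\<lambda>m. LBINT x:{0<..<1}. (real m + 1) * (1 - x) ^ m * g x) \<longlonglongrightarrow> (l :: real)"
proof -
  have B0: "B \<ge> 0" using B[of "1 / 2"] by auto
  define k where "k m x = (real m + 1) * (1 - x) ^ m" for m :: nat and x :: real
  have [measurable]: "k m \<in> borel_measurable borel" for m unfolding k_def by measurable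
  have kb: "0 \<le> k m x" "k m x \<le> real m + 1" if "x \<in> {0<..<1}" for m x
    using that by (auto simp: k_def mult_left_le power_le_one)
  have i: "set_integrable lborel {0<..<1} (\<lambda>x. k m x * f x)"
    if [measurable]: "f \<in> borel_measurable borel" and f: "\<And>x. x \<in> {0<..<1} \<Longrightarrow> \<bar>f x\<bar> \<le> c" for f m c
  proof (rule set_integrable_bounded_interval[where B="(real m + 1) * c"])
    fix x :: real assume x: "x \<in> {0<..<1}"
    show "\<bar>k m x * f x\<bar> \<le> (real m + 1) * c"
      unfolding abs_mult using kb[OF x, of m] f[OF x] by (intro mult_mono) auto
  qed auto
  have ik: "(LBINT x:{0<..<1}. k m x * c) = c" for c m
    using integral_power_kernel[of m] by (simp add: k_def)
  show ?thesis unfolding k_def[symmetric]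
  proof (rule LIMSEQ_I)
    fix e :: real assume e: "e > 0"
    have "\<forall>\<^sub>F y in at_right 0. dist (g y) l < e / 2"
      using lim e unfolding tendsto_iff by (metis half_gt_zero)
    then obtain b where b: "b > 0" "\<And>y. 0 < y \<Longrightarrow> y < b \<Longrightarrow> \<bar>g y - l\<bar> < e / 2"
      unfolding eventually_at_right_field dist_real_def by blast
    define d where "d = min b (1 / 2)"
    define c where "c = B + \<bar>l\<bar>"
    have d: "0 < d" "d < 1" "d \<le> b" using b by (auto simp: d_def)
    have "(\<lambda>m. (real m + 1) * (1 - d) ^ m * c) \<longlonglongrightarrow> 0 * c"
    proof (intro tendsto_mult tendsto_const)
      have "(\<lambda>m. real m * (1 - d) ^ m + (1 - d) ^ m) \<longlonglongrightarrow> 0 + 0"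
        using d by (intro tendsto_add powser_times_n_limit_0 LIMSEQ_realpow_zero) auto
      then show "(\<lambda>m. (real m + 1) * (1 - d) ^ m) \<longlonglongrightarrow> 0" by (simp add: distrib_right)
    qed
    then have "\<forall>\<^sub>F m in sequentially. (real m + 1) * (1 - d) ^ m * c < e / 2"
      using e by (intro order_tendstoD(2)) auto
    then obtain M where M: "\<And>m. m \<ge> M \<Longrightarrow> (real m + 1) * (1 - d) ^ m * c < e / 2"
      unfolding eventually_sequentially by blast
    show "\<exists>M. \<forall>m\<ge>M. norm ((LBINT x:{0<..<1}. k m x * g x) - l) < e"
    proof (intro exI allI impI)
      fix m assume m: "M \<le> m"
      define r where "r = (real m + 1) * (1 - d) ^ m * c"
      have r: "r < e / 2" "r \<ge> 0" using M[OF m] d B0 by (auto simp: r_def c_def)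
      have il: "set_integrable lborel {0<..<1} (\<lambda>x. k m x * l)" by (rule i[of _ "\<bar>l\<bar>"]) auto
      have ig: "set_integrable lborel {0<..<1} (\<lambda>x. k m x * g x)" by (rule i[OF _ B]) auto
      have ie: "set_integrable lborel {0<..<1} (\<lambda>x. k m x * (e / 2))" by (rule i[of _ "\<bar>e / 2\<bar>"]) auto
      have ir: "set_integrable lborel {0<..<1} (\<lambda>x::real. r)"
        by (rule set_integrable_bounded_interval[where B="\<bar>r\<bar>"]) auto
      have "(LBINT x:{0<..<1}. k m x * g x) - l = (LBINT x:{0<..<1}. k m x * g x - k m x * l)"
        using set_integral_diff(2)[OF ig il] ik by simp
      also have "norm \<dots> \<le> (LBINT x:{0<..<1}. norm (k m x * g x - k m x * l))"
        by (rule set_integral_norm_bound[OF set_integral_diff(1)[OF ig il]])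
      also have "\<dots> \<le> (LBINT x:{0<..<1}. k m x * (e / 2) + r)"
      proof (rule set_integral_mono)
        fix x :: real assume x: "x \<in> {0<..<1}"
        have "norm (k m x * g x - k m x * l) = k m x * \<bar>g x - l\<bar>"
          using kb(1)[OF x, of m] by (simp add: right_diff_distrib[symmetric] abs_mult)
        also have "\<dots> \<le> k m x * (e / 2) + r"
        proof (cases "x < d")
          case True
          then have "k m x * \<bar>g x - l\<bar> \<le> k m x * (e / 2)"
            using b(2)[of x] d x kb(1)[OF x, of m] by (intro mult_left_mono) auto
          then show ?thesis using r by linarith
        next
          case False
          have "\<bar>g x - l\<bar> \<le> c" using B[OF x] by (auto simp: c_def)
          moreover have "k m x \<le> (real m + 1) * (1 - d) ^ m"
            unfolding k_def using False x by (intro mult_left_mono power_mono) auto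
          ultimately have "k m x * \<bar>g x - l\<bar> \<le> r"
            unfolding r_def using kb(1)[OF x, of m] d by (intro mult_mono) auto
          then show ?thesis using kb(1)[OF x, of m] e by (simp add: add_increasing)
        qed
        finally show "norm (k m x * g x - k m x * l) \<le> k m x * (e / 2) + r" .
      qed (use ig il ie ir in \<open>auto intro!: set_integral_diff set_integral_add set_integrable_abs\<close>)
      also have "\<dots> = e / 2 + r"
        using set_integral_add(2)[OF ie ir] ik[of m "e / 2"] by (simp add: set_lebesgue_integral_def)
      finally show "norm ((LBINT x:{0<..<1}. k m x * g x) - l) < e" using r by linarith
    qed
  qed
qed

lemma set_integral_reflect_unit_interval:
  fixes f :: "real \<Rightarrow> real"
  shows "(LBINT x:{0<..<1}. f (1 - x)) = (LBINT x:{0<..<1}. f x)"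
proof -
  have "(LINT x|lborel. indicator {0<..<1} x *\<^sub>R f x) = \<bar>-1\<bar> *\<^sub>R (LINT x|lborel. indicator {0<..<1} (1 + (-1) * x) *\<^sub>R f (1 + (-1) * x))"
    by (rule lborel_integral_real_affine) simp
  also have "(\<lambda>x. indicator {0<..<1} (1 + (-1) * x) *\<^sub>R f (1 + (-1) * x)) = (\<lambda>x. indicator {0<..<1} x *\<^sub>R f (1 - x))"
    by (auto simp: indicator_def fun_eq_iff)
  finally show ?thesis by (simp add: set_lebesgue_integral_def)
qed

lemma power_kernel_concentrates_at_1:
  assumes [measurable]: "g \<in> borel_measurable borel" and B: "\<And>x. x \<in> {0<..<1} \<Longrightarrow> \<bar>g x\<bar> \<le> B"
    and lim: "(g \<longlongrightarrow> l) (at_left 1)"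
  shows "(\<lambda>m. LBINT x:{0<..<1}. (real m + 1) * x ^ m * g x) \<longlonglongrightarrow> (l :: real)"
proof -
  have "((\<lambda>x. g (1 - x)) \<longlongrightarrow> l) (at_right 0)"
  proof (rule filterlim_compose[OF lim])
    show "filterlim (\<lambda>x. 1 - x :: real) (at_left 1) (at_right 0)"
      unfolding filterlim_at by (auto intro!: tendsto_eq_intros simp: eventually_at_filter)
  qed
  then have "(\<lambda>m. LBINT x:{0<..<1}. (real m + 1) * (1 - x) ^ m * g (1 - x)) \<longlonglongrightarrow> l"
    by (intro power_kernel_concentrates_at_0[of _ B]) (auto intro: B)
  then show ?thesis
    using set_integral_reflect_unit_interval[of "\<lambda>x. (real _ + 1) * x ^ _ * g x"] by simp
qed

section \<open>Stability of the scheme\<close>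

lemma abs_le_four_terms: "x = a + b - c + d \<Longrightarrow> \<bar>d\<bar> \<le> e \<Longrightarrow> \<bar>x\<bar> \<le> \<bar>a\<bar> + \<bar>b\<bar> + \<bar>c\<bar> + (e :: real)"
  by linarith

lemma abs_le_five_terms:
  "x = a - b - c + d - y \<Longrightarrow> \<bar>d\<bar> \<le> e \<Longrightarrow> \<bar>x\<bar> \<le> \<bar>a\<bar> + \<bar>b\<bar> + \<bar>c\<bar> + e + \<bar>y :: real\<bar>"
  "x = a + b + c - d + y \<Longrightarrow> \<bar>d\<bar> \<le> e \<Longrightarrow> \<bar>x\<bar> \<le> \<bar>a\<bar> + \<bar>b\<bar> + \<bar>c\<bar> + e + \<bar>y\<bar>"
  by linarith+

locale split_flux =
  fixes F1 F2 F1' F2' :: "real \<Rightarrow> real" and lam :: real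
  assumes lam: "lam > 0"
    and dF1: "\<And>x. (F1 has_real_derivative F1' x) (at x)" and dF2: "\<And>x. (F2 has_real_derivative F2' x) (at x)"
    and F1'_nonneg: "\<And>x. 0 \<le> F1' x" and F2'_nonpos: "\<And>x. F2' x \<le> 0"
    and cfl: "\<And>x. lam * (F1' x - F2' x) \<le> 1"
begin

text \<open>The part of the update that depends on the cell's own value.\<close>
definition G :: "real \<Rightarrow> real" where "G x = x - lam * (F1 x - F2 x)"

lemma dG: "(G has_real_derivative 1 - lam * (F1' x - F2' x)) (at x)"
  unfolding G_def by (auto intro!: derivative_eq_intros dF1 dF2)

lemma mono_F1: "mono F1"
  by (rule monoI, rule DERIV_nonneg_imp_nondecreasing) (use dF1 F1'_nonneg in auto)

lemma antimono_F2: "antimono F2"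
  by (rule antimonoI, rule DERIV_nonpos_imp_nonincreasing) (use dF2 F2'_nonpos in auto)

lemma mono_G: "mono G"
  by (rule monoI, rule DERIV_nonneg_imp_nondecreasing) (use dG cfl in \<open>auto intro!: exI\<close>)

text \<open>The three functions \<open>G\<close>, \<open>lam * F1\<close> and \<open>- lam * F2\<close> are nondecreasing and add up to the identity, so
  their increments all have the sign of \<open>x - y\<close>.\<close>
lemma abs_split:
  "\<bar>G x - G y\<bar> + lam * \<bar>F1 x - F1 y\<bar> + lam * \<bar>F2 x - F2 y\<bar> = \<bar>x - y\<bar>"
proof -
  have "\<bar>G x - G y\<bar> + lam * \<bar>F1 x - F1 y\<bar> + lam * \<bar>F2 x - F2 y\<bar> = \<bar>x - y\<bar>" if "y \<le> x" for x y
  proof -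
    have "G y \<le> G x" "F1 y \<le> F1 x" "F2 x \<le> F2 y"
      using that mono_G mono_F1 antimono_F2 by (auto dest: monoD antimonoD)
    then have "\<bar>G x - G y\<bar> + lam * \<bar>F1 x - F1 y\<bar> + lam * \<bar>F2 x - F2 y\<bar>
        = (G x - G y) + lam * (F1 x - F1 y) + lam * (F2 y - F2 x)" by simp
    also have "\<dots> = x - y" by (simp add: G_def algebra_simps)
    finally show ?thesis using that by simp
  qed
  from this[of x y] this[of y x] show ?thesis by (cases "y \<le> x") (auto simp: abs_minus_commute)
qed

lemma lam_F_le: "\<bar>lam * (F1 x - F1 y)\<bar> \<le> \<bar>x - y\<bar>" "\<bar>lam * (F2 x - F2 y)\<bar> \<le> \<bar>x - y\<bar>"
proof -
  have "0 \<le> lam * \<bar>F1 x - F1 y\<bar>" "0 \<le> lam * \<bar>F2 x - F2 y\<bar>" using lam by auto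
  then have "lam * \<bar>F1 x - F1 y\<bar> \<le> \<bar>x - y\<bar>" "lam * \<bar>F2 x - F2 y\<bar> \<le> \<bar>x - y\<bar>"
    using abs_split[of x y] abs_ge_zero[of "G x - G y"] by linarith+
  then show "\<bar>lam * (F1 x - F1 y)\<bar> \<le> \<bar>x - y\<bar>" "\<bar>lam * (F2 x - F2 y)\<bar> \<le> \<bar>x - y\<bar>"
    using lam by (auto simp: abs_mult)
qed

end

text \<open>A Gronwall bound for growth by a factor \<open>1 + \<gamma> * dt\<close> in each of \<open>T / dt\<close> steps.\<close>
definition sup_bound :: "real \<Rightarrow> real \<Rightarrow> real \<Rightarrow> real" where
  "sup_bound R \<gamma> T = R * exp (\<gamma> * T)"

text \<open>The initial data and the data at both ends contribute \<open>W\<close> each; the source contributes at most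
  \<open>3 * \<gamma> * dt * sup_bound R \<gamma> T\<close> in each time step.\<close>
definition variation_bound :: "real \<Rightarrow> real \<Rightarrow> real \<Rightarrow> real \<Rightarrow> real" where
  "variation_bound W R \<gamma> T = 3 * W + 3 * \<gamma> * T * sup_bound R \<gamma> T"

text \<open>One run of the scheme, reduced to what the estimates depend on: the update rule in the interior and
  bounds for the size and the variation of the initial and the boundary values. With \<open>N \<ge> 2\<close> there
  is at least one interior cell.\<close>
locale scheme_grid = split_flux F1 F2 F1' F2' lam
  for F1 F2 F1' F2' :: "real \<Rightarrow> real" and lam :: real +
  fixes \<gamma> T R W :: real and N M :: nat and v :: "nat \<Rightarrow> nat \<Rightarrow> real"
  assumes N: "2 \<le> N" and \<gamma>: "\<gamma> > 0" and T: "(real M + 1) * (lam / real N) = T"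
    and update: "\<And>n j. n \<le> M \<Longrightarrow> 1 \<le> j \<Longrightarrow> j < N \<Longrightarrow> v (Suc n) j = v n j
       - lam * ((F1 (v n j) + F2 (v n (j + 1))) - (F1 (v n (j - 1)) + F2 (v n j)))
       + \<gamma> * (lam / real N) * P_disc N (v n) j"
    and bound_init: "\<And>j. j \<le> N \<Longrightarrow> \<bar>v 0 j\<bar> \<le> R"
    and bound_bdry: "\<And>n. n \<le> Suc M \<Longrightarrow> \<bar>v n 0\<bar> \<le> R" "\<And>n. n \<le> Suc M \<Longrightarrow> \<bar>v n N\<bar> \<le> R"
    and var_init: "(\<Sum>j<N. \<bar>v 0 (Suc j) - v 0 j\<bar>) \<le> W"
    and var_bdry: "(\<Sum>n<Suc M. \<bar>v (Suc n) 0 - v n 0\<bar>) \<le> W" "(\<Sum>n<Suc M. \<bar>v (Suc n) N - v n N\<bar>) \<le> W"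
begin

abbreviation "h \<equiv> 1 / real N"
abbreviation "\<tau> \<equiv> lam / real N"
abbreviation "K \<equiv> sup_bound R \<gamma> T"
abbreviation "V \<equiv> variation_bound W R \<gamma> T"

lemma h_pos: "h > 0" and \<tau>_pos: "\<tau> > 0"
  using N lam by auto

lemma g0: "0 \<le> \<gamma> * \<tau>"
  by (rule mult_nonneg_nonneg) (use \<gamma> \<tau>_pos in \<open>simp_all add: less_imp_le\<close>)

lemma R_nonneg: "R \<ge> 0" using bound_init[of 0] by auto

lemma T_pos: "T > 0"
  unfolding T[symmetric] using \<tau>_pos by (intro mult_pos_pos) auto

lemma update_G:
  assumes "n \<le> M" "1 \<le> j" "j < N"
  shows "v (Suc n) j = G (v n j) + lam * F1 (v n (j - 1)) - lam * F2 (v n (j + 1)) + \<gamma> * \<tau> * P_disc N (v n) j"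
  unfolding update[OF assms] G_def by (simp add: algebra_simps)

text \<open>The weights of the trapezoidal sum add up to \<open>j / N \<le> 1\<close>.\<close>
lemma P_disc_bound:
  assumes b: "\<And>i. i \<le> N \<Longrightarrow> \<bar>w i\<bar> \<le> B" and j: "1 \<le> j" "j \<le> N"
  shows "\<bar>P_disc N w j\<bar> \<le> B"
proof -
  have "\<bar>w 0 / 2 + (\<Sum>i = 1..j - 1. w i) + w j / 2\<bar> \<le> \<bar>w 0\<bar> / 2 + (\<Sum>i = 1..j - 1. \<bar>w i\<bar>) + \<bar>w j\<bar> / 2"
    using sum_abs[of w "{1..j - 1}"] by linarith
  also have "\<dots> \<le> B / 2 + (\<Sum>i = 1..j - 1. B) + B / 2"
    using j by (intro add_mono sum_mono divide_right_mono b) auto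
  also have "\<dots> = real j * B" using j by (simp add: of_nat_diff algebra_simps)
  also have "\<dots> \<le> real N * B" using j b[of 0] by (intro mult_right_mono) auto
  finally have "\<bar>w 0 / 2 + (\<Sum>i = 1..j - 1. w i) + w j / 2\<bar> \<le> real N * B" .
  then show ?thesis using N by (simp add: P_disc_def abs_mult field_simps)
qed

text \<open>Apart from the source the update is nondecreasing in its three arguments and maps a constant to
  itself, so it preserves the bounds \<open>B\<close> and \<open>- B\<close>; the source adds at most \<open>\<gamma> * \<tau> * B\<close>.\<close>
lemma bound_growth: "n \<le> Suc M \<Longrightarrow> j \<le> N \<Longrightarrow> \<bar>v n j\<bar> \<le> R * (1 + \<gamma> * \<tau>) ^ n"
proof (induction n arbitrary: j)
  case 0
  then show ?case using bound_init by simp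
next
  case (Suc n)
  define B where "B = R * (1 + \<gamma> * \<tau>) ^ n"
  have IH: "\<bar>v n i\<bar> \<le> B" if "i \<le> N" for i using Suc that by (auto simp: B_def)
  have RB: "R \<le> R * (1 + \<gamma> * \<tau>) ^ Suc n"
    using R_nonneg g0 one_le_power[of "1 + \<gamma> * \<tau>" "Suc n"] by (intro mult_le_cancel_left1[THEN iffD2]) auto
  consider "j = 0" | "j = N" | "1 \<le> j" "j < N" using Suc.prems by linarith
  then show ?case
  proof cases
    case 3
    have n: "n \<le> M" using Suc.prems by simp
    have up: "G x + lam * F1 y - lam * F2 z \<le> B" if "x \<le> B" "y \<le> B" "z \<le> B" for x y z
    proof -
      have "G x \<le> G B" "lam * F1 y \<le> lam * F1 B" "lam * F2 B \<le> lam * F2 z"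
        using that lam mono_G mono_F1 antimono_F2 by (auto dest: monoD antimonoD)
      then show ?thesis by (simp add: G_def algebra_simps)
    qed
    have lo: "- B \<le> G x + lam * F1 y - lam * F2 z" if "- B \<le> x" "- B \<le> y" "- B \<le> z" for x y z
    proof -
      have "G (- B) \<le> G x" "lam * F1 (- B) \<le> lam * F1 y" "lam * F2 z \<le> lam * F2 (- B)"
        using that lam mono_G mono_F1 antimono_F2 by (auto dest: monoD antimonoD)
      then show ?thesis by (simp add: G_def algebra_simps)
    qed
    have "j - 1 \<le> N" using 3 by linarith
    then have IHs: "\<bar>v n j\<bar> \<le> B" "\<bar>v n (j - 1)\<bar> \<le> B" "\<bar>v n (j + 1)\<bar> \<le> B"
      using 3 by (auto intro: IH)
    have "\<bar>G (v n j) + lam * F1 (v n (j - 1)) - lam * F2 (v n (j + 1))\<bar> \<le> B"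
    proof (rule abs_leI)
      show "G (v n j) + lam * F1 (v n (j - 1)) - lam * F2 (v n (j + 1)) \<le> B"
        using IHs by (intro up) auto
      have "- B \<le> G (v n j) + lam * F1 (v n (j - 1)) - lam * F2 (v n (j + 1))"
        using IHs by (intro lo) auto
      then show "- (G (v n j) + lam * F1 (v n (j - 1)) - lam * F2 (v n (j + 1))) \<le> B" by linarith
    qed
    moreover have "\<bar>\<gamma> * \<tau> * P_disc N (v n) j\<bar> \<le> \<gamma> * \<tau> * B"
      using g0 P_disc_bound[of "v n" B j] IH 3 by (simp only: abs_mult[of "\<gamma> * \<tau>"] abs_of_nonneg) (intro mult_left_mono, auto)
    ultimately have "\<bar>v (Suc n) j\<bar> \<le> B + \<gamma> * \<tau> * B"
      unfolding update_G[OF n 3] by linarith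
    then show ?thesis by (simp add: B_def algebra_simps)
  next
    case 1
    then show ?thesis using bound_bdry(1)[of "Suc n"] Suc.prems RB by simp
  next
    case 2
    then show ?thesis using bound_bdry(2)[of "Suc n"] Suc.prems RB by simp
  qed
qed

lemma bound: "n \<le> Suc M \<Longrightarrow> j \<le> N \<Longrightarrow> \<bar>v n j\<bar> \<le> K"
proof -
  assume n: "n \<le> Suc M" and j: "j \<le> N"
  have "(1 + \<gamma> * \<tau>) ^ n \<le> (1 + \<gamma> * \<tau>) ^ Suc M" using n g0 by (intro power_increasing) auto
  also have "\<dots> \<le> exp (\<gamma> * \<tau>) ^ Suc M" using g0 by (intro power_mono exp_ge_add_one_self) auto
  also have "\<dots> = exp (\<gamma> * T)" unfolding exp_of_nat_mult[symmetric] T[symmetric] by (simp add: algebra_simps)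
  finally have "R * (1 + \<gamma> * \<tau>) ^ n \<le> K" unfolding sup_bound_def using R_nonneg by (rule mult_left_mono)
  then show ?thesis using bound_growth[OF n j] by linarith
qed

lemma K_nonneg: "0 \<le> K" using R_nonneg by (simp add: sup_bound_def)

lemma P_bound: "n \<le> Suc M \<Longrightarrow> 1 \<le> j \<Longrightarrow> j \<le> N \<Longrightarrow> \<bar>P_disc N (v n) j\<bar> \<le> K"
  by (rule P_disc_bound) (auto intro: bound)

text \<open>By \<open>abs_split\<close> the increment of \<open>v n\<close> across a face consists of three parts \<open>g\<close>, \<open>a\<close> and \<open>b\<close>. In the
  update the \<open>g\<close> part remains at its face, the \<open>a\<close> part (from \<open>F1\<close>) moves one face to the right and
  the \<open>b\<close> part (from \<open>F2\<close>) one face to the left, except that parts which would leave the interval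
  are counted at the outermost faces. So each part is counted once in the new variation. What comes in addition are the changes of the boundary values and the source: \<open>\<gamma> * \<tau> * K\<close> at each of
  the two outermost faces, and another \<open>\<gamma> * \<tau> * K\<close> for all other faces together, because
  neighbouring values of \<open>P_disc\<close> differ by at most \<open>h * K\<close>.\<close>
lemma variation_step:
  assumes n: "n \<le> M"
  shows "(\<Sum>j<N. \<bar>v (Suc n) (Suc j) - v (Suc n) j\<bar>)
     \<le> (\<Sum>j<N. \<bar>v n (Suc j) - v n j\<bar>) + 3 * \<gamma> * \<tau> * K
        + \<bar>v (Suc n) 0 - v n 0\<bar> + \<bar>v (Suc n) N - v n N\<bar>"
proof -
  obtain m where m: "N = Suc (Suc m)" using N by (metis Suc_le_D numeral_2_eq_2 Suc_le_mono)
  define g where "g j = \<bar>G (v n (Suc j)) - G (v n j)\<bar>" for j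
  define a where "a j = lam * \<bar>F1 (v n (Suc j)) - F1 (v n j)\<bar>" for j
  define b where "b j = lam * \<bar>F2 (v n (Suc j)) - F2 (v n j)\<bar>" for j
  have gab: "g j + a j + b j = \<bar>v n (Suc j) - v n j\<bar>" for j
    using abs_split unfolding g_def a_def b_def .
  have Pb: "\<bar>\<gamma> * \<tau> * P_disc N (v n) j\<bar> \<le> \<gamma> * \<tau> * K" if "1 \<le> j" "j \<le> N" for j
    using g0 P_bound[of n j] that n by (simp only: abs_mult[of "\<gamma> * \<tau>"] abs_of_nonneg) (intro mult_left_mono, auto)
  have lamabs: "lam * \<bar>x\<bar> = \<bar>lam * x\<bar>" for x using lam by (simp add: abs_mult)
  have interior: "\<bar>v (Suc n) (Suc (Suc i)) - v (Suc n) (Suc i)\<bar> \<le> g (Suc i) + a i + b (Suc (Suc i)) + \<gamma> * \<tau> * (h * K)"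
    if i: "i < m" for i
  proof -
    have "P_disc N (v n) (Suc (Suc i)) - P_disc N (v n) (Suc i) = h * ((v n (Suc i) + v n (Suc (Suc i))) / 2)"
      by (simp add: P_disc_def algebra_simps add_divide_distrib diff_divide_distrib)
    moreover have "\<bar>(v n (Suc i) + v n (Suc (Suc i))) / 2\<bar> \<le> K"
      using bound[of n "Suc i"] bound[of n "Suc (Suc i)"] n i m by auto
    ultimately have "\<bar>P_disc N (v n) (Suc (Suc i)) - P_disc N (v n) (Suc i)\<bar> \<le> h * K"
      using h_pos by (simp only: abs_mult[of h] abs_of_pos) (intro mult_left_mono, auto)
    then have "\<bar>\<gamma> * \<tau> * (P_disc N (v n) (Suc (Suc i)) - P_disc N (v n) (Suc i))\<bar> \<le> \<gamma> * \<tau> * (h * K)"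
      using g0 by (simp only: abs_mult[of "\<gamma> * \<tau>"] abs_of_nonneg) (intro mult_left_mono, auto)
    moreover have "v (Suc n) (Suc (Suc i)) - v (Suc n) (Suc i) =
        (G (v n (Suc (Suc i))) - G (v n (Suc i))) + lam * (F1 (v n (Suc i)) - F1 (v n i))
        - lam * (F2 (v n (Suc (Suc (Suc i)))) - F2 (v n (Suc (Suc i))))
        + \<gamma> * \<tau> * (P_disc N (v n) (Suc (Suc i)) - P_disc N (v n) (Suc i))"
      using update_G[OF n, of "Suc i"] update_G[OF n, of "Suc (Suc i)"] i m by (simp add: algebra_simps)
    ultimately show ?thesis unfolding g_def a_def b_def lamabs by (intro abs_le_four_terms)
  qed
  have left: "\<bar>v (Suc n) (Suc 0) - v (Suc n) 0\<bar> \<le> g 0 + b 0 + b (Suc 0) + \<gamma> * \<tau> * K + \<bar>v (Suc n) 0 - v n 0\<bar>"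
  proof -
    have "v (Suc n) (Suc 0) - v (Suc n) 0 = (G (v n (Suc 0)) - G (v n 0))
        - lam * (F2 (v n (Suc 0)) - F2 (v n 0)) - lam * (F2 (v n (Suc (Suc 0))) - F2 (v n (Suc 0)))
        + \<gamma> * \<tau> * P_disc N (v n) (Suc 0) - (v (Suc n) 0 - v n 0)"
      using update_G[OF n, of "Suc 0"] m by (simp add: G_def algebra_simps)
    then show ?thesis using Pb[of "Suc 0"] N unfolding g_def b_def lamabs by (intro abs_le_five_terms(1)) auto
  qed
  have right: "\<bar>v (Suc n) (Suc (Suc m)) - v (Suc n) (Suc m)\<bar> \<le> g (Suc m) + a (Suc m) + a m + \<gamma> * \<tau> * K + \<bar>v (Suc n) N - v n N\<bar>"
  proof -
    have "v (Suc n) (Suc (Suc m)) - v (Suc n) (Suc m) = (G (v n (Suc (Suc m))) - G (v n (Suc m)))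
        + lam * (F1 (v n (Suc (Suc m))) - F1 (v n (Suc m))) + lam * (F1 (v n (Suc m)) - F1 (v n m))
        - \<gamma> * \<tau> * P_disc N (v n) (Suc m) + (v (Suc n) N - v n N)"
      using update_G[OF n, of "Suc m"] m by (simp add: G_def algebra_simps)
    then show ?thesis using Pb[of "Suc m"] m unfolding g_def a_def lamabs by (intro abs_le_five_terms(2)) auto
  qed
  have split: "(\<Sum>j<N. w j) = w 0 + (\<Sum>i<m. w (Suc i)) + w (Suc m)" for w :: "nat \<Rightarrow> real"
    unfolding m by (subst sum.lessThan_Suc, subst sum.lessThan_Suc_shift, simp)
  have "(\<Sum>j<N. \<bar>v (Suc n) (Suc j) - v (Suc n) j\<bar>)
      \<le> (g 0 + b 0 + b (Suc 0) + \<gamma> * \<tau> * K + \<bar>v (Suc n) 0 - v n 0\<bar>)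
        + (\<Sum>i<m. g (Suc i) + a i + b (Suc (Suc i)) + \<gamma> * \<tau> * (h * K))
        + (g (Suc m) + a (Suc m) + a m + \<gamma> * \<tau> * K + \<bar>v (Suc n) N - v n N\<bar>)"
    unfolding split by (intro add_mono sum_mono left right interior) simp
  also have "\<dots> = (\<Sum>j<N. g j) + (\<Sum>j<N. a j) + (\<Sum>j<N. b j) + real m * (\<gamma> * \<tau> * (h * K)) + 2 * (\<gamma> * \<tau> * K)
       + \<bar>v (Suc n) 0 - v n 0\<bar> + \<bar>v (Suc n) N - v n N\<bar>"
    (is "_ = ?R")
  proof -
    have sa: "(\<Sum>j<N. a j) = (\<Sum>i<m. a i) + a m + a (Suc m)" unfolding m by simp
    have sb: "(\<Sum>j<N. b j) = b 0 + b (Suc 0) + (\<Sum>i<m. b (Suc (Suc i)))"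
      unfolding m by (simp only: sum.lessThan_Suc_shift add.assoc)
    show ?thesis unfolding sa sb split[of g] by (simp add: sum.distrib)
  qed
  also have "?R \<le> (\<Sum>j<N. g j + a j + b j) + 3 * \<gamma> * \<tau> * K + \<bar>v (Suc n) 0 - v n 0\<bar> + \<bar>v (Suc n) N - v n N\<bar>"
  proof -
    have "real m * (\<gamma> * \<tau> * (h * K)) = (real m * h) * (\<gamma> * \<tau> * K)" by (simp add: algebra_simps)
    also have "\<dots> \<le> 1 * (\<gamma> * \<tau> * K)"
    proof (rule mult_right_mono)
      show "real m * h \<le> 1" using m by (simp add: field_simps)
    qed (rule mult_nonneg_nonneg[OF g0 K_nonneg])
    also have "1 * (\<gamma> * \<tau> * K) = 3 * (\<gamma> * \<tau> * K) - 2 * (\<gamma> * \<tau> * K)"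
      by (simp only: left_diff_distrib[symmetric]) simp
    also have "3 * (\<gamma> * \<tau> * K) = 3 * \<gamma> * \<tau> * K" by (simp only: mult.assoc)
    finally show ?thesis unfolding sum.distrib by (simp only: le_diff_eq add.assoc)
  qed
  finally show ?thesis by (simp only: gab)
qed

lemma variation: "n \<le> Suc M \<Longrightarrow> (\<Sum>j<N. \<bar>v n (Suc j) - v n j\<bar>) \<le> V"
proof -
  have *: "n \<le> Suc M \<Longrightarrow> (\<Sum>j<N. \<bar>v n (Suc j) - v n j\<bar>) \<le> W + real n * (3 * \<gamma> * \<tau> * K)
      + (\<Sum>i<n. \<bar>v (Suc i) 0 - v i 0\<bar>) + (\<Sum>i<n. \<bar>v (Suc i) N - v i N\<bar>)" for n
  proof (induction n)
    case 0 then show ?case using var_init by simp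
  next
    case (Suc n)
    have "real (Suc n) * (3 * \<gamma> * \<tau> * K) = real n * (3 * \<gamma> * \<tau> * K) + 3 * \<gamma> * \<tau> * K"
      by (simp only: of_nat_Suc distrib_right mult_1_left)
    with Suc show ?case using variation_step[of n] unfolding sum.lessThan_Suc by linarith
  qed
  assume n: "n \<le> Suc M"
  have "(\<Sum>i<n. \<bar>v (Suc i) 0 - v i 0\<bar>) \<le> W" "(\<Sum>i<n. \<bar>v (Suc i) N - v i N\<bar>) \<le> W"
    by (rule order.trans[OF sum_mono2 var_bdry(1)], use n in auto)
       (rule order.trans[OF sum_mono2 var_bdry(2)], use n in auto)
  moreover have "real n * (3 * \<gamma> * \<tau> * K) \<le> 3 * \<gamma> * T * K"
  proof -
    have "real n * (3 * \<gamma> * \<tau> * K) \<le> (real M + 1) * (3 * \<gamma> * \<tau> * K)"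
      using n mult_nonneg_nonneg[OF g0 K_nonneg] by (intro mult_right_mono) auto
    also have "\<dots> = 3 * \<gamma> * T * K" unfolding T[symmetric] by simp
    finally show ?thesis .
  qed
  ultimately show ?thesis using *[OF n] unfolding variation_bound_def by linarith
qed

text \<open>The Lipschitz constant in time. The term \<open>4 * K\<close> stems from the two boundary values, which may jump by
  \<open>2 * K\<close> each, \<open>2 * V\<close> from the fluxes on both sides of the cells, and the last term from the source.\<close>
abbreviation "D \<equiv> (4 * K + 2 * V + \<gamma> * lam * K) / lam"

lemma time_step:
  assumes n: "n \<le> M"
  shows "h * (\<Sum>j\<le>N. \<bar>v (Suc n) j - v n j\<bar>) \<le> D * \<tau>"
proof -
  obtain m where m: "N = Suc m" using N by (cases N) auto
  have Pb: "\<bar>\<gamma> * \<tau> * P_disc N (v n) j\<bar> \<le> \<gamma> * \<tau> * K" if "1 \<le> j" "j \<le> N" for j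
    using g0 P_bound[of n j] that n by (simp only: abs_mult[of "\<gamma> * \<tau>"] abs_of_nonneg) (intro mult_left_mono, auto)
  have inner: "\<bar>v (Suc n) (Suc i) - v n (Suc i)\<bar> \<le> \<bar>v n (Suc i) - v n i\<bar> + \<bar>v n (Suc (Suc i)) - v n (Suc i)\<bar> + \<gamma> * \<tau> * K"
    if i: "i < m" for i
  proof -
    have "v (Suc n) (Suc i) - v n (Suc i) = - lam * (F1 (v n (Suc i)) - F1 (v n i))
        - lam * (F2 (v n (Suc (Suc i))) - F2 (v n (Suc i))) + \<gamma> * \<tau> * P_disc N (v n) (Suc i)"
      using update[OF n, of "Suc i"] i m by (simp add: algebra_simps)
    moreover have "\<bar>\<gamma> * \<tau> * P_disc N (v n) (Suc i)\<bar> \<le> \<gamma> * \<tau> * K"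
      using Pb[of "Suc i"] i m by simp
    moreover have "\<bar>lam * (F1 (v n (Suc i)) - F1 (v n i))\<bar> \<le> \<bar>v n (Suc i) - v n i\<bar>"
      by (rule lam_F_le)
    moreover have "\<bar>lam * (F2 (v n (Suc (Suc i))) - F2 (v n (Suc i)))\<bar> \<le> \<bar>v n (Suc (Suc i)) - v n (Suc i)\<bar>"
      by (rule lam_F_le)
    ultimately show ?thesis by linarith
  qed
  have "(\<Sum>j\<le>N. \<bar>v (Suc n) j - v n j\<bar>) = \<bar>v (Suc n) 0 - v n 0\<bar> + (\<Sum>i<m. \<bar>v (Suc n) (Suc i) - v n (Suc i)\<bar>) + \<bar>v (Suc n) N - v n N\<bar>"
    unfolding m by (subst sum.atMost_Suc, subst lessThan_Suc_atMost[symmetric], subst sum.lessThan_Suc_shift, simp)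
  also have "\<dots> \<le> 2 * K + (\<Sum>i<m. \<bar>v n (Suc i) - v n i\<bar> + \<bar>v n (Suc (Suc i)) - v n (Suc i)\<bar> + \<gamma> * \<tau> * K) + 2 * K"
  proof (intro add_mono sum_mono inner)
    show "\<bar>v (Suc n) 0 - v n 0\<bar> \<le> 2 * K" "\<bar>v (Suc n) N - v n N\<bar> \<le> 2 * K"
      using bound[of n 0] bound[of "Suc n" 0] bound[of n N] bound[of "Suc n" N] n by auto
  qed auto
  also have "\<dots> \<le> 2 * K + (V + V + \<gamma> * lam * K) + 2 * K"
  proof -
    have "(\<Sum>i<m. \<bar>v n (Suc i) - v n i\<bar>) \<le> V" "(\<Sum>i<m. \<bar>v n (Suc (Suc i)) - v n (Suc i)\<bar>) \<le> V"
    proof -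
      have "(\<Sum>i<m. \<bar>v n (Suc i) - v n i\<bar>) + \<bar>v n (Suc m) - v n m\<bar> \<le> V"
        using variation[of n] n unfolding m by simp
      then show "(\<Sum>i<m. \<bar>v n (Suc i) - v n i\<bar>) \<le> V" using abs_ge_zero[of "v n (Suc m) - v n m"] by linarith
      have "\<bar>v n (Suc 0) - v n 0\<bar> + (\<Sum>i<m. \<bar>v n (Suc (Suc i)) - v n (Suc i)\<bar>) \<le> V"
        using variation[of n] n unfolding m sum.lessThan_Suc_shift by simp
      then show "(\<Sum>i<m. \<bar>v n (Suc (Suc i)) - v n (Suc i)\<bar>) \<le> V" using abs_ge_zero[of "v n (Suc 0) - v n 0"] by linarith
    qed
    moreover have "real m * (\<gamma> * \<tau> * K) \<le> \<gamma> * lam * K"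
    proof -
      have "real m * (\<gamma> * \<tau> * K) \<le> real N * (\<gamma> * \<tau> * K)"
        using m by (intro mult_right_mono mult_nonneg_nonneg[OF g0 K_nonneg]) simp
      also have "\<dots> = \<gamma> * lam * K" using N by simp
      finally show ?thesis .
    qed
    ultimately show ?thesis unfolding sum.distrib sum_constant card_lessThan by linarith
  qed
  finally have "h * (\<Sum>j\<le>N. \<bar>v (Suc n) j - v n j\<bar>) \<le> h * (4 * K + 2 * V + \<gamma> * lam * K)"
    using h_pos by (intro mult_left_mono) auto
  also have "\<dots> = D * \<tau>" using lam by simp
  finally show ?thesis .
qed

end

section \<open>Discrete entropy inequalities\<close>

text \<open>The inequality between a convex function and its tangent, seen through a nondecreasing function \<open>\<phi>\<close>:
  \<open>E - e w * \<phi>\<close> has the derivative \<open>(e - e w) * \<phi>'\<close> and so is minimal at \<open>w\<close>. Here \<open>e\<close> is the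
  derivative of an entropy and \<open>\<phi>\<close> will be one of the monotone parts of the scheme.\<close>
lemma entropy_flux_tangent:
  fixes E e \<phi> \<phi>' :: "real \<Rightarrow> real"
  assumes E: "\<And>x. (E has_real_derivative e x * \<phi>' x) (at x)" and \<phi>: "\<And>x. (\<phi> has_real_derivative \<phi>' x) (at x)"
    and pos: "\<And>x. 0 \<le> \<phi>' x" and e: "mono e"
  shows "e w * (\<phi> a - \<phi> w) \<le> E a - E w"
proof -
  define D where "D s = E s - e w * \<phi> s" for s
  have D: "(D has_real_derivative (e x - e w) * \<phi>' x) (at x)" for x
    unfolding D_def by (auto intro!: derivative_eq_intros E \<phi> simp: algebra_simps)
  have "D w \<le> D a"
  proof (cases "w \<le> a")
    case True
    then show ?thesis
      by (rule DERIV_nonneg_imp_nondecreasing)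
         (use D pos monoD[OF e] in \<open>auto intro!: exI[of _ "(e _ - e w) * \<phi>' _"] mult_nonneg_nonneg\<close>)
  next
    case False
    then have "a \<le> w" by simp
    then show ?thesis
      by (rule DERIV_nonpos_imp_nonincreasing)
         (use D pos monoD[OF e] in \<open>auto intro!: exI[of _ "(e _ - e w) * \<phi>' _"] mult_nonpos_nonneg\<close>)
  qed
  then show ?thesis by (simp add: D_def algebra_simps)
qed

text \<open>An entropy \<open>e\<close> with flux \<open>q\<close>, and the part \<open>Q1\<close> of \<open>q\<close> that belongs to \<open>F1\<close>; the rest \<open>q - Q1\<close>
  belongs to \<open>F2\<close>.\<close>
locale entropy_for_split_flux =
  fixes F1' F2' e e' q Q1 :: "real \<Rightarrow> real"
  assumes de: "\<And>x. (e has_real_derivative e' x) (at x)" and mono_e': "mono e'"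
    and dq: "\<And>x. (q has_real_derivative e' x * (F1' x + F2' x)) (at x)"
    and dQ1: "\<And>x. (Q1 has_real_derivative e' x * F1' x) (at x)"

lemma sum_by_parts_flux:
  fixes p A :: "nat \<Rightarrow> real"
  assumes "1 \<le> n"
  shows "(\<Sum>j=1..<n. p j * (A (j - 1) - A j)) = (\<Sum>j=1..<n. (p (Suc j) - p j) * A j) + p 1 * A 0 - p n * A (n - 1)"
  using assms
proof (induction n rule: dec_induct)
  case base then show ?case by simp
next
  case (step n)
  then show ?case by (simp add: sum.atLeastLessThan_Suc algebra_simps)
qed

locale scheme_grid_entropy = scheme_grid F1 F2 F1' F2' lam \<gamma> T R W N M v
    + entropy_for_split_flux F1' F2' e e' q Q1
  for F1 F2 F1' F2' lam \<gamma> T R W N M v e e' q Q1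
begin

text \<open>The numerical entropy flux, split between the two neighbours like the flux of the scheme and
  consistent: \<open>Q x x = q x\<close>.\<close>
definition Q :: "real \<Rightarrow> real \<Rightarrow> real" where "Q x y = Q1 x + (q y - Q1 y)"

text \<open>The new value \<open>w\<close> is \<open>G x + lam * F1 y - lam * F2 z\<close> plus the source, and it is also
  \<open>G w + lam * F1 w - lam * F2 w\<close>. The difference of both expressions is multiplied by \<open>e' w\<close>, and
  \<open>entropy_flux_tangent\<close> estimates the contribution of each of the three parts.\<close>
lemma cell_entropy_inequality:
  assumes n: "n \<le> M" "1 \<le> j" "j < N"
  shows "e (v (Suc n) j) \<le> e (v n j) + lam * (Q (v n (j - 1)) (v n j) - Q (v n j) (v n (j + 1)))
     + \<gamma> * \<tau> * e' (v (Suc n) j) * P_disc N (v n) j"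
proof -
  define w where "w = v (Suc n) j"
  have t1: "e' w * (G x - G w) \<le> (e x - lam * (Q1 x - (q x - Q1 x))) - (e w - lam * (Q1 w - (q w - Q1 w)))" for x
  proof (rule entropy_flux_tangent[OF _ dG _ mono_e'])
    show "((\<lambda>x. e x - lam * (Q1 x - (q x - Q1 x))) has_real_derivative e' x * (1 - lam * (F1' x - F2' x))) (at x)" for x
      by (auto intro!: derivative_eq_intros de dq dQ1 simp: algebra_simps)
    show "0 \<le> 1 - lam * (F1' x - F2' x)" for x using cfl[of x] by simp
  qed
  have t2: "e' w * (F1 x - F1 w) \<le> Q1 x - Q1 w" for x
    by (rule entropy_flux_tangent[OF dQ1 dF1 F1'_nonneg mono_e'])
  have t3: "e' w * ((- F2 x) - (- F2 w)) \<le> (- (q x - Q1 x)) - (- (q w - Q1 w))" for x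
  proof (rule entropy_flux_tangent[where \<phi>'="\<lambda>x. - F2' x", OF _ _ _ mono_e'])
    show "((\<lambda>x. - (q x - Q1 x)) has_real_derivative e' x * - F2' x) (at x)" for x
      by (auto intro!: derivative_eq_intros dq dQ1 simp: algebra_simps)
    show "((\<lambda>x. - F2 x) has_real_derivative - F2' x) (at x)" for x
      by (auto intro!: derivative_eq_intros dF2)
  qed (use F2'_nonpos in simp)
  define x y z where "x = v n j" and "y = v n (j - 1)" and "z = v n (j + 1)"
  define p where "p = \<gamma> * \<tau> * P_disc N (v n) j"
  have w: "w = G x + lam * F1 y - lam * F2 z + p"
    unfolding w_def x_def y_def z_def p_def by (rule update_G[OF n])
  have wid: "w = G w + lam * F1 w - lam * F2 w" by (simp add: G_def algebra_simps)
  have "e' w * (G x - G w) + lam * (e' w * (F1 y - F1 w)) + lam * (e' w * ((- F2 z) - (- F2 w)))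
      \<le> (e x - lam * (Q1 x - (q x - Q1 x))) - (e w - lam * (Q1 w - (q w - Q1 w)))
        + lam * (Q1 y - Q1 w) + lam * ((- (q z - Q1 z)) - (- (q w - Q1 w)))"
    using lam by (intro add_mono mult_left_mono t1 t2 t3) auto
  also have "\<dots> = e x - e w + lam * (Q y x - Q x z)" by (simp add: Q_def algebra_simps)
  also have "e' w * (G x - G w) + lam * (e' w * (F1 y - F1 w)) + lam * (e' w * ((- F2 z) - (- F2 w)))
      = e' w * ((G x + lam * F1 y - lam * F2 z) - (G w + lam * F1 w - lam * F2 w))"
    by (simp add: algebra_simps)
  also have "\<dots> = e' w * (- p)" using w wid by (intro arg_cong2[where f="(*)"]) auto
  finally show ?thesis unfolding w_def x_def y_def z_def p_def by (simp add: algebra_simps)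
qed

text \<open>Multiplication of the cell inequalities by test values and summation by parts. Three replacements
  prepare the limit. At the outermost faces \<open>Q\<close> involves an interior value and is
  replaced by a bound that depends on the boundary value alone. In the interior \<open>Q\<close> is replaced
  by \<open>q\<close>, with an error controlled by the spatial variation. In the source \<open>e'\<close> is taken at
  the old instead of the new value, with an error controlled by \<open>time_step\<close>.\<close>
lemma tested_entropy_step:
  fixes p p' :: "nat \<Rightarrow> real"
  assumes n: "n \<le> M"
    and p0: "\<And>j. j \<le> N \<Longrightarrow> 0 \<le> p' j" and pB: "\<And>j. j \<le> N \<Longrightarrow> p' j \<le> B"
    and pL: "\<And>j. j < N \<Longrightarrow> \<bar>p' (Suc j) - p' j\<bar> \<le> B * h"
    and Lip: "\<And>x y. x \<in> {-K..K} \<Longrightarrow> y \<in> {-K..K} \<Longrightarrow> \<bar>q x - Q1 x - (q y - Q1 y)\<bar> \<le> L * \<bar>x - y\<bar>"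
      "\<And>x y. x \<in> {-K..K} \<Longrightarrow> y \<in> {-K..K} \<Longrightarrow> \<bar>e' x - e' y\<bar> \<le> L * \<bar>x - y\<bar>" and L: "L \<ge> 0"
    and c0: "\<And>x y. x \<in> {-K..K} \<Longrightarrow> y \<in> {-K..K} \<Longrightarrow> Q x y \<le> c0 x"
    and c1: "\<And>x y. x \<in> {-K..K} \<Longrightarrow> y \<in> {-K..K} \<Longrightarrow> c1 y \<le> Q x y"
  shows "h * (\<Sum>j=1..<N. p' j * e (v (Suc n) j)) - h * (\<Sum>j=1..<N. p j * e (v n j))
    \<le> \<tau> * (h * (\<Sum>j=1..<N. (p' j - p j) / \<tau> * e (v n j))
        + h * (\<Sum>j=1..<N. (p' (Suc j) - p' j) / h * q (v n j))
        + h * (\<Sum>j=1..<N. \<gamma> * p' j * P_disc N (v n) j * e' (v n j))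
        + p' 1 * c0 (v n 0) - p' N * c1 (v n N) + B * L * V * h + \<gamma> * B * L * K * D * \<tau>)"
proof -
  have B0: "0 \<le> B" using p0[of 0] pB[of 0] by linarith
  have vK: "v n j \<in> {-K..K}" if "j \<le> N" for j using bound[of n j] n that by (auto simp: abs_le_iff)
  have vK': "v (Suc n) j \<in> {-K..K}" if "j \<le> N" for j using bound[of "Suc n" j] n that by (auto simp: abs_le_iff)
  have \<tau>h: "\<tau> = lam * h" by simp
  define S where "S = (\<Sum>j=1..<N. p' j * (Q (v n (j - 1)) (v n j) - Q (v n j) (v n (Suc j))))"
  define Z where "Z = (\<Sum>j=1..<N. p' j * (\<gamma> * e' (v (Suc n) j) * P_disc N (v n) j))"
  have "(\<Sum>j=1..<N. p' j * e (v (Suc n) j)) \<le> (\<Sum>j=1..<N. p' j * (e (v n j)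
     + lam * (Q (v n (j - 1)) (v n j) - Q (v n j) (v n (Suc j))) + \<tau> * (\<gamma> * e' (v (Suc n) j) * P_disc N (v n) j)))"
    using cell_entropy_inequality[OF n] p0 by (intro sum_mono mult_left_mono) (auto simp: mult_ac)
  also have "\<dots> = (\<Sum>j=1..<N. p' j * e (v n j)) + lam * S + \<tau> * Z"
    unfolding S_def Z_def sum_distrib_left sum.distrib[symmetric]
    by (intro sum.cong refl) (simp only: distrib_left mult_ac)
  finally have main: "(\<Sum>j=1..<N. p' j * e (v (Suc n) j)) \<le> (\<Sum>j=1..<N. p' j * e (v n j)) + lam * S + \<tau> * Z" .
  have S: "S \<le> h * (\<Sum>j=1..<N. (p' (Suc j) - p' j) / h * q (v n j)) + B * L * V * h + p' 1 * c0 (v n 0) - p' N * c1 (v n N)"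
  proof -
    define A where "A j = Q (v n j) (v n (Suc j))" for j
    have A: "A j = q (v n j) + (q (v n (Suc j)) - Q1 (v n (Suc j)) - (q (v n j) - Q1 (v n j)))" for j
      by (simp add: A_def Q_def)
    have "S = (\<Sum>j=1..<N. p' j * (A (j - 1) - A j))"
      unfolding S_def A_def by (intro sum.cong refl) simp
    also have "\<dots> = (\<Sum>j=1..<N. (p' (Suc j) - p' j) * A j) + p' 1 * A 0 - p' N * A (N - 1)"
      by (rule sum_by_parts_flux) (use N in simp)
    finally have S_eq: "S = (\<Sum>j=1..<N. (p' (Suc j) - p' j) * A j) + p' 1 * A 0 - p' N * A (N - 1)" .
    have "(\<Sum>j=1..<N. (p' (Suc j) - p' j) * A j) \<le>
        (\<Sum>j=1..<N. (p' (Suc j) - p' j) * q (v n j) + B * h * (L * \<bar>v n (Suc j) - v n j\<bar>))"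
    proof (rule sum_mono)
      fix j assume j: "j \<in> {1..<N}"
      let ?d = "q (v n (Suc j)) - Q1 (v n (Suc j)) - (q (v n j) - Q1 (v n j))"
      have "(p' (Suc j) - p' j) * ?d \<le> \<bar>p' (Suc j) - p' j\<bar> * \<bar>?d\<bar>"
        by (simp add: abs_mult[symmetric])
      also have "\<dots> \<le> B * h * (L * \<bar>v n (Suc j) - v n j\<bar>)"
        using j B0 h_pos by (intro mult_mono pL Lip(1) vK) auto
      finally show "(p' (Suc j) - p' j) * A j \<le> (p' (Suc j) - p' j) * q (v n j) + B * h * (L * \<bar>v n (Suc j) - v n j\<bar>)"
        unfolding A by (simp only: distrib_left add_le_cancel_left)
    qed
    also have "\<dots> = h * (\<Sum>j=1..<N. (p' (Suc j) - p' j) / h * q (v n j)) + B * h * L * (\<Sum>j=1..<N. \<bar>v n (Suc j) - v n j\<bar>)"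
      using h_pos by (simp add: sum.distrib sum_distrib_left mult_ac)
    also have "B * h * L * (\<Sum>j=1..<N. \<bar>v n (Suc j) - v n j\<bar>) \<le> B * h * L * V"
    proof (rule mult_left_mono)
      have "(\<Sum>j=1..<N. \<bar>v n (Suc j) - v n j\<bar>) \<le> (\<Sum>j<N. \<bar>v n (Suc j) - v n j\<bar>)"
        by (rule sum_mono2) auto
      then show "(\<Sum>j=1..<N. \<bar>v n (Suc j) - v n j\<bar>) \<le> V" using variation[of n] n by linarith
    qed (use B0 L h_pos in auto)
    also have "B * h * L * V = B * L * V * h" by (simp only: mult_ac)
    finally have 1: "(\<Sum>j=1..<N. (p' (Suc j) - p' j) * A j)
        \<le> h * (\<Sum>j=1..<N. (p' (Suc j) - p' j) / h * q (v n j)) + B * L * V * h" by simp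
    have 2: "p' 1 * A 0 \<le> p' 1 * c0 (v n 0)"
      unfolding A_def using N by (intro mult_left_mono c0 p0 vK) auto
    have 3: "p' N * c1 (v n N) \<le> p' N * A (N - 1)"
      unfolding A_def using N by (intro mult_left_mono) (auto intro!: c1 p0 vK simp: Suc_diff_Suc)
    show ?thesis using S_eq 1 2 3 by linarith
  qed
  have Z: "h * Z \<le> h * (\<Sum>j=1..<N. \<gamma> * p' j * P_disc N (v n) j * e' (v n j)) + \<gamma> * B * L * K * D * \<tau>"
  proof -
    have "Z \<le> (\<Sum>j=1..<N. \<gamma> * p' j * P_disc N (v n) j * e' (v n j) + \<gamma> * B * K * (L * \<bar>v (Suc n) j - v n j\<bar>))"
      unfolding Z_def
    proof (rule sum_mono)
      fix j assume j: "j \<in> {1..<N}"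
      have "\<bar>p' j * P_disc N (v n) j\<bar> \<le> B * K"
        unfolding abs_mult using j n p0[of j] pB[of j] P_bound[of n j] B0 by (intro mult_mono) auto
      then have "\<bar>p' j * P_disc N (v n) j\<bar> * \<bar>e' (v (Suc n) j) - e' (v n j)\<bar> \<le> B * K * (L * \<bar>v (Suc n) j - v n j\<bar>)"
        using j B0 K_nonneg by (intro mult_mono Lip(2) vK vK' mult_nonneg_nonneg) (auto simp: R_nonneg)
      then have "p' j * P_disc N (v n) j * (e' (v (Suc n) j) - e' (v n j)) \<le> B * K * (L * \<bar>v (Suc n) j - v n j\<bar>)"
        by (simp add: abs_mult[symmetric] abs_le_iff)
      then have "\<gamma> * (p' j * P_disc N (v n) j * (e' (v (Suc n) j) - e' (v n j))) \<le> \<gamma> * (B * K * (L * \<bar>v (Suc n) j - v n j\<bar>))"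
        using \<gamma> by (intro mult_left_mono) auto
      then show "p' j * (\<gamma> * e' (v (Suc n) j) * P_disc N (v n) j)
          \<le> \<gamma> * p' j * P_disc N (v n) j * e' (v n j) + \<gamma> * B * K * (L * \<bar>v (Suc n) j - v n j\<bar>)"
        by (simp add: algebra_simps)
    qed
    also have "\<dots> = (\<Sum>j=1..<N. \<gamma> * p' j * P_disc N (v n) j * e' (v n j)) + \<gamma> * B * K * L * (\<Sum>j=1..<N. \<bar>v (Suc n) j - v n j\<bar>)"
      by (simp add: sum.distrib sum_distrib_left mult_ac)
    finally have "h * Z \<le> h * ((\<Sum>j=1..<N. \<gamma> * p' j * P_disc N (v n) j * e' (v n j)) + \<gamma> * B * K * L * (\<Sum>j=1..<N. \<bar>v (Suc n) j - v n j\<bar>))"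
      using h_pos by (intro mult_left_mono) auto
    also have "\<dots> = h * (\<Sum>j=1..<N. \<gamma> * p' j * P_disc N (v n) j * e' (v n j)) + \<gamma> * B * K * L * (h * (\<Sum>j=1..<N. \<bar>v (Suc n) j - v n j\<bar>))"
      by (simp only: distrib_left mult_ac)
    also have "\<gamma> * B * K * L * (h * (\<Sum>j=1..<N. \<bar>v (Suc n) j - v n j\<bar>)) \<le> \<gamma> * B * K * L * (D * \<tau>)"
    proof (rule mult_left_mono)
      have "h * (\<Sum>j=1..<N. \<bar>v (Suc n) j - v n j\<bar>) \<le> h * (\<Sum>j\<le>N. \<bar>v (Suc n) j - v n j\<bar>)"
        using h_pos by (intro mult_left_mono sum_mono2) auto
      then show "h * (\<Sum>j=1..<N. \<bar>v (Suc n) j - v n j\<bar>) \<le> D * \<tau>" using time_step[OF n] by linarith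
    qed (use \<gamma> B0 K_nonneg L in \<open>intro mult_nonneg_nonneg, auto\<close>)
    finally show ?thesis by (simp only: mult_ac)
  qed
  have E: "\<tau> * (h * (\<Sum>j=1..<N. (p' j - p j) / \<tau> * e (v n j)))
      = h * (\<Sum>j=1..<N. p' j * e (v n j)) - h * (\<Sum>j=1..<N. p j * e (v n j))"
  proof -
    have "\<tau> * (h * (\<Sum>j=1..<N. (p' j - p j) / \<tau> * e (v n j))) = h * (\<Sum>j=1..<N. \<tau> * ((p' j - p j) / \<tau> * e (v n j)))"
      by (simp only: sum_distrib_left mult_ac)
    also have "(\<Sum>j=1..<N. \<tau> * ((p' j - p j) / \<tau> * e (v n j))) = (\<Sum>j=1..<N. p' j * e (v n j) - p j * e (v n j))"
    proof (intro sum.cong refl)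
      have "c * (d / c * x) = d * x" if "c \<noteq> 0" for c d x :: real using that by simp
      then show "\<tau> * ((p' j - p j) / \<tau> * e (v n j)) = p' j * e (v n j) - p j * e (v n j)" for j
        using \<tau>_pos by (metis left_diff_distrib less_irrefl)
    qed
    finally show ?thesis by (simp only: sum_subtractf right_diff_distrib)
  qed
  have "h * (\<Sum>j=1..<N. p' j * e (v (Suc n) j)) \<le> h * ((\<Sum>j=1..<N. p' j * e (v n j)) + lam * S + \<tau> * Z)"
    using main h_pos by (intro mult_left_mono) auto
  also have "\<dots> = h * (\<Sum>j=1..<N. p' j * e (v n j)) + \<tau> * (S + h * Z)"
    unfolding \<tau>h by (simp only: distrib_left mult_ac)
  also have "\<tau> * (S + h * Z) \<le> \<tau> * ((h * (\<Sum>j=1..<N. (p' (Suc j) - p' j) / h * q (v n j)) + B * L * V * h + p' 1 * c0 (v n 0) - p' N * c1 (v n N))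
     + (h * (\<Sum>j=1..<N. \<gamma> * p' j * P_disc N (v n) j * e' (v n j)) + \<gamma> * B * L * K * D * \<tau>))"
    using \<tau>_pos S Z by (intro mult_left_mono add_mono) auto
  finally show ?thesis using E by (simp only: distrib_left right_diff_distrib) linarith
qed

end

section \<open>Sums over cells as integrals\<close>

lemma step_function_bounded: "\<bar>s (idx h c L x)\<bar> \<le> (\<Sum>j\<le>L. \<bar>s j :: real\<bar>)"
  by (rule member_le_sum) (auto intro: idx_le)

lemma set_integrable_bounded_set:
  fixes f :: "real \<Rightarrow> real"
  assumes [measurable]: "f \<in> borel_measurable borel" "A \<in> sets borel" and A: "bounded A" and "\<And>x. x \<in> A \<Longrightarrow> \<bar>f x\<bar> \<le> B"
  shows "set_integrable lborel A f"
proof -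
  have "integrable lborel (\<lambda>x. indicator A x *\<^sub>R max B 0)"
    by (rule integrable_real_indicator[THEN integrable_scaleR_left])
       (use emeasure_bounded_finite[OF A] in \<open>auto simp: less_top\<close>)
  then show ?thesis unfolding set_integrable_def
    by (rule Bochner_Integration.integrable_bound) (use assms(4) in \<open>auto simp: indicator_def intro!: AE_I2 order.trans[OF assms(4)]\<close>)
qed

lemma step_function_integrable:
  fixes s :: "nat \<Rightarrow> real"
  assumes [measurable]: "A \<in> sets borel" and "bounded A"
  shows "set_integrable lborel A (\<lambda>x. s (idx h c L x))"
  using step_function_bounded[of s h c L] by (intro set_integrable_bounded_set assms) auto

lemma integral_step_function:
  fixes s :: "nat \<Rightarrow> real"
  assumes h: "h > 0" and "i \<le> k" "k \<le> Suc L"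
  shows "(LBINT x:{real i * h - c..<real k * h - c}. s (idx h c L x)) = h * (\<Sum>j=i..<k. s j)"
  using assms(2,3)
proof (induction k rule: dec_induct)
  case base
  then show ?case by (simp add: set_lebesgue_integral_def)
next
  case (step k)
  have ik: "real i * h \<le> real k * h" using step h by (intro mult_right_mono) auto
  have kk: "real k * h \<le> real (Suc k) * h" using h by (intro mult_right_mono) auto
  have "(LBINT x:{real k * h - c..<real (Suc k) * h - c}. s (idx h c L x))
      = (LBINT x:{real k * h - c..<real (Suc k) * h - c}. s k)"
  proof (rule set_lebesgue_integral_cong)
    show "\<forall>x. x \<in> {real k * h - c..<real (Suc k) * h - c} \<longrightarrow> s (idx h c L x) = s k"
      using step h by (auto intro!: arg_cong[where f=s] idx_eqI)
  qed auto
  also have "\<dots> = h * s k" using kk by (simp add: set_lebesgue_integral_def algebra_simps)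
  finally have cell: "(LBINT x:{real k * h - c..<real (Suc k) * h - c}. s (idx h c L x)) = h * s k" .
  have "{real i * h - c..<real (Suc k) * h - c} = {real i * h - c..<real k * h - c} \<union> {real k * h - c..<real (Suc k) * h - c}"
    using ik kk by auto
  then have "(LBINT x:{real i * h - c..<real (Suc k) * h - c}. s (idx h c L x))
     = (LBINT x:{real i * h - c..<real k * h - c}. s (idx h c L x)) + (LBINT x:{real k * h - c..<real (Suc k) * h - c}. s (idx h c L x))"
    by (simp only:) (rule set_integral_Un, auto intro!: step_function_integrable)
  then show ?case using step cell by (simp add: sum.atLeastLessThan_Suc distrib_left del: of_nat_Suc)
qed

text \<open>The interior cells cover \<open>[h/2, 1 - h/2)\<close>; the two half cells at the ends are cut off.\<close>
lemma space_sum_eq_integral: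
  fixes g :: "nat \<Rightarrow> real"
  assumes N: "2 \<le> N"
  defines "h \<equiv> 1 / real N"
  shows "h * (\<Sum>j=1..<N. g j) = (LBINT x:{0<..<1}. indicator {h / 2..<1 - h / 2} x * g (idx h (h / 2) N x))"
proof -
  have h: "h > 0" "h \<le> 1 / 2" "real N * h = 1" using N by (auto simp: h_def field_simps)
  have "h * (\<Sum>j=1..<N. g j) = (LBINT x:{real 1 * h - h / 2..<real N * h - h / 2}. g (idx h (h / 2) N x))"
    by (rule integral_step_function[symmetric]) (use h N in auto)
  also have "{real 1 * h - h / 2..<real N * h - h / 2} = {h / 2..<1 - h / 2}"
    using h by auto
  also have "(LBINT x:{h / 2..<1 - h / 2}. g (idx h (h / 2) N x))
      = (LBINT x:{0<..<1}. indicator {h / 2..<1 - h / 2} x * g (idx h (h / 2) N x))"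
    unfolding set_lebesgue_integral_def
    by (rule Bochner_Integration.integral_cong[OF refl]) (use h in \<open>auto simp: indicator_def\<close>)
  finally show ?thesis .
qed

lemma set_integral_atLeastLessThan:
  fixes f :: "real \<Rightarrow> real"
  assumes [measurable]: "f \<in> borel_measurable borel"
  shows "(LBINT t:{a..<b}. f t) = (LBINT t:{a<..<b}. f t)"
  unfolding set_lebesgue_integral_def
proof (rule integral_cong_AE)
  show "AE t in lborel. indicator {a..<b} t *\<^sub>R f t = indicator {a<..<b} t *\<^sub>R f t"
    using AE_lborel_singleton[of a] by eventually_elim (auto simp: indicator_def)
qed auto

lemma time_sum_eq_integral:
  fixes g :: "nat \<Rightarrow> real"
  assumes \<tau>: "\<tau> > 0" and T: "real (Suc M) * \<tau> = T"
  shows "\<tau> * (\<Sum>n<Suc M. g n) = (LBINT t:{0<..<T}. g (idx \<tau> 0 (Suc M) t))"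
proof -
  have "\<tau> * (\<Sum>n<Suc M. g n) = (LBINT t:{real 0 * \<tau> - 0..<real (Suc M) * \<tau> - 0}. g (idx \<tau> 0 (Suc M) t))"
    unfolding lessThan_atLeast0 by (rule integral_step_function[symmetric]) (use \<tau> in auto)
  also have "\<dots> = (LBINT t:{0<..<T}. g (idx \<tau> 0 (Suc M) t))"
    unfolding T by (subst set_integral_atLeastLessThan) auto
  finally show ?thesis .
qed

text \<open>Only half of the first and of the last cell lies in the unit interval.\<close>
lemma integral_abs_step_le:
  fixes g :: "nat \<Rightarrow> real"
  assumes N: "1 \<le> N"
  defines "h \<equiv> 1 / real N"
  shows "(LBINT x:{0<..<1}. \<bar>g (idx h (h / 2) N x)\<bar>) \<le> h * (\<Sum>j\<le>N. \<bar>g j\<bar>)"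
proof -
  have h: "h > 0" "real N * h = 1" using N by (auto simp: h_def)
  have "(LBINT x:{0<..<1}. \<bar>g (idx h (h / 2) N x)\<bar>) \<le> (LBINT x:{real 0 * h - h / 2..<real (Suc N) * h - h / 2}. \<bar>g (idx h (h / 2) N x)\<bar>)"
    unfolding set_lebesgue_integral_def
  proof (rule integral_mono)
    show "integrable lborel (\<lambda>x. indicator {0<..<1} x *\<^sub>R \<bar>g (idx h (h / 2) N x)\<bar>)"
      using step_function_integrable[of "{0<..<1}" "\<lambda>j. \<bar>g j\<bar>" h "h / 2" N] by (simp add: set_integrable_def)
    show "integrable lborel (\<lambda>x. indicator {real 0 * h - h / 2..<real (Suc N) * h - h / 2} x *\<^sub>R \<bar>g (idx h (h / 2) N x)\<bar>)"
      using step_function_integrable[of "{real 0 * h - h / 2..<real (Suc N) * h - h / 2}" "\<lambda>j. \<bar>g j\<bar>" h "h / 2" N] by (simp add: set_integrable_def)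
  qed (use h in \<open>auto simp: indicator_def distrib_right\<close>)
  also have "\<dots> = h * (\<Sum>j=0..<Suc N. \<bar>g j\<bar>)"
    by (rule integral_step_function) (use h in auto)
  finally show ?thesis by (simp only: atLeast0LessThan lessThan_Suc_atMost)
qed

lemma set_integral_abs_le:
  fixes f :: "real \<Rightarrow> real"
  assumes ab: "a \<le> b" and B: "\<And>x. x \<in> {a<..<b} \<Longrightarrow> \<bar>f x\<bar> \<le> B" and B0: "0 \<le> B"
  shows "\<bar>LBINT x:{a<..<b}. f x\<bar> \<le> B * (b - a)"
proof (cases "set_integrable lborel {a<..<b} f")
  case True
  have c: "set_integrable lborel {a<..<b} (\<lambda>_. B)" by (rule set_integrable_bounded_set[where B=B]) (use B0 in auto)
  have "\<bar>LBINT x:{a<..<b}. f x\<bar> \<le> (LBINT x:{a<..<b}. \<bar>f x\<bar>)"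
    using set_integral_norm_bound[OF True] by simp
  also have "\<dots> \<le> (LBINT x:{a<..<b}. B)"
    by (rule set_integral_mono[OF set_integrable_abs[OF True] c B])
  also have "\<dots> = B * (b - a)" using ab by (simp add: set_lebesgue_integral_def)
  finally show ?thesis .
next
  case False
  then have "(LBINT x:{a<..<b}. f x) = 0"
    unfolding set_lebesgue_integral_def set_integrable_def by (rule not_integrable_integral_eq)
  then show ?thesis using ab B0 by simp
qed

text \<open>The trapezoidal sum is the integral up to the middle of the cell of \<open>x\<close>, up to half of the boundary
  cell. The four error terms below are at most \<open>B * h\<close> each.\<close>
lemma P_disc_close_to_integral:
  assumes N: "2 \<le> N" and B: "\<And>j. j \<le> N \<Longrightarrow> \<bar>w j\<bar> \<le> B"
  defines "h \<equiv> 1 / real N"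
  assumes x: "h / 2 \<le> x" "x < 1 - h / 2"
  shows "\<bar>P_disc N w (idx h (h / 2) N x) - (LBINT y:{0<..<x}. w (idx h (h / 2) N y))\<bar> \<le> 4 * B * h"
proof -
  have h: "h > 0" "h \<le> 1 / 2" "real N * h = 1" using N by (auto simp: h_def field_simps)
  have B0: "B \<ge> 0" using B[of 0] by auto
  define j where "j = idx h (h / 2) N x"
  have jx: "real j * h \<le> x + h / 2" "x + h / 2 < real (Suc j) * h"
    unfolding j_def by (rule idx_bounds; use h x in \<open>simp add: distrib_right\<close>)+
  have j1: "1 \<le> j"
  proof (rule ccontr)
    assume "\<not> 1 \<le> j"
    then have "j = 0" by simp
    with jx x show False by simp
  qed
  have jN: "j \<le> N" unfolding j_def by (rule idx_le)
  let ?w = "\<lambda>y. w (idx h (h / 2) N y)"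
  have int: "set_integrable lborel A ?w" if "A \<in> sets borel" "bounded A" for A
    by (rule step_function_integrable[OF that])
  have jh: "h / 2 \<le> real j * h - h / 2" using j1 h mult_right_mono[of 1 "real j" h] by simp
  have bd: "\<bar>LBINT y:{a<..<b}. ?w y\<bar> \<le> B * (b - a)" if "a \<le> b" for a b
    by (rule set_integral_abs_le) (use that B0 idx_le B in auto)
  have s: "(\<Sum>i=0..<j. w i) = w 0 + (\<Sum>i=1..j - 1. w i)"
    using j1 by (cases j) (auto simp: sum.atLeast_Suc_atMost atLeastLessThanSuc_atLeastAtMost)
  have full: "(LBINT y:{- h / 2..<real j * h - h / 2}. ?w y) = h * (\<Sum>i=0..<j. w i)"
    using integral_step_function[of h 0 j N "h / 2" w] h jN by simp
  have "{- h / 2..<real j * h - h / 2} = {- h / 2..<0} \<union> {0..<real j * h - h / 2}"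
    by (rule ivl_disj_un_two(3)[symmetric]) (use jh h in linarith)+
  then have 1: "(LBINT y:{- h / 2..<real j * h - h / 2}. ?w y) = (LBINT y:{- h / 2..<0}. ?w y) + (LBINT y:{0..<real j * h - h / 2}. ?w y)"
    by (simp only:) (rule set_integral_Un, auto intro!: int)
  have "{0..<x} = {0..<real j * h - h / 2} \<union> {real j * h - h / 2..<x}"
    by (rule ivl_disj_un_two(3)[symmetric]) (use jh jx h in linarith)+
  then have 2: "(LBINT y:{0..<x}. ?w y) = (LBINT y:{0..<real j * h - h / 2}. ?w y) + (LBINT y:{real j * h - h / 2..<x}. ?w y)"
    by (simp only:) (rule set_integral_Un, auto intro!: int)
  have b1: "\<bar>LBINT y:{- h / 2..<0}. ?w y\<bar> \<le> B * h"
    using bd[of "- h / 2" 0] h B0 mult_left_mono[of "h / 2" h B] by (simp add: set_integral_atLeastLessThan)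
  have b2: "\<bar>LBINT y:{real j * h - h / 2..<x}. ?w y\<bar> \<le> B * h"
    using bd[of "real j * h - h / 2" x] jx h B0 mult_left_mono[of "x - (real j * h - h / 2)" h B]
    by (simp add: set_integral_atLeastLessThan distrib_right)
  have P: "P_disc N w j = h * (\<Sum>i=0..<j. w i) - h * w 0 / 2 + h * w j / 2"
    unfolding s by (simp add: P_disc_def h_def add_divide_distrib diff_divide_distrib)
  have b3: "\<bar>h * w 0 / 2\<bar> \<le> B * h" "\<bar>h * w j / 2\<bar> \<le> B * h"
    using h B[of 0] B[OF jN] mult_left_mono[of "\<bar>w 0\<bar> / 2" B h] mult_left_mono[of "\<bar>w j\<bar> / 2" B h] B0
    by (auto simp: abs_mult mult.commute)
  have "(LBINT y:{0<..<x}. ?w y) = (LBINT y:{0..<x}. ?w y)" by (rule set_integral_atLeastLessThan[symmetric]) simp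
  then show ?thesis using 1 2 full P b1 b2 b3 unfolding j_def[symmetric] by linarith
qed

lemma tendsto_set_integral_bounded:
  fixes f :: "nat \<Rightarrow> real \<Rightarrow> real"
  assumes m[measurable]: "\<And>k. f k \<in> borel_measurable borel"
    and B: "\<And>k x. x \<in> {a<..<b} \<Longrightarrow> \<bar>f k x\<bar> \<le> B"
    and c: "\<And>x. x \<in> {a<..<b} \<Longrightarrow> (\<lambda>k. f k x) \<longlonglongrightarrow> g x"
  shows "(\<lambda>k. LBINT x:{a<..<b}. f k x) \<longlonglongrightarrow> (LBINT x:{a<..<b}. g x)"
proof -
  have eq: "(LBINT x:{a<..<b}. indicator {a<..<b} x * F x) = (LBINT x:{a<..<b}. F x)" for F :: "real \<Rightarrow> real"
    unfolding set_lebesgue_integral_def by (intro Bochner_Integration.integral_cong) (auto simp: indicator_def)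
  have "(\<lambda>x. indicator {a<..<b} x * g x) \<in> borel_measurable borel"
    by (rule borel_measurable_LIMSEQ_real[of borel "\<lambda>k x. indicator {a<..<b} x * f k x"])
       (use c in \<open>auto simp: indicator_def\<close>)
  then have "(\<lambda>k. LBINT x:{a<..<b}. f k x) \<longlonglongrightarrow> (LBINT x:{a<..<b}. indicator {a<..<b} x * g x)"
    by (intro set_dominated_convergence_interval[where B=B]) (use B c in auto)
  then show ?thesis by (simp only: eq)
qed

text \<open>By the mean value theorem the quotient is a value of \<open>p'\<close> at a point that converges to \<open>(x, t)\<close>.\<close>
lemma difference_quotient_tendsto:
  fixes p p' :: "real \<Rightarrow> real \<Rightarrow> real"
  assumes d: "\<And>x t. ((\<lambda>s. p x s) has_real_derivative p' x t) (at t)"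
    and c: "continuous_on UNIV (\<lambda>(x, t). p' x t)"
    and X: "X \<longlonglongrightarrow> x" and r: "r \<longlonglongrightarrow> t" and s: "s \<longlonglongrightarrow> t" and rs: "\<And>k. r k < s k"
  shows "(\<lambda>k. (p (X k) (s k) - p (X k) (r k)) / (s k - r k)) \<longlonglongrightarrow> p' x t"
proof -
  have "\<exists>z. r k < z \<and> z < s k \<and> p (X k) (s k) - p (X k) (r k) = (s k - r k) * p' (X k) z" for k
    using MVT2[OF rs, of k "\<lambda>s. p (X k) s" "p' (X k)"] d by blast
  then obtain z where z: "\<And>k. r k < z k" "\<And>k. z k < s k"
     "\<And>k. p (X k) (s k) - p (X k) (r k) = (s k - r k) * p' (X k) (z k)" by metis
  have "z \<longlonglongrightarrow> t"
    by (rule tendsto_sandwich[OF _ _ r s]) (use z in \<open>auto intro!: always_eventually less_imp_le\<close>)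
  then have "(\<lambda>k. (X k, z k)) \<longlonglongrightarrow> (x, t)" using X by (intro tendsto_Pair)
  then have "(\<lambda>k. (\<lambda>(x, t). p' x t) (X k, z k)) \<longlonglongrightarrow> (\<lambda>(x, t). p' x t) (x, t)"
    using c by (intro isCont_tendsto_compose[of "(x, t)" "\<lambda>(x, t). p' x t"]) (auto simp: continuous_on_eq_continuous_at)
  moreover have "(p (X k) (s k) - p (X k) (r k)) / (s k - r k) = p' (X k) (z k)" for k
    using z(3)[of k] rs[of k] by simp
  ultimately show ?thesis by simp
qed

section \<open>The entropy inequality in the limit\<close>

text \<open>A sequence of runs of the scheme on finer and finer grids, with a limit \<open>u\<close> at every time. The limit
  is represented by a function that has one-sided limits \<open>u 0 t\<close> and \<open>w1 t\<close> at the ends of the interval.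
  The limits \<open>a\<close> and \<open>b\<close> of the boundary values are in general different from these traces.\<close>
locale scheme_limit = split_flux F1 F2 F1' F2' lam
  for F1 F2 F1' F2' :: "real \<Rightarrow> real" and lam :: real +
  fixes \<gamma> T R W C :: real and N M :: "nat \<Rightarrow> nat" and v :: "nat \<Rightarrow> nat \<Rightarrow> nat \<Rightarrow> real"
    and u :: "real \<Rightarrow> real \<Rightarrow> real" and a b w1 :: "real \<Rightarrow> real"
  assumes grid: "\<And>k. scheme_grid F1 F2 F1' F2' lam \<gamma> T R W (N k) (M k) (v k)"
    and cF1': "continuous_on UNIV F1'" and cF2': "continuous_on UNIV F2'"
    and N_inf: "filterlim N at_top sequentially"
    and C: "sup_bound R \<gamma> T \<le> C"
    and u_measurable: "(\<lambda>(x, t). u x t) \<in> borel_measurable (borel \<Otimes>\<^sub>M borel)"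
    and u_bound: "\<And>x t. \<bar>u x t\<bar> \<le> 2 * C"
    and u_at_0: "\<And>t. ((\<lambda>x. u x t) \<longlongrightarrow> u 0 t) (at_right 0)"
    and u_at_1: "\<And>t. ((\<lambda>x. u x t) \<longlongrightarrow> w1 t) (at_left 1)"
    and u_lim: "\<And>t. t \<in> {0..T} \<Longrightarrow> (\<lambda>k. dist1 0 1
        (\<lambda>x. v k (idx (lam / real (N k)) 0 (Suc (M k)) t) (idx (1 / real (N k)) (1 / real (N k) / 2) (N k) x))
        (\<lambda>x. u x t)) \<longlonglongrightarrow> 0"
    and a: "bvr C a" and a_lim: "(\<lambda>k. dist1 0 T (\<lambda>t. v k (idx (lam / real (N k)) 0 (Suc (M k)) t) 0) a) \<longlonglongrightarrow> 0"
    and b: "bvr C b" and b_lim: "(\<lambda>k. dist1 0 T (\<lambda>t. v k (idx (lam / real (N k)) 0 (Suc (M k)) t) (N k)) b) \<longlonglongrightarrow> 0"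
begin

definition h :: "nat \<Rightarrow> real" where "h k = 1 / real (N k)"
definition \<tau> :: "nat \<Rightarrow> real" where "\<tau> k = lam / real (N k)"
definition J :: "nat \<Rightarrow> real \<Rightarrow> nat" where "J k x = idx (h k) (h k / 2) (N k) x"
definition I :: "nat \<Rightarrow> real \<Rightarrow> nat" where "I k t = idx (\<tau> k) 0 (Suc (M k)) t"

lemmas [measurable] = u_measurable

abbreviation "K \<equiv> sup_bound R \<gamma> T"

lemma grid_facts:
  shows N2: "2 \<le> N k" and \<gamma>_pos: "\<gamma> > 0" and T_pos: "T > 0" and K_nonneg: "K \<ge> 0"
    and T_eq: "real (Suc (M k)) * \<tau> k = T"
    and v_bound: "\<And>n j. n \<le> Suc (M k) \<Longrightarrow> j \<le> N k \<Longrightarrow> \<bar>v k n j\<bar> \<le> K"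
    and P_bound: "\<And>n j. n \<le> Suc (M k) \<Longrightarrow> 1 \<le> j \<Longrightarrow> j \<le> N k \<Longrightarrow> \<bar>P_disc (N k) (v k n) j\<bar> \<le> K"
proof -
  interpret g: scheme_grid F1 F2 F1' F2' lam \<gamma> T R W "N k" "M k" "v k" by (rule grid)
  show "2 \<le> N k" "\<gamma> > 0" "T > 0" "K \<ge> 0" using g.N g.\<gamma> g.T_pos g.K_nonneg by auto
  show "real (Suc (M k)) * \<tau> k = T" using g.T by (simp add: \<tau>_def add.commute)
qed (rule scheme_grid.bound[OF grid] scheme_grid.P_bound[OF grid]; assumption)+

lemma C_nonneg: "C \<ge> 0" using K_nonneg C by linarith

lemma h_pos: "h k > 0" and h_half: "h k \<le> 1 / 2" and Nh: "real (N k) * h k = 1" and \<tau>_pos: "\<tau> k > 0"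
  using N2[of k] lam by (auto simp: h_def \<tau>_def field_simps)

lemma h_lim: "h \<longlonglongrightarrow> 0" and \<tau>_lim: "\<tau> \<longlonglongrightarrow> 0"
proof -
  have "filterlim (\<lambda>k. real (N k)) at_top sequentially"
    using filterlim_compose[OF filterlim_real_sequentially N_inf] .
  then show h: "h \<longlonglongrightarrow> 0" unfolding h_def[abs_def] by (rule tendsto_divide_0[OF tendsto_const filterlim_at_top_imp_at_infinity])
  have "\<tau> = (\<lambda>k. lam * h k)" by (simp add: fun_eq_iff \<tau>_def h_def)
  then show "\<tau> \<longlonglongrightarrow> 0" using tendsto_mult_left[OF h, of lam] by simp
qed

lemma J_measurable [measurable]: "J k \<in> measurable borel (count_space UNIV)"
  unfolding J_def[abs_def] by measurable

lemma I_measurable [measurable]: "I k \<in> measurable borel (count_space UNIV)"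
  unfolding I_def[abs_def] by measurable

lemma J_le: "J k x \<le> N k" and I_le: "I k t \<le> Suc (M k)"
  by (auto simp: J_def I_def idx_le)

lemma J_near:
  assumes "x \<in> {0<..<1}"
  shows "\<bar>real (J k x) * h k - x\<bar> \<le> h k"
proof -
  have "x + h k / 2 < real (Suc (N k)) * h k" using assms Nh[of k] h_pos[of k] by (simp add: distrib_right)
  then show ?thesis
    using idx_bounds[of "h k" x "h k / 2" "N k"] assms h_pos[of k] unfolding J_def by (auto simp: distrib_right abs_le_iff)
qed

lemma J_inner:
  assumes "x \<in> {h k / 2..<1 - h k / 2}"
  shows "1 \<le> J k x" "J k x < N k"
proof -
  have x: "x + h k / 2 < real (N k) * h k" using assms Nh[of k] by simp
  then have x': "x + h k / 2 < real (Suc (N k)) * h k" using h_pos[of k] by (simp add: distrib_right)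
  have b: "real (J k x) * h k \<le> x + h k / 2" "x + h k / 2 < real (Suc (J k x)) * h k"
    unfolding J_def by (rule idx_bounds; use assms x' h_pos[of k] in simp)+
  have "real (J k x) * h k < real (N k) * h k" using b x by linarith
  then show "J k x < N k" using h_pos[of k] by simp
  have "h k < real (Suc (J k x)) * h k \<or> h k = x + h k / 2" using b assms by auto
  then show "1 \<le> J k x" using b(2) by (cases "J k x") auto
qed

lemma J_lim: "x \<in> {0<..<1} \<Longrightarrow> (\<lambda>k. real (J k x) * h k) \<longlonglongrightarrow> x"
proof -
  assume x: "x \<in> {0<..<1}"
  have "(\<lambda>k. real (J k x) * h k - x) \<longlonglongrightarrow> 0"
    by (rule Lim_null_comparison[OF _ h_lim]) (use J_near[OF x] in auto)
  then show ?thesis by (simp add: LIM_zero_iff)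
qed

lemma I_bounds:
  assumes "t \<in> {0..<T}"
  shows "real (I k t) * \<tau> k \<le> t" "t < real (Suc (I k t)) * \<tau> k" "I k t \<le> M k"
proof -
  have "t < real (Suc (Suc (M k))) * \<tau> k"
    using assms T_eq[of k] \<tau>_pos[of k] by (simp add: distrib_right)
  then show b: "real (I k t) * \<tau> k \<le> t" "t < real (Suc (I k t)) * \<tau> k"
    using idx_bounds[of "\<tau> k" t 0 "Suc (M k)"] assms \<tau>_pos[of k] unfolding I_def by auto
  have "real (I k t) * \<tau> k < real (Suc (M k)) * \<tau> k" using b T_eq[of k] assms by auto
  then show "I k t \<le> M k" using \<tau>_pos[of k] by simp
qed

lemma I_lim:
  assumes t: "t \<in> {0..<T}"
  shows "(\<lambda>k. real (I k t) * \<tau> k) \<longlonglongrightarrow> t" "(\<lambda>k. real (Suc (I k t)) * \<tau> k) \<longlonglongrightarrow> t"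
proof -
  have "(\<lambda>k. real (I k t) * \<tau> k - t) \<longlonglongrightarrow> 0"
  proof (rule Lim_null_comparison[OF _ \<tau>_lim], intro always_eventually allI)
    show "norm (real (I k t) * \<tau> k - t) \<le> \<tau> k" for k
      using I_bounds(1,2)[OF t, of k] by (simp add: distrib_right abs_le_iff)
  qed
  then show 1: "(\<lambda>k. real (I k t) * \<tau> k) \<longlonglongrightarrow> t" by (simp add: LIM_zero_iff)
  show "(\<lambda>k. real (Suc (I k t)) * \<tau> k) \<longlonglongrightarrow> t"
    using tendsto_add[OF 1 \<tau>_lim] by (simp add: distrib_right add.commute)
qed

lemma I_T: "I k T = Suc (M k)"
  unfolding I_def using \<tau>_pos[of k] T_eq[of k] by (intro idx_eqI) (auto simp: distrib_right)

lemma I_0: "I k 0 = 0"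
  unfolding I_def using \<tau>_pos[of k] by (intro idx_eqI) auto

lemma U_lim: "t \<in> {0..T} \<Longrightarrow> (\<lambda>k. dist1 0 1 (\<lambda>x. v k (I k t) (J k x)) (\<lambda>x. u x t)) \<longlonglongrightarrow> 0"
  using u_lim unfolding I_def J_def h_def \<tau>_def .

lemma indicator_inner_lim:
  assumes "x \<in> {0<..<1}"
  shows "\<forall>\<^sub>F k in sequentially. x \<in> {h k / 2..<1 - h k / 2}"
proof -
  have "\<forall>\<^sub>F k in sequentially. h k < min (2 * x) (2 * (1 - x))"
    using h_lim assms by (intro order_tendstoD(2)) auto
  then show ?thesis by eventually_elim auto
qed

lemma cell_sum_bounded:
  assumes B: "\<And>j. 1 \<le> j \<Longrightarrow> j < N k \<Longrightarrow> \<bar>c j\<bar> \<le> B" and g: "\<And>j. 1 \<le> j \<Longrightarrow> j < N k \<Longrightarrow> \<bar>w j\<bar> \<le> g"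
  shows "\<bar>h k * (\<Sum>j=1..<N k. c j * w j)\<bar> \<le> B * g"
proof -
  have "\<bar>c 1\<bar> \<le> B" "\<bar>w 1\<bar> \<le> g" using B[of 1] g[of 1] N2[of k] by auto
  then have Bg: "0 \<le> B" "0 \<le> g" by linarith+
  have "\<bar>\<Sum>j=1..<N k. c j * w j\<bar> \<le> (\<Sum>j=1..<N k. \<bar>c j * w j\<bar>)" by (rule sum_abs)
  also have "\<dots> \<le> (\<Sum>j=1..<N k. B * g)"
    by (intro sum_mono) (auto simp: abs_mult intro!: mult_mono B g Bg)
  also have "\<dots> \<le> real (N k) * (B * g)" using Bg by (simp add: mult_right_mono)
  finally have "h k * \<bar>\<Sum>j=1..<N k. c j * w j\<bar> \<le> h k * (real (N k) * (B * g))"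
    using h_pos[of k] by (intro mult_left_mono) auto
  also have "\<dots> = (real (N k) * h k) * (B * g)" by (simp only: mult_ac)
  also have "\<dots> = B * g" by (simp only: Nh mult_1_left)
  finally show ?thesis using h_pos[of k] by (simp add: abs_mult)
qed

text \<open>The sum is an integral over \<open>(0,1)\<close> whose coefficient \<open>X k\<close> is cut off outside the interior
  cells; every \<open>x\<close> lies in an interior cell eventually.\<close>
lemma cell_sum_tendsto:
  fixes G :: "real \<Rightarrow> real"
  assumes t: "t \<in> {0..T}"
    and B: "\<And>k j. 1 \<le> j \<Longrightarrow> j < N k \<Longrightarrow> \<bar>c k j\<bar> \<le> B"
    and lim: "\<And>x. x \<in> {0<..<1} \<Longrightarrow> (\<lambda>k. c k (J k x)) \<longlonglongrightarrow> A x"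
    and G: "continuous_on UNIV G" "\<And>x y. x \<in> {-2*C..2*C} \<Longrightarrow> y \<in> {-2*C..2*C} \<Longrightarrow> \<bar>G x - G y\<bar> \<le> L * \<bar>x - y\<bar>" "L \<ge> 0"
  shows "(\<lambda>k. h k * (\<Sum>j=1..<N k. c k j * G (v k (I k t) j))) \<longlonglongrightarrow> (LBINT x:{0<..<1}. A x * G (u x t))"
proof -
  define X where "X k x = indicator {h k / 2..<1 - h k / 2} x * c k (J k x)" for k x
  define Y where "Y x = indicator {0<..<1::real} x * A x" for x
  have B0: "B \<ge> 0" using B[of 1 0] N2[of 0] by auto
  have [measurable]: "X k \<in> borel_measurable borel" for k unfolding X_def[abs_def] by measurable
  have XB: "\<bar>X k x\<bar> \<le> B" for k x
    using J_inner[of x k] B[of "J k x"] B0 by (auto simp: X_def indicator_def)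
  have Xlim: "(\<lambda>k. X k x) \<longlonglongrightarrow> A x" if x: "x \<in> {0<..<1}" for x
  proof (rule Lim_transform_eventually[OF lim[OF x]])
    show "\<forall>\<^sub>F k in sequentially. c k (J k x) = X k x"
      using indicator_inner_lim[OF x] by eventually_elim (simp add: X_def)
  qed
  have [measurable]: "Y \<in> borel_measurable borel"
    by (rule borel_measurable_LIMSEQ_real[of borel "\<lambda>k x. indicator {0<..<1} x * X k x"])
       (use Xlim in \<open>auto simp: Y_def indicator_def\<close>)
  have vC: "\<bar>v k (I k t) (J k x)\<bar> \<le> 2 * C" for k x
  proof -
    have "\<bar>v k (I k t) (J k x)\<bar> \<le> K" by (rule v_bound[OF I_le J_le])
    then show ?thesis using C C_nonneg by linarith
  qed
  have "(\<lambda>k. LBINT x:{0<..<1}. X k x * G (v k (I k t) (J k x))) \<longlonglongrightarrow> (LBINT x:{0<..<1}. Y x * G (u x t))"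
  proof (rule tendsto_integral_product[where K=B and B="2 * C" and L=L and G=G and A=X and A'=Y
        and U="\<lambda>k x. v k (I k t) (J k x)" and u="\<lambda>x. u x t"])
    show "(\<lambda>k. X k x) \<longlonglongrightarrow> Y x" if "x \<in> {0<..<1}" for x
      using Xlim[OF that] that by (simp add: Y_def)
    show "(\<lambda>x. u x t) \<in> borel_measurable borel" by measurable
    show "\<bar>u x t\<bar> \<le> 2 * C" for x by (rule u_bound)
    show "(\<lambda>x. v k (I k t) (J k x)) \<in> borel_measurable borel" for k by measurable
  qed (use XB vC U_lim[OF t] G in auto)
  moreover have "h k * (\<Sum>j=1..<N k. c k j * G (v k (I k t) j)) = (LBINT x:{0<..<1}. X k x * G (v k (I k t) (J k x)))" for k
    using space_sum_eq_integral[OF N2[of k], of "\<lambda>j. c k j * G (v k (I k t) j)"]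
    unfolding h_def[symmetric] J_def[symmetric] X_def by (simp add: mult.assoc)
  moreover have "(LBINT x:{0<..<1}. Y x * G (u x t)) = (LBINT x:{0<..<1}. A x * G (u x t))"
    unfolding set_lebesgue_integral_def by (intro Bochner_Integration.integral_cong) (auto simp: Y_def indicator_def)
  ultimately show ?thesis by simp
qed

text \<open>The trapezoidal sums are close to integrals of the step functions, and these converge by the
  convergence in \<open>L\<^sup>1\<close>.\<close>
lemma P_lim:
  assumes t: "t \<in> {0..T}" and x: "x \<in> {0<..<1}"
  shows "(\<lambda>k. P_disc (N k) (v k (I k t)) (J k x)) \<longlonglongrightarrow> P_int u x t"
proof -
  have P: "P_int u x t = (LBINT y:{0<..<x}. u y t)"
    unfolding P_int_def set_lebesgue_integral_def
  proof (rule integral_cong_AE)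
    show "AE y in lborel. indicator {0..x} y *\<^sub>R u y t = indicator {0<..<x} y *\<^sub>R u y t"
      using AE_lborel_singleton[of 0] AE_lborel_singleton[of x] by eventually_elim (auto simp: indicator_def)
  qed measurable
  have int: "set_integrable lborel {0<..<1} (\<lambda>y. v k (I k t) (J k y))" for k
    unfolding J_def by (rule step_function_integrable) auto
  have intu: "set_integrable lborel {0<..<1} (\<lambda>y. u y t)"
    by (rule set_integrable_bounded_interval[OF _ u_bound]) measurable
  have 1: "(\<lambda>k. (LBINT y:{0<..<x}. v k (I k t) (J k y)) - (LBINT y:{0<..<x}. u y t)) \<longlonglongrightarrow> 0"
    by (rule Lim_null_comparison[OF _ U_lim[OF t]])
       (use set_integral_diff_le_dist1[OF int intu, of 0 x] x in auto)
  have 2: "(\<lambda>k. P_disc (N k) (v k (I k t)) (J k x) - (LBINT y:{0<..<x}. v k (I k t) (J k y))) \<longlonglongrightarrow> 0"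
  proof (rule Lim_null_comparison)
    show "(\<lambda>k. 4 * K * h k) \<longlonglongrightarrow> 0" using tendsto_mult_left[OF h_lim, of "4 * K"] by simp
    show "\<forall>\<^sub>F k in sequentially. norm (P_disc (N k) (v k (I k t)) (J k x) - (LBINT y:{0<..<x}. v k (I k t) (J k y))) \<le> 4 * K * h k"
      using indicator_inner_lim[OF x]
    proof eventually_elim
      case (elim k)
      then show ?case
        using P_disc_close_to_integral[OF N2, of k "v k (I k t)" K x] v_bound[OF I_le]
        unfolding h_def[symmetric] J_def[symmetric] by auto
    qed
  qed
  show ?thesis using tendsto_add[OF 1 2] unfolding P by (simp add: LIM_zero_iff)
qed

text \<open>The tested inequalities are summed over all time steps. The test function \<open>\<phi>\<close> may be positive at
  \<open>x = 0\<close> and \<open>x = 1\<close>. The interior values next to the boundary need not converge, but the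
  boundary terms are expressed by the boundary values alone, whose limits are \<open>a\<close> and \<open>b\<close>.\<close>
lemma entropy_inequality_with_boundary:
  fixes e e' e'' q Q1 c0 c1 :: "real \<Rightarrow> real" and \<phi> \<phi>x \<phi>t :: "real \<Rightarrow> real \<Rightarrow> real"
  assumes ent: "entropy_for_split_flux F1' F2' e e' q Q1"
    and de': "\<And>x. (e' has_real_derivative e'' x) (at x)" and ce'': "continuous_on UNIV e''"
    and c0: "\<And>x y. x \<in> {-K..K} \<Longrightarrow> y \<in> {-K..K} \<Longrightarrow> Q1 x + (q y - Q1 y) \<le> c0 x"
    and c1: "\<And>x y. x \<in> {-K..K} \<Longrightarrow> y \<in> {-K..K} \<Longrightarrow> c1 y \<le> Q1 x + (q y - Q1 y)"
    and cc0: "continuous_on UNIV c0" and Lc0: "\<And>x y. x \<in> {-2*C..2*C} \<Longrightarrow> y \<in> {-2*C..2*C} \<Longrightarrow> \<bar>c0 x - c0 y\<bar> \<le> L0 * \<bar>x - y\<bar>"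
    and cc1: "continuous_on UNIV c1" and Lc1: "\<And>x y. x \<in> {-2*C..2*C} \<Longrightarrow> y \<in> {-2*C..2*C} \<Longrightarrow> \<bar>c1 x - c1 y\<bar> \<le> L0 * \<bar>x - y\<bar>"
    and L0: "L0 \<ge> 0"
    and \<phi>_nonneg: "\<And>x t. x \<in> {0..1} \<Longrightarrow> t \<in> {0..T} \<Longrightarrow> 0 \<le> \<phi> x t"
    and \<phi>x: "\<And>x t. ((\<lambda>y. \<phi> y t) has_real_derivative \<phi>x x t) (at x)"
    and \<phi>t: "\<And>x t. ((\<lambda>s. \<phi> x s) has_real_derivative \<phi>t x t) (at t)"
    and c\<phi>: "continuous_on UNIV (\<lambda>(x, t). \<phi> x t)"
    and c\<phi>x: "continuous_on UNIV (\<lambda>(x, t). \<phi>x x t)" and c\<phi>t: "continuous_on UNIV (\<lambda>(x, t). \<phi>t x t)"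
  shows "0 \<le> (LBINT t:{0<..<T}. (LBINT x:{0<..<1}. \<phi>t x t * e (u x t)) + (LBINT x:{0<..<1}. \<phi>x x t * q (u x t))
        + (LBINT x:{0<..<1}. \<gamma> * \<phi> x t * P_int u x t * e' (u x t)))
      + (LBINT t:{0<..<T}. \<phi> 0 t * c0 (a t)) - (LBINT t:{0<..<T}. \<phi> 1 t * c1 (b t))
      + (LBINT x:{0<..<1}. \<phi> x 0 * e (u x 0)) - (LBINT x:{0<..<1}. \<phi> x T * e (u x T))"
proof -
  interpret E: entropy_for_split_flux F1' F2' e e' q Q1 by (rule ent)
  have ce': "continuous_on UNIV e'" using de' by (auto intro!: continuous_at_imp_continuous_on DERIV_isCont)
  have ce: "continuous_on UNIV e" using E.de by (auto intro!: continuous_at_imp_continuous_on DERIV_isCont)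
  have cq: "continuous_on UNIV q" using E.dq by (auto intro!: continuous_at_imp_continuous_on DERIV_isCont)
  have d2: "((\<lambda>x. q x - Q1 x) has_real_derivative e' x * F2' x) (at x)" for x
    by (auto intro!: derivative_eq_intros E.dq E.dQ1 simp: algebra_simps)
  obtain L1 where L1: "L1 \<ge> 0" "\<And>x y. x \<in> {-2*C..2*C} \<Longrightarrow> y \<in> {-2*C..2*C} \<Longrightarrow> \<bar>e x - e y\<bar> \<le> L1 * \<bar>x - y\<bar>"
    using C1_imp_lipschitz_on_interval[OF E.de ce', of "2*C"] by auto
  have cq': "continuous_on UNIV (\<lambda>x. e' x * (F1' x + F2' x))" "continuous_on UNIV (\<lambda>x. e' x * F2' x)"
    by (intro continuous_intros ce' cF1' cF2')+
  obtain L2 where L2: "L2 \<ge> 0" "\<And>x y. x \<in> {-2*C..2*C} \<Longrightarrow> y \<in> {-2*C..2*C} \<Longrightarrow> \<bar>q x - q y\<bar> \<le> L2 * \<bar>x - y\<bar>"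
    using C1_imp_lipschitz_on_interval[OF E.dq cq'(1), of "2*C"] by auto
  obtain L3 where L3: "L3 \<ge> 0" "\<And>x y. x \<in> {-2*C..2*C} \<Longrightarrow> y \<in> {-2*C..2*C} \<Longrightarrow> \<bar>e' x - e' y\<bar> \<le> L3 * \<bar>x - y\<bar>"
    using C1_imp_lipschitz_on_interval[OF de' ce'', of "2*C"] by auto
  obtain L4 where L4: "L4 \<ge> 0" "\<And>x y. x \<in> {-2*C..2*C} \<Longrightarrow> y \<in> {-2*C..2*C} \<Longrightarrow>
      \<bar>q x - Q1 x - (q y - Q1 y)\<bar> \<le> L4 * \<bar>x - y\<bar>"
    using C1_imp_lipschitz_on_interval[OF d2 cq'(2), of "2*C"] by auto
  define L where "L = max L3 L4"
  have KC: "x \<in> {-2*C..2*C}" if "x \<in> {-K..K}" for x using that C K_nonneg by auto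
  have Lip3: "\<bar>e' x - e' y\<bar> \<le> L * \<bar>x - y\<bar>" if "x \<in> {-K..K}" "y \<in> {-K..K}" for x y
    using L3(2)[OF KC KC, OF that] mult_right_mono[of L3 L "\<bar>x - y\<bar>"] by (simp add: L_def)
  have Lip4: "\<bar>q x - Q1 x - (q y - Q1 y)\<bar> \<le> L * \<bar>x - y\<bar>" if "x \<in> {-K..K}" "y \<in> {-K..K}" for x y
    using L4(2)[OF KC KC, OF that] mult_right_mono[of L4 L "\<bar>x - y\<bar>"] by (simp add: L_def)
  have bnd: "\<exists>B. \<forall>x\<in>{0..1}. \<forall>t\<in>{0..T}. \<bar>f x t\<bar> \<le> B" if "continuous_on UNIV (\<lambda>(x, t). f x t)" for f :: "real \<Rightarrow> real \<Rightarrow> real"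
  proof -
    have "compact ((\<lambda>(x, t). f x t) ` ({0..1} \<times> {0..T}))"
      by (intro compact_continuous_image continuous_on_subset[OF that] compact_Times) auto
    then obtain B where "\<forall>y\<in>(\<lambda>(x, t). f x t) ` ({0..1} \<times> {0..T}). norm y \<le> B"
      using compact_imp_bounded bounded_iff by metis
    then show ?thesis by (intro exI[of _ B]) auto
  qed
  obtain B1 B2 B3 where B123: "\<And>x t. x \<in> {0..1} \<Longrightarrow> t \<in> {0..T} \<Longrightarrow> \<bar>\<phi> x t\<bar> \<le> B1"
    "\<And>x t. x \<in> {0..1} \<Longrightarrow> t \<in> {0..T} \<Longrightarrow> \<bar>\<phi>x x t\<bar> \<le> B2" "\<And>x t. x \<in> {0..1} \<Longrightarrow> t \<in> {0..T} \<Longrightarrow> \<bar>\<phi>t x t\<bar> \<le> B3"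
    using bnd[OF c\<phi>] bnd[OF c\<phi>x] bnd[OF c\<phi>t] by metis
  define B where "B = max B1 (max B2 B3)"
  have B: "\<bar>\<phi> x t\<bar> \<le> B" "\<bar>\<phi>x x t\<bar> \<le> B" "\<bar>\<phi>t x t\<bar> \<le> B" if "x \<in> {0..1}" "t \<in> {0..T}" for x t
    using B123(1)[OF that] B123(2)[OF that] B123(3)[OF that] by (auto simp: B_def)
  have B0: "B \<ge> 0" using B(1)[of 0 0] T_pos by auto
  \<comment> \<open>The test function is sampled at the grid points. As in \<open>tested_entropy_step\<close>, the difference in
    time relates the levels \<open>n\<close> and \<open>n + 1\<close>, and everything else is taken at level \<open>n + 1\<close>.\<close>
  have xj: "real j * h k \<in> {0..1}" if "j \<le> N k" for j k
    using that mult_right_mono[of "real j" "real (N k)" "h k"] h_pos[of k] Nh[of k] by auto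
  have tn: "real n * \<tau> k \<in> {0..T}" if "n \<le> Suc (M k)" for n k
    using that mult_right_mono[of "real n" "real (Suc (M k))" "\<tau> k"] \<tau>_pos[of k] T_eq[of k] by auto
  define p where "p k n j = \<phi> (real j * h k) (real n * \<tau> k)" for k n j
  define dt where "dt k n j = (p k (Suc n) j - p k n j) / \<tau> k" for k n j
  define dx where "dx k n j = (p k (Suc n) (Suc j) - p k (Suc n) j) / h k" for k n j
  define src where "src k n j = \<gamma> * p k (Suc n) j * P_disc (N k) (v k n) j" for k n j
  have dtB: "\<bar>dt k n j\<bar> \<le> B" if nj: "n \<le> M k" "j \<le> N k" for k n j
  proof -
    have "\<exists>z. real n * \<tau> k < z \<and> z < real (Suc n) * \<tau> k \<and> p k (Suc n) j - p k n j
        = (real (Suc n) * \<tau> k - real n * \<tau> k) * \<phi>t (real j * h k) z"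
      unfolding p_def by (rule MVT2) (use \<phi>t \<tau>_pos[of k] in auto)
    then obtain z where z: "real n * \<tau> k < z" "z < real (Suc n) * \<tau> k"
      "p k (Suc n) j - p k n j = (real (Suc n) * \<tau> k - real n * \<tau> k) * \<phi>t (real j * h k) z" by blast
    have "dt k n j = \<phi>t (real j * h k) z" using z(3) \<tau>_pos[of k] by (simp add: dt_def distrib_right)
    moreover have "z \<in> {0..T}" using z tn[of n k] tn[of "Suc n" k] nj by auto
    ultimately show ?thesis using B(3)[OF xj[OF nj(2)]] by simp
  qed
  have dxB: "\<bar>dx k n j\<bar> \<le> B" if nj: "n \<le> M k" "j < N k" for k n j
  proof -
    have "\<exists>z. real j * h k < z \<and> z < real (Suc j) * h k \<and> p k (Suc n) (Suc j) - p k (Suc n) j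
        = (real (Suc j) * h k - real j * h k) * \<phi>x z (real (Suc n) * \<tau> k)"
      unfolding p_def by (rule MVT2[where f="\<lambda>x. \<phi> x (real (Suc n) * \<tau> k)"]) (use \<phi>x h_pos[of k] in auto)
    then obtain z where z: "real j * h k < z" "z < real (Suc j) * h k"
      "p k (Suc n) (Suc j) - p k (Suc n) j = (real (Suc j) * h k - real j * h k) * \<phi>x z (real (Suc n) * \<tau> k)" by blast
    have "dx k n j = \<phi>x z (real (Suc n) * \<tau> k)" using z(3) h_pos[of k] by (simp add: dx_def distrib_right)
    moreover have "z \<in> {0..1}" using z xj[of j k] xj[of "Suc j" k] nj by auto
    ultimately show ?thesis using B(2)[OF _ tn[of "Suc n" k]] nj by simp
  qed
  have srcB: "\<bar>src k n j\<bar> \<le> \<gamma> * B * K" if nj: "n \<le> M k" "1 \<le> j" "j < N k" for k n j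
    unfolding src_def abs_mult p_def
    using nj B(1)[OF xj[of j k] tn[of "Suc n" k]] P_bound[of n k j] \<gamma>_pos B0 K_nonneg
    by (intro mult_mono) auto
  \<comment> \<open>At a fixed time the three space sums converge; below, bounded convergence integrates this over time.\<close>
  define S1 where "S1 k n = h k * (\<Sum>j=1..<N k. dt k n j * e (v k n j))" for k n
  define S2 where "S2 k n = h k * (\<Sum>j=1..<N k. dx k n j * q (v k n j))" for k n
  define S3 where "S3 k n = h k * (\<Sum>j=1..<N k. src k n j * e' (v k n j))" for k n
  have lim1: "(\<lambda>k. S1 k (I k t)) \<longlonglongrightarrow> (LBINT x:{0<..<1}. \<phi>t x t * e (u x t))" if t: "t \<in> {0<..<T}" for t
    unfolding S1_def
  proof (rule cell_sum_tendsto[where c="\<lambda>k. dt k (I k t)" and G=e and A="\<lambda>x. \<phi>t x t" and B=B and L=L1])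
    show "\<bar>dt k (I k t) j\<bar> \<le> B" if "1 \<le> j" "j < N k" for k j
      using that t I_bounds(3)[of t k] by (intro dtB) auto
    show "(\<lambda>k. dt k (I k t) (J k x)) \<longlonglongrightarrow> \<phi>t x t" if "x \<in> {0<..<1}" for x
      using difference_quotient_tendsto[OF \<phi>t c\<phi>t J_lim[OF that] I_lim, of t] t \<tau>_pos
      by (simp add: dt_def p_def distrib_right)
  qed (use t ce L1 in auto)
  have lim2: "(\<lambda>k. S2 k (I k t)) \<longlonglongrightarrow> (LBINT x:{0<..<1}. \<phi>x x t * q (u x t))" if t: "t \<in> {0<..<T}" for t
    unfolding S2_def
  proof (rule cell_sum_tendsto[where c="\<lambda>k. dx k (I k t)" and G=q and A="\<lambda>x. \<phi>x x t" and B=B and L=L2])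
    show "\<bar>dx k (I k t) j\<bar> \<le> B" if "1 \<le> j" "j < N k" for k j
      using that t I_bounds(3)[of t k] by (intro dxB) auto
    show "(\<lambda>k. dx k (I k t) (J k x)) \<longlonglongrightarrow> \<phi>x x t" if x: "x \<in> {0<..<1}" for x
    proof -
      have c': "continuous_on UNIV (\<lambda>(t, x). \<phi>x x t)"
        using continuous_on_compose2[OF c\<phi>x, of UNIV prod.swap] by (auto simp: case_prod_unfold intro!: continuous_intros)
      have J2: "(\<lambda>k. real (Suc (J k x)) * h k) \<longlonglongrightarrow> x"
        using tendsto_add[OF J_lim[OF x] h_lim] by (simp add: distrib_right add.commute)
      show ?thesis
        using difference_quotient_tendsto[of "\<lambda>t x. \<phi> x t" "\<lambda>t x. \<phi>x x t", OF \<phi>x c' I_lim(2)[of t] J_lim[OF x] J2] t h_pos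
        by (simp add: dx_def p_def distrib_right)
    qed
  qed (use t cq L2 in auto)
  have point: "(\<lambda>k. \<phi> (X k) (Y k)) \<longlonglongrightarrow> \<phi> x t" if "X \<longlonglongrightarrow> x" "Y \<longlonglongrightarrow> t" for X Y x t
  proof -
    have "(\<lambda>k. (X k, Y k)) \<longlonglongrightarrow> (x, t)" using that by (intro tendsto_Pair)
    then have "(\<lambda>k. (\<lambda>(x, t). \<phi> x t) (X k, Y k)) \<longlonglongrightarrow> (\<lambda>(x, t). \<phi> x t) (x, t)"
      using c\<phi> by (intro isCont_tendsto_compose[of "(x, t)" "\<lambda>(x, t). \<phi> x t"]) (auto simp: continuous_on_eq_continuous_at)
    then show ?thesis by simp
  qed
  have lim3: "(\<lambda>k. S3 k (I k t)) \<longlonglongrightarrow> (LBINT x:{0<..<1}. \<gamma> * \<phi> x t * P_int u x t * e' (u x t))" if t: "t \<in> {0<..<T}" for t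
    unfolding S3_def
  proof (rule cell_sum_tendsto[where c="\<lambda>k. src k (I k t)" and G=e' and A="\<lambda>x. \<gamma> * \<phi> x t * P_int u x t" and B="\<gamma> * B * K" and L=L3])
    show "\<bar>src k (I k t) j\<bar> \<le> \<gamma> * B * K" if "1 \<le> j" "j < N k" for k j
      using that t I_bounds(3)[of t k] by (intro srcB) auto
    show "(\<lambda>k. src k (I k t) (J k x)) \<longlonglongrightarrow> \<gamma> * \<phi> x t * P_int u x t" if "x \<in> {0<..<1}" for x
      unfolding src_def p_def using that t by (intro tendsto_intros point J_lim I_lim P_lim) auto
  qed (use t ce' L3 in auto)
  obtain g where g: "\<And>x. x \<in> {-K..K} \<Longrightarrow> \<bar>e x\<bar> \<le> g" "\<And>x. x \<in> {-K..K} \<Longrightarrow> \<bar>q x\<bar> \<le> g" "\<And>x. x \<in> {-K..K} \<Longrightarrow> \<bar>e' x\<bar> \<le> g"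
  proof -
    obtain g1 g2 g3 where "\<forall>x\<in>{-K..K}. \<bar>e x\<bar> \<le> g1" "\<forall>x\<in>{-K..K}. \<bar>q x\<bar> \<le> g2" "\<forall>x\<in>{-K..K}. \<bar>e' x\<bar> \<le> g3"
      using continuous_imp_bounded_on_interval[OF ce, of K] continuous_imp_bounded_on_interval[OF cq, of K]
        continuous_imp_bounded_on_interval[OF ce', of K] by blast
    then show thesis by (intro that[of "max g1 (max g2 g3)"]) (auto simp: le_max_iff_disj)
  qed
  have vK: "v k n j \<in> {-K..K}" if "n \<le> Suc (M k)" "j \<le> N k" for k n j
    using v_bound[OF that] by (auto simp: abs_le_iff)
  have SB: "\<bar>S1 k (I k t)\<bar> \<le> B * g" "\<bar>S2 k (I k t)\<bar> \<le> B * g" "\<bar>S3 k (I k t)\<bar> \<le> \<gamma> * B * K * g" if t: "t \<in> {0<..<T}" for k t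
  proof -
    have n: "I k t \<le> M k" using I_bounds(3)[of t k] t by auto
    show "\<bar>S1 k (I k t)\<bar> \<le> B * g" unfolding S1_def
      by (rule cell_sum_bounded) (use n in \<open>auto intro!: dtB g vK\<close>)
    show "\<bar>S2 k (I k t)\<bar> \<le> B * g" unfolding S2_def
      by (rule cell_sum_bounded) (use n in \<open>auto intro!: dxB g vK\<close>)
    show "\<bar>S3 k (I k t)\<bar> \<le> \<gamma> * B * K * g" unfolding S3_def
      by (rule cell_sum_bounded) (use n in \<open>auto intro!: srcB g vK\<close>)
  qed
  have limS: "(\<lambda>k. LBINT t:{0<..<T}. S1 k (I k t) + S2 k (I k t) + S3 k (I k t)) \<longlonglongrightarrow>
      (LBINT t:{0<..<T}. (LBINT x:{0<..<1}. \<phi>t x t * e (u x t)) + (LBINT x:{0<..<1}. \<phi>x x t * q (u x t))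
        + (LBINT x:{0<..<1}. \<gamma> * \<phi> x t * P_int u x t * e' (u x t)))"
  proof (rule tendsto_set_integral_bounded)
    show "\<bar>S1 k (I k t) + S2 k (I k t) + S3 k (I k t)\<bar> \<le> B * g + B * g + \<gamma> * B * K * g" if "t \<in> {0<..<T}" for k t
      using SB[OF that, of k] by linarith
  qed (auto intro!: tendsto_add lim1 lim2 lim3)
  \<comment> \<open>At the left end the test function is sampled at the first interior point \<open>h k\<close>, which tends to 0.\<close>
  have bdryB: "\<bar>v k (I k t) j\<bar> \<le> 2 * C" if "j \<le> N k" for k t j
    using v_bound[OF I_le that, of t] C C_nonneg by linarith
  have lim_a: "(\<lambda>k. LBINT t:{0<..<T}. p k (Suc (I k t)) 1 * c0 (v k (I k t) 0)) \<longlonglongrightarrow> (LBINT t:{0<..<T}. \<phi> 0 t * c0 (a t))"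
  proof (rule tendsto_integral_product[where K=B and B="2*C" and L=L0 and G=c0 and A="\<lambda>k t. p k (Suc (I k t)) 1"
        and A'="\<phi> 0" and U="\<lambda>k t. v k (I k t) 0" and u=a])
    show "(\<lambda>k. p k (Suc (I k t)) 1) \<longlonglongrightarrow> \<phi> 0 t" if "t \<in> {0<..<T}" for t
      unfolding p_def using that h_lim by (intro point I_lim) auto
    show "\<bar>p k (Suc (I k t)) 1\<bar> \<le> B" if "t \<in> {0<..<T}" for k t
      unfolding p_def using that I_bounds(3)[of t k] N2[of k] by (intro B xj tn) auto
    show "\<phi> 0 \<in> borel_measurable borel"
      using \<phi>t[of 0] by (intro borel_measurable_continuous_onI continuous_at_imp_continuous_on) (auto intro: DERIV_isCont)
    show "(\<lambda>k. dist1 0 T (\<lambda>t. v k (I k t) 0) a) \<longlonglongrightarrow> 0" using a_lim unfolding I_def \<tau>_def .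
    show "\<bar>a t\<bar> \<le> 2 * C" for t by (rule bvr_bounded[OF a])
  qed (use bdryB cc0 Lc0 L0 bvr_measurable[OF a] in auto)
  have lim_b: "(\<lambda>k. LBINT t:{0<..<T}. p k (Suc (I k t)) (N k) * c1 (v k (I k t) (N k))) \<longlonglongrightarrow> (LBINT t:{0<..<T}. \<phi> 1 t * c1 (b t))"
  proof (rule tendsto_integral_product[where K=B and B="2*C" and L=L0 and G=c1 and A="\<lambda>k t. p k (Suc (I k t)) (N k)"
        and A'="\<phi> 1" and U="\<lambda>k t. v k (I k t) (N k)" and u=b])
    show "(\<lambda>k. p k (Suc (I k t)) (N k)) \<longlonglongrightarrow> \<phi> 1 t" if "t \<in> {0<..<T}" for t
      unfolding p_def Nh using that by (intro point I_lim) auto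
    show "\<bar>p k (Suc (I k t)) (N k)\<bar> \<le> B" if "t \<in> {0<..<T}" for k t
      unfolding p_def using that I_bounds(3)[of t k] N2[of k] by (intro B xj tn) auto
    show "\<phi> 1 \<in> borel_measurable borel"
      using \<phi>t[of 1] by (intro borel_measurable_continuous_onI continuous_at_imp_continuous_on) (auto intro: DERIV_isCont)
    show "(\<lambda>k. dist1 0 T (\<lambda>t. v k (I k t) (N k)) b) \<longlonglongrightarrow> 0" using b_lim unfolding I_def \<tau>_def .
    show "\<bar>b t\<bar> \<le> 2 * C" for t by (rule bvr_bounded[OF b])
  qed (use bdryB cc1 Lc1 L0 bvr_measurable[OF b] in auto)
  \<comment> \<open>The time slabs meet the times 0 and \<open>T\<close> exactly, so the sums there are cell sums of \<open>u\<close> at these times.\<close>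
  define En where "En k n = h k * (\<Sum>j=1..<N k. p k n j * e (v k n j))" for k n
  have lim_end: "(\<lambda>k. En k (I k t)) \<longlonglongrightarrow> (LBINT x:{0<..<1}. \<phi> x t * e (u x t))"
    if t: "t \<in> {0, T}" for t
    unfolding En_def
  proof (rule cell_sum_tendsto[where c="\<lambda>k. p k (I k t)" and G=e and A="\<lambda>x. \<phi> x t" and B=B and L=L1])
    have tt: "real (I k t) * \<tau> k = t" for k using t I_0[of k] I_T[of k] T_eq[of k] by auto
    show "t \<in> {0..T}" using t T_pos by auto
    show "\<bar>p k (I k t) j\<bar> \<le> B" if "1 \<le> j" "j < N k" for k j
      unfolding p_def using that I_le by (intro B xj tn) auto
    show "(\<lambda>k. p k (I k t) (J k x)) \<longlonglongrightarrow> \<phi> x t" if "x \<in> {0<..<1}" for x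
      unfolding p_def tt using that by (intro point J_lim) auto
  qed (use ce L1 in auto)
  \<comment> \<open>The sum over the time steps telescopes on the left-hand side and is an integral over \<open>(0,T)\<close> on the
    right-hand side. The errors \<open>T * err k\<close> vanish with the mesh size.\<close>
  define Dk where "Dk = (4 * K + 2 * variation_bound W R \<gamma> T + \<gamma> * lam * K) / lam"
  define err where "err k = B * L * variation_bound W R \<gamma> T * h k + \<gamma> * B * L * K * Dk * \<tau> k" for k
  have disc: "En k (Suc (M k)) - En k 0 \<le> (LBINT t:{0<..<T}. S1 k (I k t) + S2 k (I k t) + S3 k (I k t))
      + (LBINT t:{0<..<T}. p k (Suc (I k t)) 1 * c0 (v k (I k t) 0))
      - (LBINT t:{0<..<T}. p k (Suc (I k t)) (N k) * c1 (v k (I k t) (N k))) + T * err k" for k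
  proof -
    interpret g: scheme_grid F1 F2 F1' F2' lam \<gamma> T R W "N k" "M k" "v k" by (rule grid)
    interpret ge: scheme_grid_entropy F1 F2 F1' F2' lam \<gamma> T R W "N k" "M k" "v k" e e' q Q1 ..
    define S where "S n = S1 k n + S2 k n + S3 k n" for n
    define Ba where "Ba n = p k (Suc n) 1 * c0 (v k n 0)" for n
    define Bb where "Bb n = p k (Suc n) (N k) * c1 (v k n (N k))" for n
    have step: "En k (Suc n) - En k n \<le> \<tau> k * (S n + Ba n - Bb n + err k)" if n: "n \<le> M k" for n
    proof -
      have "En k (Suc n) - En k n \<le> \<tau> k * (S1 k n + S2 k n + S3 k n + p k (Suc n) 1 * c0 (v k n 0)
          - p k (Suc n) (N k) * c1 (v k n (N k)) + B * L * variation_bound W R \<gamma> T * h k + \<gamma> * B * L * K * Dk * \<tau> k)"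
        unfolding En_def S1_def S2_def S3_def dt_def dx_def src_def Dk_def h_def[of k] \<tau>_def[of k]
      proof (rule ge.tested_entropy_step[OF n])
        show "0 \<le> p k (Suc n) j" "p k (Suc n) j \<le> B" if "j \<le> N k" for j
        proof -
          show "0 \<le> p k (Suc n) j" unfolding p_def using n that by (intro \<phi>_nonneg xj tn) auto
          have "\<bar>p k (Suc n) j\<bar> \<le> B" unfolding p_def using n that by (intro B xj tn) auto
          then show "p k (Suc n) j \<le> B" by linarith
        qed
        show "\<bar>p k (Suc n) (Suc j) - p k (Suc n) j\<bar> \<le> B * (1 / real (N k))" if "j < N k" for j
          using dxB[OF n that] h_pos[of k] unfolding dx_def h_def[symmetric]
          by (simp add: abs_divide pos_divide_le_eq)
        show "0 \<le> L" using L3 by (simp add: L_def le_max_iff_disj)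
      qed (use Lip3 Lip4 c0 c1 in \<open>simp_all add: ge.Q_def\<close>)
      then show ?thesis by (simp only: S_def Ba_def Bb_def err_def add.assoc)
    qed
    have "En k (Suc (M k)) - En k 0 = (\<Sum>n<Suc (M k). En k (Suc n) - En k n)"
      by (rule sum_lessThan_telescope[symmetric])
    also have "\<dots> \<le> (\<Sum>n<Suc (M k). \<tau> k * (S n + Ba n - Bb n + err k))"
      by (intro sum_mono step) auto
    also have "\<dots> = \<tau> k * (\<Sum>n<Suc (M k). S n) + \<tau> k * (\<Sum>n<Suc (M k). Ba n) - \<tau> k * (\<Sum>n<Suc (M k). Bb n)
        + (real (Suc (M k)) * \<tau> k) * err k"
      by (simp only: sum_distrib_left sum.distrib sum_subtractf sum_constant card_lessThan distrib_left right_diff_distrib mult_ac)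
    finally show ?thesis
      unfolding T_eq by (simp only: time_sum_eq_integral[OF \<tau>_pos T_eq] I_def[symmetric] S_def Ba_def Bb_def)
  qed
  have "(\<lambda>k. T * err k) \<longlonglongrightarrow> T * (B * L * variation_bound W R \<gamma> T * 0 + \<gamma> * B * L * K * Dk * 0)"
    unfolding err_def by (intro tendsto_intros h_lim \<tau>_lim)
  then have lim_err: "(\<lambda>k. T * err k) \<longlonglongrightarrow> 0" by simp
  have "(\<lambda>k. En k (Suc (M k)) - En k 0) \<longlonglongrightarrow> (LBINT x:{0<..<1}. \<phi> x T * e (u x T)) - (LBINT x:{0<..<1}. \<phi> x 0 * e (u x 0))"
    using tendsto_diff[OF lim_end[of T] lim_end[of 0]] by (simp add: I_0 I_T)
  from LIMSEQ_le[OF this tendsto_add[OF tendsto_diff[OF tendsto_add[OF limS lim_a] lim_b] lim_err]] disc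
  show ?thesis by auto
qed

end

section \<open>Boundary entropy inequalities\<close>

lemma antiderivative_exists:
  fixes g :: "real \<Rightarrow> real"
  assumes "continuous_on UNIV g"
  shows "\<exists>G. \<forall>x. (G has_real_derivative g x) (at x)"
  using einterval_antiderivative[of "-\<infinity>" "\<infinity>" g] assms
  by (auto simp: has_real_derivative_iff_has_vector_derivative continuous_on_eq_continuous_at)

context scheme_limit
begin

lemma integral_in_x_measurable:
  fixes g :: "real \<Rightarrow> real \<Rightarrow> real"
  assumes [measurable]: "(\<lambda>(t, x). g t x) \<in> borel_measurable (borel \<Otimes>\<^sub>M borel)"
  shows "(\<lambda>t. LBINT x:{0<..<1}. g t x) \<in> borel_measurable borel"
  unfolding set_lebesgue_integral_def
  by (rule lborel.borel_measurable_lebesgue_integral) measurable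

lemma P_int_measurable [measurable]: "(\<lambda>(x, t). P_int u x t) \<in> borel_measurable (borel \<Otimes>\<^sub>M borel)"
proof -
  have eq: "(\<lambda>(x, t). P_int u x t) = (\<lambda>z. LINT y|lborel. (if 0 \<le> y \<and> y \<le> fst z then u y (snd z) else 0))"
    by (auto simp: P_int_def set_lebesgue_integral_def fun_eq_iff indicator_def intro!: Bochner_Integration.integral_cong)
  show ?thesis unfolding eq
    by (rule lborel.borel_measurable_lebesgue_integral) measurable
qed

lemma P_int_bound: "x \<in> {0<..<1} \<Longrightarrow> \<bar>P_int u x t\<bar> \<le> 2 * C"
proof -
  assume x: "x \<in> {0<..<1}"
  have "P_int u x t = (LBINT y:{0<..<x}. u y t)"
    unfolding P_int_def set_lebesgue_integral_def
  proof (rule integral_cong_AE)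
    show "AE y in lborel. indicator {0..x} y *\<^sub>R u y t = indicator {0<..<x} y *\<^sub>R u y t"
      using AE_lborel_singleton[of 0] AE_lborel_singleton[of x] by eventually_elim (auto simp: indicator_def)
  qed measurable
  moreover have "\<bar>LBINT y:{0<..<x}. u y t\<bar> \<le> 2 * C * (x - 0)"
    by (rule set_integral_abs_le) (use x u_bound C_nonneg in auto)
  moreover have "2 * C * (x - 0) \<le> 2 * C * 1" using x C_nonneg by (intro mult_left_mono) auto
  ultimately show ?thesis by simp
qed

text \<open>The cut-off functions \<open>\<kappa> m\<close> tend to 0 in the interior, so that in the inequality tested with
  \<open>p t * \<kappa> m x\<close> all terms without \<open>\<kappa>'\<close> vanish in the limit. What remains is the flux term, in which the
  weight \<open>\<kappa>' m\<close> concentrates at the boundary, and the boundary terms. The values \<open>\<sigma>0\<close> and \<open>\<sigma>1\<close> select the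
  end of the interval.\<close>
lemma boundary_layer_limit:
  fixes e e' e'' q Q1 c0 c1 p p' Wt :: "real \<Rightarrow> real" and \<kappa> \<kappa>' :: "nat \<Rightarrow> real \<Rightarrow> real"
  assumes ent: "entropy_for_split_flux F1' F2' e e' q Q1"
    and de': "\<And>x. (e' has_real_derivative e'' x) (at x)" and ce'': "continuous_on UNIV e''"
    and c0: "\<And>x y. Q1 x + (q y - Q1 y) \<le> c0 x" and c1: "\<And>x y. c1 y \<le> Q1 x + (q y - Q1 y)"
    and dc0: "\<And>x. (c0 has_real_derivative c0' x) (at x)" "continuous_on UNIV c0'"
    and dc1: "\<And>x. (c1 has_real_derivative c1' x) (at x)" "continuous_on UNIV c1'"
    and p_nonneg: "\<And>t. t \<in> {0..T} \<Longrightarrow> 0 \<le> p t"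
    and dp: "\<And>t. (p has_real_derivative p' t) (at t)" and cp': "continuous_on UNIV p'"
    and d\<kappa>: "\<And>m x. (\<kappa> m has_real_derivative \<kappa>' m x) (at x)" and c\<kappa>': "\<And>m. continuous_on UNIV (\<kappa>' m)"
    and \<kappa>01: "\<And>m x. x \<in> {0..1} \<Longrightarrow> 0 \<le> \<kappa> m x \<and> \<kappa> m x \<le> 1"
    and \<kappa>_lim: "\<And>x. x \<in> {0<..<1} \<Longrightarrow> (\<lambda>m. \<kappa> m x) \<longlonglongrightarrow> 0"
    and \<kappa>_ends: "\<And>m. \<kappa> m 0 = \<sigma>0" "\<And>m. \<kappa> m 1 = \<sigma>1"
    and conc: "\<And>t. t \<in> {0<..<T} \<Longrightarrow> (\<lambda>m. LBINT x:{0<..<1}. \<kappa>' m x * q (u x t)) \<longlonglongrightarrow> Wt t"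
    and mass: "\<And>m. (LBINT x:{0<..<1}. \<bar>\<kappa>' m x\<bar>) \<le> 1"
  shows "0 \<le> (LBINT t:{0<..<T}. p t * Wt t) + \<sigma>0 * (LBINT t:{0<..<T}. p t * c0 (a t)) - \<sigma>1 * (LBINT t:{0<..<T}. p t * c1 (b t))"
proof -
  interpret E: entropy_for_split_flux F1' F2' e e' q Q1 by (rule ent)
  have cont: "continuous_on UNIV g" if "\<And>x. (g has_real_derivative g' x) (at x)" for g g' :: "real \<Rightarrow> real"
    using that by (auto intro!: continuous_at_imp_continuous_on DERIV_isCont)
  have ce: "continuous_on UNIV e" "continuous_on UNIV e'" "continuous_on UNIV q" "continuous_on UNIV c0"
     "continuous_on UNIV c1" "continuous_on UNIV p" "continuous_on UNIV (\<kappa> m)" for m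
    using cont[of e, OF E.de] cont[of e', OF de'] cont[of q, OF E.dq] cont[of c0, OF dc0(1)] cont[of c1, OF dc1(1)] cont[of p, OF dp] cont[of "\<kappa> m", OF d\<kappa>]
    by auto
  have [measurable]: "e \<in> borel_measurable borel" "e' \<in> borel_measurable borel" "q \<in> borel_measurable borel"
     "p \<in> borel_measurable borel" "p' \<in> borel_measurable borel" "\<kappa> m \<in> borel_measurable borel" "\<kappa>' m \<in> borel_measurable borel" for m
    using ce cp' c\<kappa>' by (auto intro: borel_measurable_continuous_onI)
  obtain L0 where L0: "L0 \<ge> 0" "\<And>x y. x \<in> {-2*C..2*C} \<Longrightarrow> y \<in> {-2*C..2*C} \<Longrightarrow> \<bar>c0 x - c0 y\<bar> \<le> L0 * \<bar>x - y\<bar>"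
    using C1_imp_lipschitz_on_interval[OF dc0, of "2*C"] by auto
  obtain L1 where L1: "L1 \<ge> 0" "\<And>x y. x \<in> {-2*C..2*C} \<Longrightarrow> y \<in> {-2*C..2*C} \<Longrightarrow> \<bar>c1 x - c1 y\<bar> \<le> L1 * \<bar>x - y\<bar>"
    using C1_imp_lipschitz_on_interval[OF dc1, of "2*C"] by auto
  have cpair: "continuous_on UNIV (\<lambda>(x, t). g t * f x)" if "continuous_on UNIV f" "continuous_on UNIV g" for f g :: "real \<Rightarrow> real"
    unfolding case_prod_unfold
    by (intro continuous_on_mult continuous_on_compose2[OF that(1)] continuous_on_compose2[OF that(2)] continuous_intros) auto
  define A where "A m t = (LBINT x:{0<..<1}. p' t * \<kappa> m x * e (u x t))" for m t
  define B where "B m t = (LBINT x:{0<..<1}. p t * \<kappa>' m x * q (u x t))" for m t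
  define S where "S m t = (LBINT x:{0<..<1}. \<gamma> * (p t * \<kappa> m x) * P_int u x t * e' (u x t))" for m t
  define X where "X m t = (LBINT x:{0<..<1}. p t * \<kappa> m x * e (u x t))" for m t
  have ineq: "0 \<le> (LBINT t:{0<..<T}. A m t + B m t + S m t)
      + (LBINT t:{0<..<T}. p t * \<kappa> m 0 * c0 (a t)) - (LBINT t:{0<..<T}. p t * \<kappa> m 1 * c1 (b t)) + X m 0 - X m T" for m
    unfolding A_def B_def S_def X_def
  proof (rule entropy_inequality_with_boundary[OF ent de' ce'', where ?L0.0="max L0 L1"])
    show "\<bar>c0 x - c0 y\<bar> \<le> max L0 L1 * \<bar>x - y\<bar>" if "x \<in> {-2*C..2*C}" "y \<in> {-2*C..2*C}" for x y
      using L0(2)[OF that] mult_right_mono[of L0 "max L0 L1" "\<bar>x - y\<bar>"] by simp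
    show "\<bar>c1 x - c1 y\<bar> \<le> max L0 L1 * \<bar>x - y\<bar>" if "x \<in> {-2*C..2*C}" "y \<in> {-2*C..2*C}" for x y
      using L1(2)[OF that] mult_right_mono[of L1 "max L0 L1" "\<bar>x - y\<bar>"] by simp
    show "continuous_on UNIV (\<lambda>(x, t). p t * \<kappa> m x)" "continuous_on UNIV (\<lambda>(x, t). p t * \<kappa>' m x)" "continuous_on UNIV (\<lambda>(x, t). p' t * \<kappa> m x)"
      by (intro cpair ce cp' c\<kappa>')+
    show "((\<lambda>y. p t * \<kappa> m y) has_real_derivative p t * \<kappa>' m x) (at x)" for x t
      by (rule DERIV_cmult[OF d\<kappa>])
    show "((\<lambda>s. p s * \<kappa> m x) has_real_derivative p' t * \<kappa> m x) (at t)" for x t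
      by (rule DERIV_cmult_right[OF dp])
  qed (use c0 c1 ce L0 p_nonneg \<kappa>01 in auto)
  note bnd = continuous_imp_bounded_on_interval
  have u2C: "u x t \<in> {- (2*C)..2*C}" for x t using u_bound[of x t] by (auto simp: abs_le_iff)
  obtain g1 g2 g3 where g: "g1 \<ge> 0" "g2 \<ge> 0" "g3 \<ge> 0" "\<And>x t. \<bar>e (u x t)\<bar> \<le> g1" "\<And>x t. \<bar>q (u x t)\<bar> \<le> g2" "\<And>x t. \<bar>e' (u x t)\<bar> \<le> g3"
    using bnd[OF ce(1), of "2*C"] bnd[OF ce(3), of "2*C"] bnd[OF ce(2), of "2*C"] u2C by metis
  obtain b1 b2 where b12: "b1 \<ge> 0" "b2 \<ge> 0" "\<And>t. t \<in> {-T..T} \<Longrightarrow> \<bar>p t\<bar> \<le> b1" "\<And>t. t \<in> {-T..T} \<Longrightarrow> \<bar>p' t\<bar> \<le> b2"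
    using bnd[OF ce(6), of T] bnd[OF cp', of T] by metis
  have \<kappa>abs: "\<bar>\<kappa> m x\<bar> \<le> 1" if "x \<in> {0<..<1}" for m x using \<kappa>01[of x m] that by auto
  have bA: "\<bar>p' t * \<kappa> m x * e (u x t)\<bar> \<le> b2 * 1 * g1" and bX: "\<bar>p t * \<kappa> m x * e (u x t)\<bar> \<le> b1 * 1 * g1"
    and bS: "\<bar>\<gamma> * (p t * \<kappa> m x) * P_int u x t * e' (u x t)\<bar> \<le> \<gamma> * (b1 * 1) * (2 * C) * g3"
    if t: "t \<in> {0..T}" and x: "x \<in> {0<..<1}" for m t x
  proof -
    have t': "t \<in> {-T..T}" using t T_pos by auto
    show "\<bar>p' t * \<kappa> m x * e (u x t)\<bar> \<le> b2 * 1 * g1" unfolding abs_mult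
      by (intro mult_mono b12 g \<kappa>abs t' x mult_nonneg_nonneg) auto
    show "\<bar>p t * \<kappa> m x * e (u x t)\<bar> \<le> b1 * 1 * g1" unfolding abs_mult
      by (intro mult_mono b12 g \<kappa>abs t' x mult_nonneg_nonneg) auto
    show "\<bar>\<gamma> * (p t * \<kappa> m x) * P_int u x t * e' (u x t)\<bar> \<le> \<gamma> * (b1 * 1) * (2 * C) * g3" unfolding abs_mult
      using \<gamma>_pos C_nonneg by (intro mult_mono b12 g \<kappa>abs t' x mult_nonneg_nonneg P_int_bound) auto
  qed
  have mA: "A m \<in> borel_measurable borel" "B m \<in> borel_measurable borel" "S m \<in> borel_measurable borel" for m
    unfolding A_def[abs_def] B_def[abs_def] S_def[abs_def] by (intro integral_in_x_measurable; measurable)+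
  have vanish: "(\<lambda>m. LBINT x:{0<..<1}. F m x) \<longlonglongrightarrow> 0"
    if "\<And>m. F m \<in> borel_measurable borel" "\<And>m x. x \<in> {0<..<1} \<Longrightarrow> \<bar>F m x\<bar> \<le> c"
      "\<And>x. x \<in> {0<..<1} \<Longrightarrow> (\<lambda>m. F m x) \<longlonglongrightarrow> 0" for F :: "nat \<Rightarrow> real \<Rightarrow> real" and c
    using tendsto_set_integral_bounded[of F 0 1 c "\<lambda>_. 0", OF that] by simp
  have limA: "(\<lambda>m. A m t) \<longlonglongrightarrow> 0" and limX: "(\<lambda>m. X m t) \<longlonglongrightarrow> 0" and limS: "(\<lambda>m. S m t) \<longlonglongrightarrow> 0"
    if t: "t \<in> {0..T}" for t
  proof -
    have *: "(\<lambda>m. c * \<kappa> m x * d) \<longlonglongrightarrow> 0" if "x \<in> {0<..<1}" for c d x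
      using tendsto_mult_right[OF tendsto_mult_left[OF \<kappa>_lim[OF that], of c], of d] by simp
    show "(\<lambda>m. A m t) \<longlonglongrightarrow> 0" unfolding A_def
      by (rule vanish[OF _ bA[OF t]]) (use * in auto)
    show "(\<lambda>m. X m t) \<longlonglongrightarrow> 0" unfolding X_def
      by (rule vanish[OF _ bX[OF t]]) (use * in auto)
    show "(\<lambda>m. S m t) \<longlonglongrightarrow> 0" unfolding S_def
    proof (rule vanish[OF _ bS[OF t]])
      show "(\<lambda>m. \<gamma> * (p t * \<kappa> m x) * P_int u x t * e' (u x t)) \<longlonglongrightarrow> 0" if "x \<in> {0<..<1}" for x
        using *[OF that, of "\<gamma> * p t" "P_int u x t * e' (u x t)"] by (simp add: mult.assoc)
    qed auto
  qed
  have i\<kappa>: "set_integrable lborel {0<..<1} (\<kappa>' m)" for m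
    by (rule set_integrable_subset[of _ "{0..1}"])
       (use c\<kappa>'[of m] in \<open>auto intro!: borel_integrable_atLeastAtMost' continuous_on_subset[of UNIV]\<close>)
  have Beq: "B m t = p t * (LBINT x:{0<..<1}. \<kappa>' m x * q (u x t))" for m t
    by (simp add: B_def mult.assoc)
  have qint: "\<bar>LBINT x:{0<..<1}. \<kappa>' m x * q (u x t)\<bar> \<le> g2" for m t
  proof -
    have i1: "set_integrable lborel {0<..<1} (\<lambda>x. \<bar>\<kappa>' m x\<bar> * g2)"
      using set_integrable_abs[OF i\<kappa>] by (rule set_integrable_mult_left)
    have i2: "set_integrable lborel {0<..<1} (\<lambda>x. \<kappa>' m x * q (u x t))"
      by (rule set_integrable_bound[OF i1])
         (use g in \<open>auto simp: abs_mult set_borel_measurable_def intro!: AE_I2 mult_left_mono\<close>)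
    have "\<bar>LBINT x:{0<..<1}. \<kappa>' m x * q (u x t)\<bar> \<le> (LBINT x:{0<..<1}. \<bar>\<kappa>' m x * q (u x t)\<bar>)"
      using set_integral_norm_bound[OF i2] by simp
    also have "\<dots> \<le> (LBINT x:{0<..<1}. \<bar>\<kappa>' m x\<bar> * g2)"
      by (rule set_integral_mono[OF set_integrable_abs[OF i2] i1]) (use g in \<open>auto simp: abs_mult intro!: mult_left_mono\<close>)
    also have "\<dots> = (LBINT x:{0<..<1}. \<bar>\<kappa>' m x\<bar>) * g2" by simp
    also have "\<dots> \<le> 1 * g2" using mass g by (intro mult_right_mono) auto
    finally show ?thesis by simp
  qed
  have bint: "\<bar>LBINT x:{0<..<1}. F x\<bar> \<le> c" if "\<And>x. x \<in> {0<..<1} \<Longrightarrow> \<bar>F x\<bar> \<le> c" "0 \<le> c" for F :: "real \<Rightarrow> real" and c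
    using set_integral_abs_le[of 0 1 F c] that by simp
  have "(\<lambda>m. LBINT t:{0<..<T}. A m t + B m t + S m t) \<longlonglongrightarrow> (LBINT t:{0<..<T}. p t * Wt t)"
  proof (rule tendsto_set_integral_bounded)
    show "\<bar>A m t + B m t + S m t\<bar> \<le> b2 * 1 * g1 + b1 * g2 + \<gamma> * (b1 * 1) * (2 * C) * g3" if t: "t \<in> {0<..<T}" for m t
    proof -
      have t': "t \<in> {0..T}" "t \<in> {-T..T}" using t T_pos by auto
      have "\<bar>A m t\<bar> \<le> b2 * 1 * g1" unfolding A_def
        by (rule bint[OF bA[OF t'(1)]]) (use b12 g in auto)
      moreover have "\<bar>S m t\<bar> \<le> \<gamma> * (b1 * 1) * (2 * C) * g3" unfolding S_def
        by (rule bint[OF bS[OF t'(1)]]) (use b12 g \<gamma>_pos C_nonneg in auto)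
      moreover have "\<bar>B m t\<bar> \<le> b1 * g2" unfolding Beq abs_mult
        by (intro mult_mono b12(3) t' qint b12(1)) auto
      ultimately show ?thesis by linarith
    qed
    show "(\<lambda>m. A m t + B m t + S m t) \<longlonglongrightarrow> p t * Wt t" if t: "t \<in> {0<..<T}" for t
    proof -
      have t': "t \<in> {0..T}" using t by auto
      show ?thesis using tendsto_add[OF tendsto_add[OF limA[OF t'] tendsto_mult_left[OF conc[OF t], of "p t"]] limS[OF t']]
        by (simp add: Beq)
    qed
  qed (use mA in auto)
  moreover have "(\<lambda>m. X m 0 - X m T) \<longlonglongrightarrow> 0 - 0" using T_pos by (intro tendsto_diff limX) auto
  ultimately have "(\<lambda>m. (LBINT t:{0<..<T}. A m t + B m t + S m t) + (\<sigma>0 * (LBINT t:{0<..<T}. p t * c0 (a t)) - \<sigma>1 * (LBINT t:{0<..<T}. p t * c1 (b t)))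
      + (X m 0 - X m T)) \<longlonglongrightarrow> (LBINT t:{0<..<T}. p t * Wt t) + (\<sigma>0 * (LBINT t:{0<..<T}. p t * c0 (a t)) - \<sigma>1 * (LBINT t:{0<..<T}. p t * c1 (b t))) + (0 - 0)"
    by (intro tendsto_add tendsto_const)
  moreover have "0 \<le> (LBINT t:{0<..<T}. A m t + B m t + S m t) + (\<sigma>0 * (LBINT t:{0<..<T}. p t * c0 (a t)) - \<sigma>1 * (LBINT t:{0<..<T}. p t * c1 (b t)))
      + (X m 0 - X m T)" for m
  proof -
    have "(LBINT t:{0<..<T}. p t * \<sigma>0 * c0 (a t)) = \<sigma>0 * (LBINT t:{0<..<T}. p t * c0 (a t))"
      "(LBINT t:{0<..<T}. p t * \<sigma>1 * c1 (b t)) = \<sigma>1 * (LBINT t:{0<..<T}. p t * c1 (b t))"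
      by (simp_all add: mult_ac flip: set_integral_mult_right)
    then show ?thesis using ineq[of m] unfolding \<kappa>_ends by linarith
  qed
  ultimately show ?thesis using LIMSEQ_le_const by fastforce
qed

text \<open>The entropy \<open>\<eta>\<close> minus its tangent at \<open>k\<close> has a critical point at \<open>k\<close>. There \<open>entropy_flux_tangent\<close>
  says that the part of the flux that belongs to \<open>F1\<close> is minimal and the part that belongs to \<open>F2\<close>
  is maximal. So the numerical entropy flux has an upper bound that only depends on its left
  argument and a lower bound that only depends on its right one.\<close>
lemma tangent_entropy:
  fixes \<eta> \<eta>' q Q1 :: "real \<Rightarrow> real" and k :: real
  assumes ent: "entropy_for_split_flux F1' F2' \<eta> \<eta>' q Q1"
  defines "qk \<equiv> \<lambda>x. q x - \<eta>' k * (F1 x + F2 x)" and "Qk \<equiv> \<lambda>x. Q1 x - \<eta>' k * F1 x"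
  shows "entropy_for_split_flux F1' F2' (\<lambda>x. \<eta> x - \<eta>' k * x) (\<lambda>x. \<eta>' x - \<eta>' k) qk Qk"
    and "Qk x + (qk y - Qk y) \<le> Qk x + (qk k - Qk k)" and "Qk k + (qk y - Qk y) \<le> Qk x + (qk y - Qk y)"
proof -
  interpret E: entropy_for_split_flux F1' F2' \<eta> \<eta>' q Q1 by (rule ent)
  show ek: "entropy_for_split_flux F1' F2' (\<lambda>x. \<eta> x - \<eta>' k * x) (\<lambda>x. \<eta>' x - \<eta>' k) qk Qk"
    unfolding qk_def Qk_def
    by unfold_locales
       (auto intro!: derivative_eq_intros E.de E.dq E.dQ1 dF1 dF2 monoI monoD[OF E.mono_e'] simp: algebra_simps)
  interpret Ek: entropy_for_split_flux F1' F2' "\<lambda>x. \<eta> x - \<eta>' k * x" "\<lambda>x. \<eta>' x - \<eta>' k" qk Qk by (rule ek)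
  have "(\<eta>' k - \<eta>' k) * (F1 x - F1 k) \<le> Qk x - Qk k"
    by (rule entropy_flux_tangent[OF Ek.dQ1 dF1 F1'_nonneg Ek.mono_e'])
  then show "Qk k + (qk y - Qk y) \<le> Qk x + (qk y - Qk y)" by simp
  have "(\<eta>' k - \<eta>' k) * (- F2 y - - F2 k) \<le> - (qk y - Qk y) - - (qk k - Qk k)"
  proof (rule entropy_flux_tangent[where \<phi>'="\<lambda>x. - F2' x", OF _ _ _ Ek.mono_e'])
    show "((\<lambda>x. - (qk x - Qk x)) has_real_derivative (\<eta>' x - \<eta>' k) * - F2' x) (at x)" for x
      by (auto intro!: derivative_eq_intros Ek.dq Ek.dQ1 simp: algebra_simps)
    show "((\<lambda>x. - F2 x) has_real_derivative - F2' x) (at x)" for x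
      by (auto intro!: derivative_eq_intros dF2)
  qed (use F2'_nonpos in simp)
  then show "Qk x + (qk y - Qk y) \<le> Qk x + (qk k - Qk k)" by simp
qed

lemma w1_measurable [measurable]: "w1 \<in> borel_measurable borel"
proof (rule borel_measurable_LIMSEQ_real)
  fix t
  have "filterlim (\<lambda>n. 1 - inverse (real (Suc n))) (at_left 1) sequentially"
    unfolding filterlim_at using tendsto_diff[OF tendsto_const LIMSEQ_inverse_real_of_nat, of 1]
    by (auto intro!: always_eventually simp del: of_nat_Suc)
  from filterlim_compose[OF u_at_1 this]
  show "(\<lambda>n. u (1 - inverse (real (Suc n))) t) \<longlonglongrightarrow> w1 t" .
qed measurable

lemma w1_bound: "\<bar>w1 t\<bar> \<le> 2 * C"
  by (rule tendsto_upperbound[OF tendsto_rabs[OF u_at_1]]) (use u_bound in \<open>auto intro!: always_eventually\<close>)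

text \<open>The exceptional null set becomes independent of \<open>k\<close>: rational \<open>k\<close> are countable and, by
  continuity, sufficient. Afterwards \<open>k\<close> may depend on \<open>t\<close>.\<close>
lemma AE_for_rationals_extends:
  fixes g :: "real \<Rightarrow> real \<Rightarrow> real"
  assumes "\<And>k. AE t in lborel. t \<in> A \<longrightarrow> 0 \<le> g k t" and "\<And>t. continuous_on UNIV (\<lambda>k. g k t)"
  shows "AE t in lborel. t \<in> A \<longrightarrow> (\<forall>k. 0 \<le> g k t)"
proof -
  have "AE t in lborel. \<forall>k\<in>\<rat>. t \<in> A \<longrightarrow> 0 \<le> g k t"
    unfolding AE_ball_countable[OF countable_rat] using assms(1) by blast
  then show ?thesis
  proof eventually_elim
    case (elim t)
    show ?case
    proof (intro impI allI)
      fix k assume "t \<in> A"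
      then have rat: "\<forall>k\<in>\<rat>. 0 \<le> g k t" using elim by auto
      show "0 \<le> g k t"
      proof (rule ccontr)
        assume "\<not> 0 \<le> g k t"
        then have "\<forall>\<^sub>F r in at_right k. g r t < 0"
          using assms(2)[of t] by (intro order_tendstoD(2)[of _ "g k t"])
            (auto simp: continuous_on_def intro: tendsto_within_subset)
        then obtain b where b: "b > k" "\<And>r. k < r \<Longrightarrow> r < b \<Longrightarrow> g r t < 0"
          unfolding eventually_at_right_field by blast
        obtain r where "r \<in> \<rat>" "k < r" "r < b" using Rats_dense_in_real[OF b(1)] by blast
        then show False using rat b(2)[of r] by fastforce
      qed
    qed
  qed
qed

text \<open>For fixed \<open>k\<close> the tangent entropy at \<open>k\<close> and the boundary layers give, for almost every \<open>t\<close>, that the entropy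
  flux \<open>qk k\<close> of the trace \<open>u 0 t\<close> is at most the numerical flux between \<open>a t\<close> and \<open>k\<close>, and likewise on the
  right. For \<open>k = a t\<close> that numerical flux equals \<open>qk k (a t)\<close> by consistency, and the inequality is
  the first claim.\<close>
lemma boundary_entropy_inequalities:
  fixes \<eta> \<eta>' \<eta>'' q :: "real \<Rightarrow> real"
  assumes d\<eta>: "\<And>x. (\<eta> has_real_derivative \<eta>' x) (at x)" and mono: "mono \<eta>'"
    and d\<eta>': "\<And>x. (\<eta>' has_real_derivative \<eta>'' x) (at x)" and c\<eta>'': "continuous_on UNIV \<eta>''"
    and dq: "\<And>x. (q has_real_derivative \<eta>' x * (F1' x + F2' x)) (at x)"
  shows "AE t in lborel. t \<in> {0<..<T} \<longrightarrow>
      q (u 0 t) - q (a t) - \<eta>' (a t) * ((F1 (u 0 t) + F2 (u 0 t)) - (F1 (a t) + F2 (a t))) \<le> 0"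
    and "AE t in lborel. t \<in> {0<..<T} \<longrightarrow>
      0 \<le> q (w1 t) - q (b t) - \<eta>' (b t) * ((F1 (w1 t) + F2 (w1 t)) - (F1 (b t) + F2 (b t)))"
proof -
  have c\<eta>': "continuous_on UNIV \<eta>'" using d\<eta>' by (auto intro!: continuous_at_imp_continuous_on DERIV_isCont)
  obtain Q1 where Q1: "\<And>x. (Q1 has_real_derivative \<eta>' x * F1' x) (at x)"
    using antiderivative_exists[of "\<lambda>x. \<eta>' x * F1' x"] c\<eta>' cF1' continuous_on_mult by blast
  have ent: "entropy_for_split_flux F1' F2' \<eta> \<eta>' q Q1" by unfold_locales (use d\<eta> mono dq Q1 in auto)
  define qk where "qk k x = q x - \<eta>' k * (F1 x + F2 x)" for k x
  define Qk where "Qk k x = Q1 x - \<eta>' k * F1 x" for k x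
  have dqk: "(qk k has_real_derivative (\<eta>' x - \<eta>' k) * (F1' x + F2' x)) (at x)"
    and dQk: "(Qk k has_real_derivative (\<eta>' x - \<eta>' k) * F1' x) (at x)" for k x
    unfolding qk_def Qk_def by (auto intro!: derivative_eq_intros dq Q1 dF1 dF2 simp: algebra_simps)
  have cqk: "continuous_on UNIV (qk k)" and cQk: "continuous_on UNIV (Qk k)" for k
    using dqk[of k] dQk[of k] by (auto intro!: continuous_at_imp_continuous_on intro: DERIV_isCont)
  have [measurable]: "qk k \<in> borel_measurable borel" "Qk k \<in> borel_measurable borel" for k
    using cqk cQk by (auto intro: borel_measurable_continuous_onI)
  have [measurable]: "a \<in> borel_measurable borel" "b \<in> borel_measurable borel"
    using a b by (auto intro: bvr_measurable)
  \<comment> \<open>The bounds for the boundary fluxes: \<open>te(2)\<close> has the shape required of \<open>c0\<close> and \<open>te(3)\<close> that of \<open>c1\<close>.\<close>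
  note te = tangent_entropy[OF ent, folded qk_def Qk_def]
  note bnd = continuous_imp_bounded_on_interval[where r="2 * C"]
  have in2C: "u 0 t \<in> {-(2*C)..2*C}" "w1 t \<in> {-(2*C)..2*C}" "a t \<in> {-(2*C)..2*C}" "b t \<in> {-(2*C)..2*C}" "u x t \<in> {-(2*C)..2*C}" for x t
    using u_bound[of 0 t] u_bound[of x t] w1_bound[of t] bvr_bounded[OF a, of t] bvr_bounded[OF b, of t]
    by (auto simp: abs_le_iff)
  have int: "set_integrable lborel {0<..<T} (\<lambda>t. p t * f (g t))"
    if poly: "real_polynomial_function p" and cf: "continuous_on UNIV f" and g: "g \<in> borel_measurable borel" "\<And>t. g t \<in> {-(2*C)..2*C}" for p f g :: "real \<Rightarrow> real"
  proof -
    have cp: "continuous_on UNIV p" using poly real_polynomial_function_eq continuous_on_polymonial_function by blast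
    have [measurable]: "p \<in> borel_measurable borel" "f \<in> borel_measurable borel" "g \<in> borel_measurable borel"
      using cp cf g(1) by (auto intro: borel_measurable_continuous_onI)
    obtain B where B: "B \<ge> 0" "\<forall>x\<in>{-(2*C)..2*C}. \<bar>f x\<bar> \<le> B" using bnd[OF cf] by blast
    have "compact (p ` {0..T})" by (intro compact_continuous_image continuous_on_subset[OF cp]) auto
    then obtain D where D: "\<forall>y\<in>p ` {0..T}. norm y \<le> D" using compact_imp_bounded bounded_iff by metis
    have "D \<ge> 0" using D[rule_format, of "p 0"] T_pos by (auto intro: order.trans[OF abs_ge_zero])
    show ?thesis
      by (rule set_integrable_bounded_interval[where B="D * B"])
         (use B D g(2) \<open>D \<ge> 0\<close> in \<open>auto simp: abs_mult intro!: mult_mono\<close>)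
  qed
  have poly: "\<exists>p'. continuous_on UNIV p' \<and> (\<forall>t. (p has_real_derivative p' t) (at t))" if "real_polynomial_function p" for p
    using has_real_derivative_polynomial_function[OF that] real_polynomial_function_eq continuous_on_polymonial_function by blast
  have ck: "((\<lambda>x. \<eta>' x - \<eta>' k) has_real_derivative \<eta>'' x) (at x)" for k x
    by (auto intro!: derivative_eq_intros d\<eta>')
  have dc0: "((\<lambda>x. Qk k x + (qk k k - Qk k k)) has_real_derivative (\<eta>' x - \<eta>' k) * F1' x) (at x)" for k x
    by (auto intro!: derivative_eq_intros dQk)
  have dc1: "((\<lambda>y. Qk k k + (qk k y - Qk k y)) has_real_derivative (\<eta>' x - \<eta>' k) * F2' x) (at x)" for k x
    by (auto intro!: derivative_eq_intros dQk dqk simp: algebra_simps)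
  have cc: "continuous_on UNIV (\<lambda>x. (\<eta>' x - \<eta>' k) * F1' x)" "continuous_on UNIV (\<lambda>x. (\<eta>' x - \<eta>' k) * F2' x)" for k
    by (intro continuous_intros c\<eta>' cF1' cF2')+
  have cc0: "continuous_on UNIV (\<lambda>x. Qk k x + (qk k k - Qk k k))" "continuous_on UNIV (\<lambda>y. Qk k k + (qk k y - Qk k y))" for k
    by (intro continuous_intros cQk cqk)+
  have kern0: "(LBINT x:{0<..<1}. \<bar>- ((real m + 1) * (1 - x) ^ m)\<bar>) \<le> 1" for m
  proof -
    have "(LBINT x:{0<..<1}. \<bar>- ((real m + 1) * (1 - x) ^ m)\<bar>) = (LBINT x:{0<..<1}. (real m + 1) * (1 - x) ^ m)"
      by (rule set_lebesgue_integral_cong) (auto simp: abs_mult)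
    then show ?thesis using integral_power_kernel[of m] by simp
  qed
  have kern1: "(LBINT x:{0<..<1}. \<bar>(real m + 1) * x ^ m\<bar>) \<le> 1" for m
  proof -
    have "(LBINT x:{0<..<1}. \<bar>(real m + 1) * x ^ m\<bar>) = (LBINT x:{0<..<1}. (real m + 1) * x ^ m)"
      by (rule set_lebesgue_integral_cong) (auto simp: abs_mult)
    also have "\<dots> = 1"
      using integral_power_kernel[of m] set_integral_reflect_unit_interval[of "\<lambda>x. (real m + 1) * x ^ m"] by simp
    finally show ?thesis by simp
  qed
  have left: "AE t in lborel. t \<in> {0<..<T} \<longrightarrow> 0 \<le> Qk k (a t) + (qk k k - Qk k k) - qk k (u 0 t)" for k
  proof -
    obtain B0 where B0: "\<forall>x\<in>{-(2*C)..2*C}. \<bar>Qk k x + (qk k k - Qk k k)\<bar> \<le> B0" using bnd[OF cc0(1)[of k]] by blast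
    obtain B1 where B1: "\<forall>x\<in>{-(2*C)..2*C}. \<bar>qk k x\<bar> \<le> B1" using bnd[OF cqk[of k]] by blast
    show ?thesis
    proof (rule AE_nonneg_if_polynomial_tests_nonneg[OF T_pos, where B="B0 + B1"])
    show "\<bar>Qk k (a t) + (qk k k - Qk k k) - qk k (u 0 t)\<bar> \<le> B0 + B1" for t
      using B0[rule_format, OF in2C(3)[of t]] B1[rule_format, OF in2C(1)[of t]] by linarith
    fix p assume p: "real_polynomial_function p" "\<And>t. t \<in> {0..T} \<Longrightarrow> 0 \<le> p t"
    obtain p' where p': "continuous_on UNIV p'" "\<And>t. (p has_real_derivative p' t) (at t)" using poly[OF p(1)] by blast
    have "0 \<le> (LBINT t:{0<..<T}. p t * - qk k (u 0 t)) + 1 * (LBINT t:{0<..<T}. p t * (Qk k (a t) + (qk k k - Qk k k)))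
      - 0 * (LBINT t:{0<..<T}. p t * (Qk k k + (qk k (b t) - Qk k (b t))))"
    proof (rule boundary_layer_limit[OF te(1) ck c\<eta>'' te(2) te(3) dc0 cc(1) dc1 cc(2) p(2) p'(2) p'(1),
          where ?\<kappa>="\<lambda>m x. (1 - x) ^ Suc m" and ?\<kappa>'="\<lambda>m x. - ((real m + 1) * (1 - x) ^ m)"])
      show "((\<lambda>x. (1 - x) ^ Suc m) has_real_derivative - ((real m + 1) * (1 - x) ^ m)) (at x)" for m x
        by (rule derivative_eq_intros refl | simp)+
      show "(\<lambda>m. (1 - x) ^ Suc m) \<longlonglongrightarrow> 0" if "x \<in> {0<..<1}" for x :: real
        using that by (intro LIMSEQ_Suc LIMSEQ_realpow_zero) auto
      show "(\<lambda>m. LBINT x:{0<..<1}. - ((real m + 1) * (1 - x) ^ m) * qk k (u x t)) \<longlonglongrightarrow> - qk k (u 0 t)" for t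
      proof -
        obtain B1 where B1: "\<forall>x\<in>{-(2*C)..2*C}. \<bar>qk k x\<bar> \<le> B1" using bnd[OF cqk[of k]] by blast
        have "((\<lambda>x. qk k (u x t)) \<longlongrightarrow> qk k (u 0 t)) (at_right 0)"
          using cqk[of k] u_at_0[of t] by (intro isCont_tendsto_compose[of _ "qk k"]) (auto simp: continuous_on_eq_continuous_at)
        then have "(\<lambda>m. LBINT x:{0<..<1}. (real m + 1) * (1 - x) ^ m * qk k (u x t)) \<longlonglongrightarrow> qk k (u 0 t)"
          by (intro power_kernel_concentrates_at_0[where B=B1]) (use B1 in2C(5) in auto)
        from tendsto_minus[OF this] show ?thesis by (simp add: set_lebesgue_integral_def)
      qed
    qed (use kern0 in \<open>auto intro!: continuous_intros power_le_one simp del: power_Suc\<close>)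
    also have "\<dots> = (LBINT t:{0<..<T}. p t * (Qk k (a t) + (qk k k - Qk k k)) - p t * qk k (u 0 t))"
      by (subst set_integral_diff(2)) (use int[OF p(1) cc0(1) _ in2C(3)] int[OF p(1) cqk _ in2C(1)] in \<open>auto simp: set_lebesgue_integral_def\<close>)
    finally show "0 \<le> (LBINT t:{0<..<T}. p t * (Qk k (a t) + (qk k k - Qk k k) - qk k (u 0 t)))"
      by (simp add: algebra_simps)
    qed measurable
  qed
  have right: "AE t in lborel. t \<in> {0<..<T} \<longrightarrow> 0 \<le> qk k (w1 t) - (Qk k k + (qk k (b t) - Qk k (b t)))" for k
  proof -
    obtain B0 where B0: "\<forall>x\<in>{-(2*C)..2*C}. \<bar>Qk k k + (qk k x - Qk k x)\<bar> \<le> B0" using bnd[OF cc0(2)[of k]] by blast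
    obtain B1 where B1: "\<forall>x\<in>{-(2*C)..2*C}. \<bar>qk k x\<bar> \<le> B1" using bnd[OF cqk[of k]] by blast
    show ?thesis
    proof (rule AE_nonneg_if_polynomial_tests_nonneg[OF T_pos, where B="B0 + B1"])
    show "\<bar>qk k (w1 t) - (Qk k k + (qk k (b t) - Qk k (b t)))\<bar> \<le> B0 + B1" for t
      using B0[rule_format, OF in2C(4)[of t]] B1[rule_format, OF in2C(2)[of t]] by linarith
    fix p assume p: "real_polynomial_function p" "\<And>t. t \<in> {0..T} \<Longrightarrow> 0 \<le> p t"
    obtain p' where p': "continuous_on UNIV p'" "\<And>t. (p has_real_derivative p' t) (at t)" using poly[OF p(1)] by blast
    have "0 \<le> (LBINT t:{0<..<T}. p t * qk k (w1 t)) + 0 * (LBINT t:{0<..<T}. p t * (Qk k (a t) + (qk k k - Qk k k)))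
      - 1 * (LBINT t:{0<..<T}. p t * (Qk k k + (qk k (b t) - Qk k (b t))))"
    proof (rule boundary_layer_limit[OF te(1) ck c\<eta>'' te(2) te(3) dc0 cc(1) dc1 cc(2) p(2) p'(2) p'(1),
          where ?\<kappa>="\<lambda>m x. x ^ Suc m" and ?\<kappa>'="\<lambda>m x. (real m + 1) * x ^ m"])
      show "((\<lambda>x. x ^ Suc m) has_real_derivative (real m + 1) * x ^ m) (at x)" for m x
        by (rule derivative_eq_intros refl | simp)+
      show "(\<lambda>m. x ^ Suc m) \<longlonglongrightarrow> 0" if "x \<in> {0<..<1}" for x :: real
        using that by (intro LIMSEQ_Suc LIMSEQ_realpow_zero) auto
      show "(\<lambda>m. LBINT x:{0<..<1}. (real m + 1) * x ^ m * qk k (u x t)) \<longlonglongrightarrow> qk k (w1 t)" for t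
      proof -
        obtain B1 where B1: "\<forall>x\<in>{-(2*C)..2*C}. \<bar>qk k x\<bar> \<le> B1" using bnd[OF cqk[of k]] by blast
        have "((\<lambda>x. qk k (u x t)) \<longlongrightarrow> qk k (w1 t)) (at_left 1)"
          using cqk[of k] u_at_1[of t] by (intro isCont_tendsto_compose[of _ "qk k"]) (auto simp: continuous_on_eq_continuous_at)
        then show ?thesis
          by (intro power_kernel_concentrates_at_1[where B=B1]) (use B1 in2C(5) in auto)
      qed
    qed (use kern1 in \<open>auto intro!: continuous_intros power_le_one simp del: power_Suc\<close>)
    also have "\<dots> = (LBINT t:{0<..<T}. p t * qk k (w1 t) - p t * (Qk k k + (qk k (b t) - Qk k (b t))))"
      by (subst set_integral_diff(2)) (use int[OF p(1) cc0(2) _ in2C(4)] int[OF p(1) cqk _ in2C(2)] in auto)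
    finally show "0 \<le> (LBINT t:{0<..<T}. p t * (qk k (w1 t) - (Qk k k + (qk k (b t) - Qk k (b t)))))"
      by (simp add: algebra_simps)
    qed measurable
  qed
  have cq: "continuous_on UNIV q" "continuous_on UNIV F1" "continuous_on UNIV F2" "continuous_on UNIV Q1"
    using DERIV_isCont[OF dq] DERIV_isCont[OF dF1] DERIV_isCont[OF dF2] DERIV_isCont[OF Q1]
    by (auto simp: continuous_on_eq_continuous_at)
  have "AE t in lborel. t \<in> {0<..<T} \<longrightarrow> (\<forall>k. 0 \<le> Qk k (a t) + (qk k k - Qk k k) - qk k (u 0 t))"
    by (rule AE_for_rationals_extends[OF left]) (unfold qk_def Qk_def, intro continuous_intros c\<eta>' cq)
  then show "AE t in lborel. t \<in> {0<..<T} \<longrightarrow>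
      q (u 0 t) - q (a t) - \<eta>' (a t) * ((F1 (u 0 t) + F2 (u 0 t)) - (F1 (a t) + F2 (a t))) \<le> 0"
  proof eventually_elim
    case (elim t)
    then show ?case using elim by (auto dest!: spec[of _ "a t"] simp: qk_def algebra_simps)
  qed
  have "AE t in lborel. t \<in> {0<..<T} \<longrightarrow> (\<forall>k. 0 \<le> qk k (w1 t) - (Qk k k + (qk k (b t) - Qk k (b t))))"
    by (rule AE_for_rationals_extends[OF right]) (unfold qk_def Qk_def, intro continuous_intros c\<eta>' cq)
  then show "AE t in lborel. t \<in> {0<..<T} \<longrightarrow>
      0 \<le> q (w1 t) - q (b t) - \<eta>' (b t) * ((F1 (w1 t) + F2 (w1 t)) - (F1 (b t) + F2 (b t)))"
  proof eventually_elim
    case (elim t)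
    then show ?case using elim by (auto dest!: spec[of _ "b t"] simp: qk_def algebra_simps)
  qed
qed

end

section \<open>Limits of the scheme as entropy solutions\<close>

lemma frechet_derivative_eq_deriv:
  fixes g :: "real \<Rightarrow> real"
  assumes "g differentiable (at x)"
  shows "frechet_derivative g (at x) 1 = deriv g x" "(g has_real_derivative deriv g x) (at x)"
proof -
  obtain d where d: "(g has_real_derivative d) (at x)" using assms by (auto simp: real_differentiable_def)
  then have eq: "deriv g x = d" by (rule DERIV_imp_deriv)
  then show "(g has_real_derivative deriv g x) (at x)" using d by simp
  have "(g has_derivative (\<lambda>h. d * h)) (at x)" using d by (simp add: has_field_derivative_def)
  then have "frechet_derivative g (at x) = (\<lambda>h. d * h)" by (rule frechet_derivative_at[symmetric])
  then show "frechet_derivative g (at x) 1 = deriv g x" by (simp add: eq)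
qed

lemma Ck_Suc_real: "Ck (Suc k) (g :: real \<Rightarrow> real) \<longleftrightarrow> (\<forall>x. g differentiable (at x)) \<and> Ck k (deriv g)"
proof -
  have "(\<lambda>x. frechet_derivative g (at x) 1) = deriv g" if "\<forall>x. g differentiable (at x)"
    using frechet_derivative_eq_deriv(1) that by auto
  then show ?thesis by (simp only: Ck.simps(2) Basis_real_def ball_simps) metis
qed

lemma Ck_1_real:
  assumes "Ck 1 (g :: real \<Rightarrow> real)"
  shows "(g has_real_derivative deriv g x) (at x)" "continuous_on UNIV (deriv g)"
  using assms frechet_derivative_eq_deriv(2) unfolding One_nat_def Ck_Suc_real Ck.simps(1) by blast+

lemma Ck_2_real:
  assumes "Ck 2 (g :: real \<Rightarrow> real)"
  shows "(g has_real_derivative deriv g x) (at x)" "(deriv g has_real_derivative deriv (deriv g) x) (at x)"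
    "continuous_on UNIV (deriv (deriv g))"
  using assms frechet_derivative_eq_deriv(2) unfolding numeral_2_eq_2 Ck_Suc_real Ck.simps(1) by blast+

text \<open>Classical partial derivatives are extracted from the recursive definition of \<open>Ck\<close> via the
  Frechet derivative in the coordinate directions.\<close>
lemma Ck_1_plane:
  fixes \<phi> :: "real \<times> real \<Rightarrow> real"
  assumes "Ck 1 \<phi>"
  defines "\<phi>x \<equiv> \<lambda>x t. frechet_derivative \<phi> (at (x, t)) (1, 0)" and "\<phi>t \<equiv> \<lambda>x t. frechet_derivative \<phi> (at (x, t)) (0, 1)"
  shows "((\<lambda>y. \<phi> (y, t)) has_real_derivative \<phi>x x t) (at x)" "((\<lambda>s. \<phi> (x, s)) has_real_derivative \<phi>t x t) (at t)"
    "continuous_on UNIV (\<lambda>(x, t). \<phi> (x, t))" "continuous_on UNIV (\<lambda>(x, t). \<phi>x x t)" "continuous_on UNIV (\<lambda>(x, t). \<phi>t x t)"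
proof -
  have d: "\<phi> differentiable (at z)" and c: "b \<in> Basis \<Longrightarrow> continuous_on UNIV (\<lambda>z. frechet_derivative \<phi> (at z) b)" for z b
    using assms(1) by (simp_all only: One_nat_def Ck.simps)
  have D: "(\<phi> has_derivative frechet_derivative \<phi> (at z)) (at z)" for z
    using d[of z] by (simp only: frechet_derivative_works)
  have lin: "linear (frechet_derivative \<phi> (at z))" for z by (rule has_derivative_linear[OF D])
  have "((\<lambda>y. \<phi> (y, t)) has_derivative (\<lambda>h. frechet_derivative \<phi> (at (x, t)) (h, 0))) (at x)"
    by (rule has_derivative_compose[where g=\<phi>, OF has_derivative_Pair[OF has_derivative_ident has_derivative_const] D])
  moreover {
  have "frechet_derivative \<phi> (at (x, t)) (h, 0) = frechet_derivative \<phi> (at (x, t)) (1, 0) * h" for h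
  proof -
    have "frechet_derivative \<phi> (at (x, t)) (h *\<^sub>R (1, 0)) = h *\<^sub>R frechet_derivative \<phi> (at (x, t)) (1, 0)"
      by (rule linear_scale[OF lin])
    moreover have "h *\<^sub>R (1, 0) = (h, 0 :: real)" by simp
    ultimately show ?thesis by (simp only: real_scaleR_def mult.commute)
  qed
  then have "(\<lambda>h. frechet_derivative \<phi> (at (x, t)) (h, 0)) = (*) (frechet_derivative \<phi> (at (x, t)) (1, 0))"
    by (intro ext)
  }
  ultimately show "((\<lambda>y. \<phi> (y, t)) has_real_derivative \<phi>x x t) (at x)"
    unfolding has_field_derivative_def \<phi>x_def by (rule back_subst)
  have "((\<lambda>s. \<phi> (x, s)) has_derivative (\<lambda>h. frechet_derivative \<phi> (at (x, t)) (0, h))) (at t)"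
    by (rule has_derivative_compose[where g=\<phi>, OF has_derivative_Pair[OF has_derivative_const has_derivative_ident] D])
  moreover {
  have "frechet_derivative \<phi> (at (x, t)) (0, h) = frechet_derivative \<phi> (at (x, t)) (0, 1) * h" for h
  proof -
    have "frechet_derivative \<phi> (at (x, t)) (h *\<^sub>R (0, 1)) = h *\<^sub>R frechet_derivative \<phi> (at (x, t)) (0, 1)"
      by (rule linear_scale[OF lin])
    moreover have "h *\<^sub>R (0, 1) = (0 :: real, h)" by simp
    ultimately show ?thesis by (simp only: real_scaleR_def mult.commute)
  qed
  then have "(\<lambda>h. frechet_derivative \<phi> (at (x, t)) (0, h)) = (*) (frechet_derivative \<phi> (at (x, t)) (0, 1))"
    by (intro ext)
  }
  ultimately show "((\<lambda>s. \<phi> (x, s)) has_real_derivative \<phi>t x t) (at t)"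
    unfolding has_field_derivative_def \<phi>t_def by (rule back_subst)
  show "continuous_on UNIV (\<lambda>(x, t). \<phi> (x, t))"
    using d differentiable_imp_continuous_within[of \<phi> _ UNIV]
    by (simp add: continuous_on_eq_continuous_within)
  show "continuous_on UNIV (\<lambda>(x, t). \<phi>x x t)" "continuous_on UNIV (\<lambda>(x, t). \<phi>t x t)"
  proof -
    have "(1, 0) \<in> (Basis :: (real \<times> real) set)" "(0, 1) \<in> (Basis :: (real \<times> real) set)"
      by (auto simp: Basis_prod_def)
    then show "continuous_on UNIV (\<lambda>(x, t). \<phi>x x t)" "continuous_on UNIV (\<lambda>(x, t). \<phi>t x t)"
      using c unfolding \<phi>x_def \<phi>t_def case_prod_unfold prod.collapse by blast+
  qed
qed

lemma convex_imp_mono_deriv: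
  fixes g :: "real \<Rightarrow> real"
  assumes "convex_on UNIV g" and d: "\<And>x. (g has_real_derivative g' x) (at x)"
  shows "mono g'"
proof (rule monoI)
  fix x y :: real assume "x \<le> y"
  have "g' x * (y - x) \<le> g y - g x" "g' y * (x - y) \<le> g x - g y"
    using convex_on_imp_above_tangent[OF assms(1) connected_UNIV _ _ d[of x], of y]
      convex_on_imp_above_tangent[OF assms(1) connected_UNIV _ _ d[of y], of x] by simp_all
  then have "(g' x - g' y) * (y - x) \<le> 0" by (simp add: algebra_simps)
  then show "g' x \<le> g' y" using \<open>x \<le> y\<close> by (cases "x = y") (auto simp: mult_le_0_iff)
qed

lemma L1_dist_eq_dist1:
  assumes "set_integrable lborel {a<..<b} f" "set_integrable lborel {a<..<b} g"
  shows "L1_dist a b f g = ennreal (dist1 a b f g)"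
proof -
  have i: "integrable lborel (\<lambda>x. indicator {a<..<b} x * \<bar>f x - g x\<bar>)"
    using set_integrable_abs[OF set_integral_diff(1)[OF assms]] by (simp add: set_integrable_def)
  have "L1_dist a b f g = (\<integral>\<^sup>+x. ennreal (indicator {a<..<b} x * \<bar>f x - g x\<bar>) \<partial>lborel)"
    unfolding L1_dist_def by (intro nn_integral_cong) (auto simp: indicator_def)
  also have "\<dots> = ennreal (dist1 a b f g)"
    unfolding dist1_def set_lebesgue_integral_def using i by (subst nn_integral_eq_integral) auto
  finally show ?thesis .
qed

context scheme_limit
begin

lemma deriv_flux:
  assumes "\<And>x. F1 x + F2 x = f x"
  shows "deriv f x = F1' x + F2' x"
proof -
  have "((\<lambda>x. F1 x + F2 x) has_real_derivative F1' x + F2' x) (at x)" by (intro derivative_intros dF1 dF2)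
  then show ?thesis unfolding assms by (rule DERIV_imp_deriv)
qed

lemma u_integrable_x: "set_integrable lborel {c<..<d} (\<lambda>x. u x t)"
  by (rule set_integrable_bounded_interval[OF _ u_bound]) measurable

text \<open>Bounded convergence in time; the exceptional null set in the definition of the trace can be empty.\<close>
lemma strong_trace_from_pointwise:
  assumes lim: "\<And>t. ((\<lambda>x. u x t) \<longlongrightarrow> w t) (at y within {0<..<1})"
    and [measurable]: "w \<in> borel_measurable borel" and wb: "\<And>t. \<bar>w t\<bar> \<le> 2 * C"
  shows "strong_trace T u y w"
proof -
  have iw: "set_integrable lborel {0<..<T} w" by (rule set_integrable_bounded_interval[OF _ wb]) measurable
  have iu: "set_integrable lborel {0<..<T} (u x)" for x
    by (rule set_integrable_bounded_interval[OF _ u_bound]) measurable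
  have "((\<lambda>x. dist1 0 T (u x) w) \<longlongrightarrow> 0) (at y within {0<..<1})"
    unfolding tendsto_at_iff_sequentially o_def
  proof (intro allI impI)
    fix X assume X: "\<forall>i. X i \<in> {0<..<1} - {y}" "X \<longlonglongrightarrow> y"
    have "(\<lambda>i. LBINT t:{0<..<T}. \<bar>u (X i) t - w t\<bar>) \<longlonglongrightarrow> (LBINT t:{0<..<T}. 0)"
    proof (rule tendsto_set_integral_bounded)
      show "\<bar>\<bar>u (X i) t - w t\<bar>\<bar> \<le> 4 * C" for i t
        using u_bound[of "X i" t] wb[of t] by linarith
      show "(\<lambda>i. \<bar>u (X i) t - w t\<bar>) \<longlonglongrightarrow> 0" for t
      proof -
        have "(\<lambda>i. u (X i) t) \<longlonglongrightarrow> w t"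
          using lim[of t] X unfolding tendsto_at_iff_sequentially o_def by blast
        then show ?thesis by (intro tendsto_rabs_zero LIM_zero)
      qed
    qed measurable
    then show "(\<lambda>i. dist1 0 T (u (X i)) w) \<longlonglongrightarrow> 0" by (simp add: dist1_def)
  qed
  from tendsto_ennrealI[OF this] have "((\<lambda>x. L1_dist 0 T (u x) w) \<longlongrightarrow> 0) (at y within {0<..<1} - {})"
    by (simp add: L1_dist_eq_dist1[OF iu iw])
  then show ?thesis unfolding strong_trace_def using iw by (intro conjI bexI[of _ "{}"]) auto
qed

lemma interior_entropy_inequality:
  assumes f: "\<And>x. F1 x + F2 x = f x"
    and u0: "AE x in lborel. x \<in> {0<..<1} \<longrightarrow> u0 x = u x 0" and mu0: "set_borel_measurable lborel {0<..<1} u0"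
    and ep: "entropy_pair f \<eta> q" and test: "test_function \<phi>" and nn: "\<And>z. 0 \<le> \<phi> z"
  shows "0 \<le> (LBINT t:{0<..<T}. LBINT x:{0<..<1}.
            (\<eta> (u x t) * deriv (\<lambda>s. \<phi> (x, s)) t + q (u x t) * deriv (\<lambda>y. \<phi> (y, t)) x
            + \<gamma> * deriv \<eta> (u x t) * P_int u x t * \<phi> (x, t)))
        + (LBINT x:{0<..<1}. \<eta> (u0 x) * \<phi> (x, 0))
        - (LBINT x:{0<..<1}. \<eta> (u x T) * \<phi> (x, T))"
proof -
  have \<eta>2: "Ck 2 \<eta>" and cv: "convex_on UNIV \<eta>" and dq: "\<And>v. (q has_real_derivative deriv \<eta> v * deriv f v) (at v)"
  proof -
    show "Ck 2 \<eta>" "convex_on UNIV \<eta>" using ep unfolding entropy_pair_def by blast+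
    show "(q has_real_derivative deriv \<eta> v * deriv f v) (at v)" for v using ep unfolding entropy_pair_def by blast
  qed
  note d\<eta> = Ck_2_real[OF \<eta>2]
  note df' = deriv_flux[OF f]
  have c\<eta>': "continuous_on UNIV (deriv \<eta>)" and c\<eta>: "continuous_on UNIV \<eta>" and cq: "continuous_on UNIV q"
    using DERIV_isCont[OF d\<eta>(2)] DERIV_isCont[OF d\<eta>(1)] DERIV_isCont[OF dq] by (auto simp: continuous_on_eq_continuous_at)
  obtain Q1 where Q1: "\<And>x. (Q1 has_real_derivative deriv \<eta> x * F1' x) (at x)"
    using antiderivative_exists[of "\<lambda>x. deriv \<eta> x * F1' x"] c\<eta>' cF1' continuous_on_mult by blast
  have cQ1: "continuous_on UNIV Q1" using DERIV_isCont[OF Q1] by (auto simp: continuous_on_eq_continuous_at)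
  have ent: "entropy_for_split_flux F1' F2' \<eta> (deriv \<eta>) q Q1"
    by unfold_locales (use d\<eta> dq df' Q1 convex_imp_mono_deriv[OF cv d\<eta>(1)] in auto)
  have \<phi>1: "Ck 1 \<phi>" using test unfolding test_function_def by blast
  define \<phi>x where "\<phi>x x t = frechet_derivative \<phi> (at (x, t)) (1, 0)" for x t
  define \<phi>t where "\<phi>t x t = frechet_derivative \<phi> (at (x, t)) (0, 1)" for x t
  note d\<phi> = Ck_1_plane[OF \<phi>1, folded \<phi>x_def \<phi>t_def]
  have deriv_eq: "deriv (\<lambda>s. \<phi> (x, s)) t = \<phi>t x t" "deriv (\<lambda>y. \<phi> (y, t)) x = \<phi>x x t" for x t
    using d\<phi>(1,2) by (auto intro: DERIV_imp_deriv)
  obtain S where S: "S \<subseteq> {0<..<1} \<times> UNIV" "\<And>z. z \<notin> S \<Longrightarrow> \<phi> z = 0"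
    using test unfolding test_function_def by blast
  have bdry: "\<phi> (0, t) = 0" "\<phi> (1, t) = 0" for t
    by (rule S(2), use S(1) in auto)+
  \<comment> \<open>The test function vanishes at the boundary, so that constants can serve as bounds for the fluxes there.\<close>
  note bnd = continuous_imp_bounded_on_interval
  obtain g1 where g1: "\<forall>x\<in>{-K..K}. \<bar>Q1 x\<bar> \<le> g1" using bnd[OF cQ1] by blast
  obtain g2 where g2: "\<forall>x\<in>{-K..K}. \<bar>q x\<bar> \<le> g2" using bnd[OF cq] by blast
  have flux: "\<bar>Q1 x + (q y - Q1 y)\<bar> \<le> 2 * g1 + g2" if "x \<in> {-K..K}" "y \<in> {-K..K}" for x y
    using g1[rule_format, OF that(1)] g1[rule_format, OF that(2)] g2[rule_format, OF that(2)] by linarith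
  have main: "0 \<le> (LBINT t:{0<..<T}. (LBINT x:{0<..<1}. \<phi>t x t * \<eta> (u x t)) + (LBINT x:{0<..<1}. \<phi>x x t * q (u x t))
        + (LBINT x:{0<..<1}. \<gamma> * \<phi> (x, t) * P_int u x t * deriv \<eta> (u x t)))
      + (LBINT t:{0<..<T}. \<phi> (0, t) * (2 * g1 + g2)) - (LBINT t:{0<..<T}. \<phi> (1, t) * (- (2 * g1 + g2)))
      + (LBINT x:{0<..<1}. \<phi> (x, 0) * \<eta> (u x 0)) - (LBINT x:{0<..<1}. \<phi> (x, T) * \<eta> (u x T))"
  proof (rule entropy_inequality_with_boundary[OF ent d\<eta>(2,3), where ?L0.0=0])
    show "Q1 x + (q y - Q1 y) \<le> 2 * g1 + g2" "- (2 * g1 + g2) \<le> Q1 x + (q y - Q1 y)"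
      if "x \<in> {-K..K}" "y \<in> {-K..K}" for x y using flux[OF that] by linarith+
  qed (use nn d\<phi> in auto)
  have i: "set_integrable lborel {0<..<1} (\<lambda>x. A x * B x)"
    if A: "continuous_on UNIV A" and B: "B \<in> borel_measurable borel" "\<And>x. x \<in> {0<..<1} \<Longrightarrow> \<bar>B x\<bar> \<le> d" "0 \<le> d" for A B :: "real \<Rightarrow> real" and d
  proof -
    obtain c where c: "0 \<le> c" "\<forall>x\<in>{-1..1}. \<bar>A x\<bar> \<le> c" using bnd[OF A] by blast
    have [measurable]: "A \<in> borel_measurable borel" "B \<in> borel_measurable borel"
      using A B by (auto intro: borel_measurable_continuous_onI)
    show ?thesis
      by (rule set_integrable_bounded_interval[where B="c * d"])
         (use B c in \<open>auto simp: abs_mult intro!: mult_mono\<close>)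
  qed
  have u2C: "u x t \<in> {- (2*C)..2*C}" for x t using u_bound[of x t] by (auto simp: abs_le_iff)
  obtain h1 where h1: "0 \<le> h1" "\<And>x t. \<bar>\<eta> (u x t)\<bar> \<le> h1" using bnd[OF c\<eta>, of "2*C"] u2C by metis
  obtain h2 where h2: "0 \<le> h2" "\<And>x t. \<bar>q (u x t)\<bar> \<le> h2" using bnd[OF cq, of "2*C"] u2C by metis
  obtain h3 where h3: "0 \<le> h3" "\<And>x t. \<bar>deriv \<eta> (u x t)\<bar> \<le> h3" using bnd[OF c\<eta>', of "2*C"] u2C by metis
  have [measurable]: "\<eta> \<in> borel_measurable borel" "q \<in> borel_measurable borel" "deriv \<eta> \<in> borel_measurable borel"
    using c\<eta> cq c\<eta>' by (auto intro: borel_measurable_continuous_onI)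
  have sect: "continuous_on UNIV (\<lambda>x. F x t)" if "continuous_on UNIV (\<lambda>(x, t). F x t)" for F :: "real \<Rightarrow> real \<Rightarrow> real" and t
  proof -
    have "continuous_on UNIV (\<lambda>x :: real. (x, t))" by (intro continuous_intros)
    from continuous_on_compose2[OF that this] show ?thesis by simp
  qed
  have inner: "(LBINT x:{0<..<1}. (\<eta> (u x t) * deriv (\<lambda>s. \<phi> (x, s)) t + q (u x t) * deriv (\<lambda>y. \<phi> (y, t)) x
            + \<gamma> * deriv \<eta> (u x t) * P_int u x t * \<phi> (x, t)))
     = (LBINT x:{0<..<1}. \<phi>t x t * \<eta> (u x t)) + (LBINT x:{0<..<1}. \<phi>x x t * q (u x t))
        + (LBINT x:{0<..<1}. \<gamma> * \<phi> (x, t) * P_int u x t * deriv \<eta> (u x t))" for t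
  proof -
    have i1: "set_integrable lborel {0<..<1} (\<lambda>x. \<phi>t x t * \<eta> (u x t))"
      by (rule i[OF sect[OF d\<phi>(5)] _ h1(2) h1(1)]) measurable
    have i2: "set_integrable lborel {0<..<1} (\<lambda>x. \<phi>x x t * q (u x t))"
      by (rule i[OF sect[OF d\<phi>(4)] _ h2(2) h2(1)]) measurable
    have "set_integrable lborel {0<..<1} (\<lambda>x. \<gamma> * \<phi> (x, t) * (P_int u x t * deriv \<eta> (u x t)))"
    proof (rule i)
      show "continuous_on UNIV (\<lambda>x. \<gamma> * \<phi> (x, t))" using sect[OF d\<phi>(3)] by (intro continuous_intros)
      show "\<bar>P_int u x t * deriv \<eta> (u x t)\<bar> \<le> 2 * C * h3" if "x \<in> {0<..<1}" for x
        unfolding abs_mult using P_int_bound[OF that] h3 C_nonneg by (intro mult_mono) auto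
    qed (use C_nonneg h3 in auto)
    then have i3: "set_integrable lborel {0<..<1} (\<lambda>x. \<gamma> * \<phi> (x, t) * P_int u x t * deriv \<eta> (u x t))"
      by (simp only: mult.assoc)
    have "(LBINT x:{0<..<1}. (\<eta> (u x t) * deriv (\<lambda>s. \<phi> (x, s)) t + q (u x t) * deriv (\<lambda>y. \<phi> (y, t)) x
            + \<gamma> * deriv \<eta> (u x t) * P_int u x t * \<phi> (x, t)))
       = (LBINT x:{0<..<1}. (\<phi>t x t * \<eta> (u x t) + \<phi>x x t * q (u x t)) + \<gamma> * \<phi> (x, t) * P_int u x t * deriv \<eta> (u x t))"
      unfolding deriv_eq by (simp only: mult_ac)
    also have "\<dots> = (LBINT x:{0<..<1}. \<phi>t x t * \<eta> (u x t)) + (LBINT x:{0<..<1}. \<phi>x x t * q (u x t))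
        + (LBINT x:{0<..<1}. \<gamma> * \<phi> (x, t) * P_int u x t * deriv \<eta> (u x t))"
      by (simp only: set_integral_add(2)[OF set_integral_add(1)[OF i1 i2] i3] set_integral_add(2)[OF i1 i2])
    finally show ?thesis .
  qed
  have init: "(LBINT x:{0<..<1}. \<eta> (u0 x) * \<phi> (x, 0)) = (LBINT x:{0<..<1}. \<phi> (x, 0) * \<eta> (u x 0))"
  proof -
    have [measurable]: "(\<lambda>x. \<phi> (x, 0)) \<in> borel_measurable borel" using sect[OF d\<phi>(3)] by (intro borel_measurable_continuous_onI)
    define g where "g x = indicator {0<..<1} x *\<^sub>R u0 x" for x
    have [measurable]: "g \<in> borel_measurable borel"
      using mu0 by (simp add: set_borel_measurable_def g_def[abs_def])
    have eq: "(\<lambda>x. indicator {0<..<1} x *\<^sub>R (\<eta> (u0 x) * \<phi> (x, 0))) = (\<lambda>x. indicator {0<..<1} x *\<^sub>R (\<eta> (g x) * \<phi> (x, 0)))"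
      by (auto simp: indicator_def fun_eq_iff g_def)
    have "(\<lambda>x. indicator {0<..<1} x *\<^sub>R (\<eta> (g x) * \<phi> (x, 0))) \<in> borel_measurable borel" by measurable
    from back_subst[of "\<lambda>F. F \<in> borel_measurable borel", OF this eq[symmetric]]
    have m0: "(\<lambda>x. indicator {0<..<1} x *\<^sub>R (\<eta> (u0 x) * \<phi> (x, 0))) \<in> borel_measurable borel" .
    show ?thesis unfolding set_lebesgue_integral_def
    proof (rule integral_cong_AE)
      show "AE x in lborel. indicator {0<..<1} x *\<^sub>R (\<eta> (u0 x) * \<phi> (x, 0)) = indicator {0<..<1} x *\<^sub>R (\<phi> (x, 0) * \<eta> (u x 0))"
        using u0 by eventually_elim (auto simp: indicator_def)
      show "(\<lambda>x. indicator {0<..<1} x *\<^sub>R (\<eta> (u0 x) * \<phi> (x, 0))) \<in> borel_measurable lborel"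
        using m0 by simp
    qed measurable
  qed
  show ?thesis using main unfolding inner init bdry by (simp add: mult.commute)
qed

lemma limit_is_entropy_solution:
  assumes f: "\<And>x. F1 x + F2 x = f x"
    and u0: "AE x in lborel. x \<in> {0<..<1} \<longrightarrow> u0 x = u x 0" and mu0: "set_borel_measurable lborel {0<..<1} u0"
    and \<alpha>: "AE t in lborel. t \<in> {0<..<T} \<longrightarrow> \<alpha> t = a t" and \<beta>: "AE t in lborel. t \<in> {0<..<T} \<longrightarrow> \<beta> t = b t"
    and lip: "\<And>s t. s \<in> {0..T} \<Longrightarrow> t \<in> {0..T} \<Longrightarrow> dist1 0 1 (\<lambda>x. u x t) (\<lambda>x. u x s) \<le> D * \<bar>t - s\<bar>"
  shows "entropy_solution T f \<gamma> u0 \<alpha> \<beta> u"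
  unfolding entropy_solution_def
proof (intro conjI)
  show "continuous_L1 T u" unfolding continuous_L1_def
  proof (intro conjI ballI u_integrable_x)
    fix t assume t: "t \<in> {0..T}"
    have "((\<lambda>s. dist1 0 1 (\<lambda>x. u x s) (\<lambda>x. u x t)) \<longlongrightarrow> 0) (at t within {0..T})"
    proof (rule Lim_null_comparison)
      show "\<forall>\<^sub>F s in at t within {0..T}. norm (dist1 0 1 (\<lambda>x. u x s) (\<lambda>x. u x t)) \<le> D * \<bar>s - t\<bar>"
        using lip t by (auto simp: eventually_at_filter dist1_nonneg)
      have "((\<lambda>s. D * \<bar>s - t\<bar>) \<longlongrightarrow> D * \<bar>t - t\<bar>) (at t within {0..T})" by (intro tendsto_intros)
      then show "((\<lambda>s. D * \<bar>s - t\<bar>) \<longlongrightarrow> 0) (at t within {0..T})" by simp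
    qed
    from tendsto_ennrealI[OF this]
    show "((\<lambda>s. L1_dist 0 1 (\<lambda>x. u x s) (\<lambda>x. u x t)) \<longlongrightarrow> 0) (at t within {0..T})"
      by (simp add: L1_dist_eq_dist1[OF u_integrable_x u_integrable_x])
  qed
  show "Linfty T u" unfolding Linfty_def
  proof (intro conjI exI[of _ "2 * C"])
    have [measurable]: "(\<lambda>(x, t). u x t) \<in> borel_measurable borel"
      using u_measurable by (simp add: borel_prod)
    have "{0<..<1} \<times> {0<..<T} \<in> sets (borel :: (real \<times> real) measure)"
      by (intro borel_open open_Times) auto
    then show "set_borel_measurable lborel ({0<..<1} \<times> {0<..<T}) (\<lambda>(x, t). u x t)"
      unfolding set_borel_measurable_def by measurable
    show "AE (x, t) in lborel. x \<in> {0<..<1} \<and> t \<in> {0<..<T} \<longrightarrow> \<bar>u x t\<bar> \<le> 2 * C"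
      by (rule AE_I2) (simp add: u_bound case_prod_unfold)
  qed
  show "\<forall>\<eta> q \<phi>. entropy_pair f \<eta> q \<and> test_function \<phi> \<and> (\<forall>z. 0 \<le> \<phi> z) \<longrightarrow>
        (LBINT t:{0<..<T}. LBINT x:{0<..<1}.
            (\<eta> (u x t) * deriv (\<lambda>s. \<phi> (x, s)) t + q (u x t) * deriv (\<lambda>y. \<phi> (y, t)) x
            + \<gamma> * deriv \<eta> (u x t) * P_int u x t * \<phi> (x, t)))
        + (LBINT x:{0<..<1}. \<eta> (u0 x) * \<phi> (x, 0))
        - (LBINT x:{0<..<1}. \<eta> (u x T) * \<phi> (x, T)) \<ge> 0"
    by (intro allI impI, elim conjE) (rule interior_entropy_inequality[OF f u0 mu0]; blast)
  show "\<exists>w0 w1. strong_trace T u 0 w0 \<and> strong_trace T u 1 w1 \<and>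
        (\<forall>\<eta> q. entropy_pair f \<eta> q \<longrightarrow> (AE t in lborel. t \<in> {0<..<T} \<longrightarrow>
            q (w0 t) - q (\<alpha> t) - deriv \<eta> (\<alpha> t) * (f (w0 t) - f (\<alpha> t)) \<le> 0 \<and>
            0 \<le> q (w1 t) - q (\<beta> t) - deriv \<eta> (\<beta> t) * (f (w1 t) - f (\<beta> t))))"
  proof (rule exI[of _ "u 0"], rule exI[of _ w1], intro conjI allI impI)
    show "strong_trace T u 0 (u 0)"
    proof (rule strong_trace_from_pointwise)
      show "((\<lambda>x. u x t) \<longlongrightarrow> u 0 t) (at 0 within {0<..<1})" for t
        by (rule tendsto_within_subset[OF u_at_0]) auto
    qed (use u_bound in auto)
    show "strong_trace T u 1 w1"
    proof (rule strong_trace_from_pointwise)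
      show "((\<lambda>x. u x t) \<longlongrightarrow> w1 t) (at 1 within {0<..<1})" for t
        by (rule tendsto_within_subset[OF u_at_1]) auto
    qed (use w1_bound in auto)
    fix \<eta> q assume ep: "entropy_pair f \<eta> q"
    note df' = deriv_flux[OF f]
    have \<eta>2: "Ck 2 \<eta>" and cv: "convex_on UNIV \<eta>" and dq: "\<And>v. (q has_real_derivative deriv \<eta> v * (F1' v + F2' v)) (at v)"
    proof -
      show "Ck 2 \<eta>" "convex_on UNIV \<eta>" using ep unfolding entropy_pair_def by blast+
      show "(q has_real_derivative deriv \<eta> v * (F1' v + F2' v)) (at v)" for v
        using ep unfolding entropy_pair_def df' by blast
    qed
    note d\<eta> = Ck_2_real[OF \<eta>2]
    note be = boundary_entropy_inequalities[OF d\<eta>(1) convex_imp_mono_deriv[OF cv d\<eta>(1)] d\<eta>(2,3) dq, unfolded f]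
    show "AE t in lborel. t \<in> {0<..<T} \<longrightarrow>
            q (u 0 t) - q (\<alpha> t) - deriv \<eta> (\<alpha> t) * (f (u 0 t) - f (\<alpha> t)) \<le> 0 \<and>
            0 \<le> q (w1 t) - q (\<beta> t) - deriv \<eta> (\<beta> t) * (f (w1 t) - f (\<beta> t))"
      using be(1) be(2) \<alpha> \<beta>
    proof eventually_elim
      case (elim t)
      show ?case
      proof
        assume t: "t \<in> {0<..<T}"
        have ab: "\<alpha> t = a t" "\<beta> t = b t" using elim(3,4) t by blast+
        show "q (u 0 t) - q (\<alpha> t) - deriv \<eta> (\<alpha> t) * (f (u 0 t) - f (\<alpha> t)) \<le> 0 \<and>
            0 \<le> q (w1 t) - q (\<beta> t) - deriv \<eta> (\<beta> t) * (f (w1 t) - f (\<beta> t))"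
          unfolding ab using elim(1,2) t by blast
      qed
    qed
  qed
qed

end

section \<open>Cell averages of data of bounded variation\<close>

lemma bvr_mono: "bvr C f \<Longrightarrow> C \<le> C' \<Longrightarrow> bvr C' f"
  unfolding bvr_def by (meson order_trans)

lemma idx_eq_iff:
  assumes "h > 0" "0 \<le> x + c" "x + c < real (Suc L) * h" "i \<le> L"
  shows "idx h c L x = i \<longleftrightarrow> real i * h \<le> x + c \<and> x + c < real (Suc i) * h"
  using idx_eqI[OF assms(1), of i x c L] idx_bounds[OF assms(1-3)] assms(4) by auto

lemma finite_total_variation_bounded:
  assumes "a < b" "finite_total_variation a b g"
  shows "\<exists>B. \<forall>x\<in>{a<..<b}. \<bar>g x\<bar> \<le> B"
proof -
  obtain C where C: "\<And>m p. (\<forall>i\<le>m. p i \<in> {a<..<b}) \<Longrightarrow> (\<forall>i<m. p i < p (Suc i)) \<Longrightarrow>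
      (\<Sum>i<m. \<bar>g (p (Suc i)) - g (p i)\<bar>) \<le> C"
    using assms(2) unfolding finite_total_variation_def by blast
  have two: "\<bar>g y - g x\<bar> \<le> C" if "x \<in> {a<..<b}" "y \<in> {a<..<b}" "x < y" for x y
    using C[of 1 "\<lambda>i. if i = 0 then x else y"] that by auto
  have C0: "0 \<le> C" using C[of 0 "\<lambda>_. (a + b) / 2"] assms(1) by auto
  define c where "c = (a + b) / 2"
  have c: "c \<in> {a<..<b}" using assms(1) by (auto simp: c_def)
  have "\<bar>g x\<bar> \<le> \<bar>g c\<bar> + C" if "x \<in> {a<..<b}" for x
    using two[OF that c] two[OF c that] C0 by (cases x c rule: linorder_cases) auto
  then show ?thesis by blast
qed

text \<open>A class in BV contains a function \<open>g\<close> of finite variation, which is bounded. Truncating \<open>v\<close> at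
  the bound of \<open>g\<close> gives a function \<open>w\<close> that is bounded and visibly Borel, but equals \<open>g\<close> only almost
  everywhere. So the variation bound passes from \<open>g\<close> to \<open>w\<close> only along almost every translate
  \<open>s\<close> of an equidistant partition, which is enough for averages.\<close>
lemma BV_representative:
  assumes ab: "a < b" and v: "v \<in> BV a b"
  obtains w K C where "w \<in> borel_measurable borel" "\<forall>x. \<bar>w x\<bar> \<le> K" "AE x in lborel. x \<in> {a<..<b} \<longrightarrow> v x = w x"
    "\<forall>c h m. h > 0 \<longrightarrow> a \<le> c \<longrightarrow> c + (real m + 1) * h \<le> b \<longrightarrow>
       (AE s in lborel. s \<in> {0<..<h} \<longrightarrow> (\<Sum>i<m. \<bar>w (c + real (Suc i) * h + s) - w (c + real i * h + s)\<bar>) \<le> C)"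
proof -
  have int: "set_integrable lborel {a<..<b} v" using v unfolding BV_def by blast
  obtain g where g: "finite_total_variation a b g" "AE x in lborel. x \<in> {a<..<b} \<longrightarrow> v x = g x"
    using v unfolding BV_def by blast
  obtain B where B: "\<And>x. x \<in> {a<..<b} \<Longrightarrow> \<bar>g x\<bar> \<le> B"
    using finite_total_variation_bounded[OF ab g(1)] by blast
  obtain C where C: "\<And>m p. (\<forall>i\<le>m. p i \<in> {a<..<b}) \<Longrightarrow> (\<forall>i<m. p i < p (Suc i)) \<Longrightarrow>
      (\<Sum>i<m. \<bar>g (p (Suc i)) - g (p i)\<bar>) \<le> C"
    using g(1) unfolding finite_total_variation_def by blast
  define K where "K = max B 0"
  define w where "w x = max (- K) (min K (indicator {a<..<b} x *\<^sub>R v x))" for x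
  have [measurable]: "(\<lambda>x. indicator {a<..<b} x *\<^sub>R v x) \<in> borel_measurable borel"
    using int by (auto simp: set_integrable_def)
  have m: "w \<in> borel_measurable borel" unfolding w_def[abs_def] by measurable
  have wb: "\<bar>w x\<bar> \<le> K" for x by (auto simp: w_def K_def)
  have wg: "AE x in lborel. x \<in> {a<..<b} \<longrightarrow> v x = g x \<and> w x = g x"
    using g(2) by eventually_elim (use B in \<open>force simp: w_def K_def\<close>)
  obtain Z where Z: "Z \<in> null_sets lborel" "{x. \<not> (x \<in> {a<..<b} \<longrightarrow> v x = g x \<and> w x = g x)} \<subseteq> Z"
    using AE_E[OF wg] by (auto simp: null_sets_def)
  \<comment> \<open>A translate of a null set is null, so almost every \<open>s\<close> avoids the exceptional set at all partition points.\<close>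
  have ZZ: "AE s in lborel. y + s \<notin> Z" for y
  proof -
    have [measurable]: "Z \<in> sets borel" using Z(1) by auto
    have "AE s in lborel. y + 1 * s \<notin> Z"
      by (rule AE_borel_affine[of 1 "\<lambda>x. x \<notin> Z"]) (use AE_not_in[OF Z(1)] in auto)
    then show ?thesis by simp
  qed
  have var: "AE s in lborel. s \<in> {0<..<h} \<longrightarrow> (\<Sum>i<m. \<bar>w (c + real (Suc i) * h + s) - w (c + real i * h + s)\<bar>) \<le> C"
    if h: "h > 0" "a \<le> c" "c + (real m + 1) * h \<le> b" for c h m
  proof -
    have "AE s in lborel. \<forall>i\<in>{..m}. c + real i * h + s \<notin> Z"
      using ZZ by (intro AE_finite_allI) auto
    then show ?thesis
    proof eventually_elim
      case (elim s)
      show ?case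
      proof
        assume s: "s \<in> {0<..<h}"
        have in_ab: "c + real i * h + s \<in> {a<..<b}" if "i \<le> m" for i
        proof -
          have "real i * h \<le> real m * h" "0 \<le> real i * h" using that h by (auto intro: mult_right_mono)
          moreover have "c + real m * h + h \<le> b" using h(3) by (simp add: distrib_right)
          ultimately show ?thesis using s h(2) unfolding greaterThanLessThan_iff by linarith
        qed
        have eq: "w (c + real i * h + s) = g (c + real i * h + s)" if "i \<le> m" for i
          using elim Z(2) in_ab[OF that] that by auto
        have "(\<Sum>i<m. \<bar>w (c + real (Suc i) * h + s) - w (c + real i * h + s)\<bar>)
            = (\<Sum>i<m. \<bar>g (c + real (Suc i) * h + s) - g (c + real i * h + s)\<bar>)"
          by (intro sum.cong refl) (simp only: eq lessThan_iff Suc_leI less_imp_le)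
        also have "\<dots> \<le> C"
          using C[of m "\<lambda>i. c + real i * h + s"] in_ab h by (simp add: distrib_right)
        finally show "(\<Sum>i<m. \<bar>w (c + real (Suc i) * h + s) - w (c + real i * h + s)\<bar>) \<le> C" .
      qed
    qed
  qed
  have "AE x in lborel. x \<in> {a<..<b} \<longrightarrow> v x = w x" using wg by eventually_elim auto
  then show thesis using that[OF m _ _, of K C] wb var by blast
qed

lemma set_integral_representative:
  fixes v w :: "real \<Rightarrow> real"
  assumes v: "set_borel_measurable lborel {a<..<b} v" and [measurable]: "w \<in> borel_measurable borel"
    and eq: "AE x in lborel. x \<in> {a<..<b} \<longrightarrow> v x = w x"
    and A: "{c<..<d} \<subseteq> A" "A \<subseteq> {c..d}" "A \<in> sets borel" and cd: "a \<le> c" "d \<le> b"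
  shows "(LBINT x:A. v x) = (LBINT x:{c<..<d}. w x)"
proof -
  note [measurable] = A(3)
  define g where "g x = indicator {a<..<b} x *\<^sub>R v x" for x
  have [measurable]: "g \<in> borel_measurable borel" using v by (simp add: set_borel_measurable_def g_def[abs_def])
  have "(\<lambda>x. indicator A x *\<^sub>R v x) = (\<lambda>x. indicator A x * (if x = a then v a else if x = b then v b else g x))"
    using A cd by (force simp: indicator_def fun_eq_iff g_def)
  moreover have "(\<lambda>x. indicator A x * (if x = a then v a else if x = b then v b else g x)) \<in> borel_measurable borel"
    by measurable
  ultimately have m: "(\<lambda>x. indicator A x *\<^sub>R v x) \<in> borel_measurable borel" by (simp only:)
  show ?thesis unfolding set_lebesgue_integral_def
  proof (rule integral_cong_AE)
    show "AE x in lborel. indicator A x *\<^sub>R v x = indicator {c<..<d} x *\<^sub>R w x"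
      using eq AE_lborel_singleton[of c] AE_lborel_singleton[of d]
    proof eventually_elim
      case (elim x)
      have "x \<in> A \<longleftrightarrow> x \<in> {c<..<d}" using A elim by force
      then show ?case using elim cd by (auto simp: indicator_def)
    qed
  qed (use m in auto)
qed

lemma slab_average_bound:
  fixes w :: "real \<Rightarrow> real"
  assumes "\<And>x. \<bar>w x\<bar> \<le> K" "c \<le> d" "d - c \<le> h" "h > 0"
  shows "\<bar>1 / h * (LBINT x:{c<..<d}. w x)\<bar> \<le> K"
proof -
  have K: "0 \<le> K" using assms(1)[of 0] by linarith
  have "\<bar>LBINT x:{c<..<d}. w x\<bar> \<le> K * (d - c)" by (rule set_integral_abs_le) (use assms K in auto)
  also have "\<dots> \<le> K * h" using assms K by (intro mult_left_mono) auto
  finally show ?thesis using assms(4) by (simp add: abs_mult pos_divide_le_eq)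
qed

text \<open>The average over a cell is the mean, over \<open>s\<close> in \<open>(0,h)\<close>, of the values at its left end shifted by \<open>s\<close>.
  Sum and integral are exchanged.\<close>
lemma variation_of_averages:
  fixes w :: "real \<Rightarrow> real"
  assumes [measurable]: "w \<in> borel_measurable borel" and K: "\<And>x. \<bar>w x\<bar> \<le> K" and h: "h > 0"
    and var: "AE s in lborel. s \<in> {0<..<h} \<longrightarrow> (\<Sum>i<m. \<bar>w (c + real (Suc i) * h + s) - w (c + real i * h + s)\<bar>) \<le> C"
  defines "A \<equiv> \<lambda>i. 1 / h * (LBINT x:{c + real i * h<..<c + real (Suc i) * h}. w x)"
  shows "(\<Sum>i<m. \<bar>A (Suc i) - A i\<bar>) \<le> C"
proof -
  have A: "A i = 1 / h * (LBINT s:{0<..<h}. w (c + real i * h + s))" for i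
  proof -
    have "(LINT x|lborel. indicator {c + real i * h<..<c + real (Suc i) * h} x *\<^sub>R w x)
        = \<bar>1\<bar> *\<^sub>R (LINT s|lborel. indicator {c + real i * h<..<c + real (Suc i) * h} ((c + real i * h) + 1 * s) *\<^sub>R w ((c + real i * h) + 1 * s))"
      by (rule lborel_integral_real_affine) simp
    also have "(\<lambda>s. indicator {c + real i * h<..<c + real (Suc i) * h} ((c + real i * h) + 1 * s) *\<^sub>R w ((c + real i * h) + 1 * s))
        = (\<lambda>s. indicator {0<..<h} s *\<^sub>R w (c + real i * h + s))"
      by (auto simp: fun_eq_iff indicator_def distrib_right)
    finally show ?thesis unfolding A_def set_lebesgue_integral_def by simp
  qed
  have int: "set_integrable lborel {0<..<h} (\<lambda>s. w (y + s))" for y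
    by (rule set_integrable_bounded_interval[OF _ K]) measurable
  have intd: "set_integrable lborel {0<..<h} (\<lambda>s. \<bar>w (c + real (Suc i) * h + s) - w (c + real i * h + s)\<bar>)" for i
    by (intro set_integrable_abs set_integral_diff int)
  have "(\<Sum>i<m. \<bar>A (Suc i) - A i\<bar>) \<le> (\<Sum>i<m. 1 / h * (LBINT s:{0<..<h}. \<bar>w (c + real (Suc i) * h + s) - w (c + real i * h + s)\<bar>))"
  proof (rule sum_mono)
    fix i
    have "A (Suc i) - A i = 1 / h * (LBINT s:{0<..<h}. w (c + real (Suc i) * h + s) - w (c + real i * h + s))"
      unfolding A by (simp only: set_integral_diff(2)[OF int int] right_diff_distrib)
    also have "\<bar>\<dots>\<bar> = 1 / h * \<bar>LBINT s:{0<..<h}. w (c + real (Suc i) * h + s) - w (c + real i * h + s)\<bar>"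
      using h by (simp add: abs_mult)
    also have "\<dots> \<le> 1 / h * (LBINT s:{0<..<h}. \<bar>w (c + real (Suc i) * h + s) - w (c + real i * h + s)\<bar>)"
      using h set_integral_norm_bound[OF set_integral_diff(1)[OF int int]] by (intro mult_left_mono) auto
    finally show "\<bar>A (Suc i) - A i\<bar> \<le> 1 / h * (LBINT s:{0<..<h}. \<bar>w (c + real (Suc i) * h + s) - w (c + real i * h + s)\<bar>)" .
  qed
  also have "\<dots> = 1 / h * (LBINT s:{0<..<h}. (\<Sum>i<m. \<bar>w (c + real (Suc i) * h + s) - w (c + real i * h + s)\<bar>))"
  proof -
    have "(LBINT s:{0<..<h}. (\<Sum>i<m. \<bar>w (c + real (Suc i) * h + s) - w (c + real i * h + s)\<bar>))
        = (\<Sum>i<m. LBINT s:{0<..<h}. \<bar>w (c + real (Suc i) * h + s) - w (c + real i * h + s)\<bar>)"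
      unfolding set_lebesgue_integral_def scaleR_sum_right
      by (rule Bochner_Integration.integral_sum) (use intd in \<open>simp add: set_integrable_def\<close>)
    then show ?thesis by (simp only: sum_distrib_left)
  qed
  also have "\<dots> \<le> 1 / h * (LBINT s:{0<..<h}. C)"
  proof (intro mult_left_mono set_integral_mono_AE)
    show "set_integrable lborel {0<..<h} (\<lambda>s. \<Sum>i<m. \<bar>w (c + real (Suc i) * h + s) - w (c + real i * h + s)\<bar>)"
    proof (rule set_integrable_bounded_interval)
      show "\<bar>\<Sum>i<m. \<bar>w (c + real (Suc i) * h + s) - w (c + real i * h + s)\<bar>\<bar> \<le> (\<Sum>i<m. 2 * K)" for s
      proof -
        have "\<bar>\<Sum>i<m. \<bar>w (c + real (Suc i) * h + s) - w (c + real i * h + s)\<bar>\<bar> = (\<Sum>i<m. \<bar>w (c + real (Suc i) * h + s) - w (c + real i * h + s)\<bar>)"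
          by (intro abs_of_nonneg sum_nonneg) auto
        also have "\<dots> \<le> (\<Sum>i<m. 2 * K)"
        proof (rule sum_mono)
          fix i show "\<bar>w (c + real (Suc i) * h + s) - w (c + real i * h + s)\<bar> \<le> 2 * K"
            using K[of "c + real (Suc i) * h + s"] K[of "c + real i * h + s"] by linarith
        qed
        finally show ?thesis .
      qed
    qed measurable
    show "set_integrable lborel {0<..<h} (\<lambda>s. C)"
      by (rule set_integrable_bounded_interval[where B="\<bar>C\<bar>"]) auto
  qed (use var h in auto)
  also have "\<dots> = C" using h by (simp add: set_lebesgue_integral_def)
  finally show ?thesis .
qed

text \<open>The average over the cell number \<open>i\<close>, with cells starting at \<open>c\<close>, is the value of the step function
  on the index cell number \<open>i + 1\<close>, with index cells starting at \<open>- d\<close>. For space cells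
  \<open>c = d = h / 2\<close> and both cells coincide; for boundary values \<open>c = d = 0\<close>, and the
  average over one time slab is used in the next one. Over complete cells the integrals agree; what is left
  over has total length at most \<open>5 * h\<close>.\<close>
lemma primitive_of_averages_close:
  fixes w :: "real \<Rightarrow> real" and s :: "nat \<Rightarrow> real"
  assumes [measurable]: "w \<in> borel_measurable borel" and K: "\<And>x. \<bar>w x\<bar> \<le> K" and sK: "\<And>j. j \<le> L \<Longrightarrow> \<bar>s j\<bar> \<le> K"
    and h: "h > 0" and c: "0 \<le> c" "0 \<le> d" "c + d \<le> h"
    and s: "\<And>i. Suc i < L \<Longrightarrow> s (Suc i) = 1 / h * (LBINT x:{c + real i * h<..<c + real (Suc i) * h}. w x)"
    and x: "0 < x" "x + d < real (Suc L) * h"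
  shows "\<bar>(LBINT y:{0<..<x}. s (idx h d L y)) - (LBINT y:{0<..<x}. w y)\<bar> \<le> 5 * K * h"
proof -
  have K0: "0 \<le> K" using K[of 0] by linarith
  define k where "k = idx h d L x"
  have kx: "real k * h \<le> x + d" "x + d < real (Suc k) * h"
    unfolding k_def by (rule idx_bounds; use h c x in simp)+
  have kL: "k \<le> L" unfolding k_def by (rule idx_le)
  let ?S = "\<lambda>y. s (idx h d L y)"
  have bS: "\<bar>LBINT y:{a..<b}. ?S y\<bar> \<le> K * (b - a)" if "a \<le> b" for a b
    unfolding set_integral_atLeastLessThan[of ?S a b, simplified]
    by (rule set_integral_abs_le) (use that K0 sK idx_le in auto)
  have bw: "\<bar>LBINT y:{a..<b}. w y\<bar> \<le> K * (b - a)" if "a \<le> b" for a b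
    unfolding set_integral_atLeastLessThan[of w a b, simplified]
    by (rule set_integral_abs_le) (use that K0 K in auto)
  have iS: "set_integrable lborel {a..<b} ?S" for a b by (rule step_function_integrable) auto
  have iw: "set_integrable lborel {a..<b} w" for a b
    by (rule set_integrable_bounded_set[where B=K]) (use K in auto)
  have split: "(LBINT y:{a..<b'}. f y) = (LBINT y:{a..<b}. f y) + (LBINT y:{b..<b'}. f y)"
    if "a \<le> b" "b \<le> b'" and "\<And>a b. set_integrable lborel {a..<b} f" for a b b' and f :: "real \<Rightarrow> real"
  proof -
    have "{a..<b'} = {a..<b} \<union> {b..<b'}" using ivl_disj_un_two(3)[OF that(1,2)] by simp
    then show ?thesis by (simp only:) (rule set_integral_Un, use that(3) in auto)
  qed
  have goal_eq: "(LBINT y:{0<..<x}. ?S y) = (LBINT y:{0..<x}. ?S y)" "(LBINT y:{0<..<x}. w y) = (LBINT y:{0..<x}. w y)"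
    by (simp_all add: set_integral_atLeastLessThan)
  show ?thesis
  proof (cases "k = 0")
    case True
    then have "x \<le> h" using kx c by simp
    then have "\<bar>LBINT y:{0..<x}. ?S y\<bar> \<le> K * h" "\<bar>LBINT y:{0..<x}. w y\<bar> \<le> K * h"
      using bS[of 0 x] bw[of 0 x] x K0 mult_left_mono[of x h K] by auto
    moreover have "0 \<le> K * h" using K0 h by simp
    ultimately show ?thesis unfolding goal_eq by linarith
  next
    case False
    then obtain k' where k': "k = Suc k'" by (cases k) auto
    have kh: "real k * h = real k' * h + h" by (simp add: k' distrib_right)
    have k0: "0 \<le> real k' * h" using h by simp
    have S1: "(LBINT y:{0..<x}. ?S y) = (LBINT y:{0..<h - d}. ?S y) + ((LBINT y:{h - d..<real k * h - d}. ?S y) + (LBINT y:{real k * h - d..<x}. ?S y))"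
      using split[of 0 "h - d" x ?S, OF _ _ iS] split[of "h - d" "real k * h - d" x ?S, OF _ _ iS] c kx kh k0 by auto
    have mid: "(LBINT y:{h - d..<real k * h - d}. ?S y) = h * (\<Sum>j=1..<k. s j)"
      using integral_step_function[of h 1 k L d s] h kL k' by simp
    have "h * (\<Sum>j=1..<Suc n. s j) = (LBINT y:{c..<c + real n * h}. w y)" if "n < L" for n
      using that
    proof (induction n)
      case 0
      then show ?case by (simp add: set_lebesgue_integral_def)
    next
      case (Suc n)
      have "h * s (Suc n) = (LBINT y:{c + real n * h..<c + real (Suc n) * h}. w y)"
        using s[of n] Suc.prems h by (simp add: set_integral_atLeastLessThan)
      moreover have "(LBINT y:{c..<c + real (Suc n) * h}. w y) = (LBINT y:{c..<c + real n * h}. w y) + (LBINT y:{c + real n * h..<c + real (Suc n) * h}. w y)"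
        by (rule split[OF _ _ iw]) (use h in \<open>auto simp: distrib_right\<close>)
      ultimately show ?case using Suc by (simp add: distrib_left)
    qed
    from this[of k'] have mid': "h * (\<Sum>j=1..<k. s j) = (LBINT y:{c..<c + real k' * h}. w y)"
      using kL unfolding k' by simp
    have le: "c + real k' * h \<le> x" using kx kh c by linarith
    have W1: "(LBINT y:{0..<x}. w y) = (LBINT y:{0..<c}. w y) + ((LBINT y:{c..<c + real k' * h}. w y) + (LBINT y:{c + real k' * h..<x}. w y))"
      using split[of 0 c x w, OF _ _ iw] split[of c "c + real k' * h" x w, OF _ _ iw] c k0 le by auto
    have e: "\<bar>LBINT y:{0..<h - d}. ?S y\<bar> \<le> K * h" "\<bar>LBINT y:{real k * h - d..<x}. ?S y\<bar> \<le> K * h" "\<bar>LBINT y:{0..<c}. w y\<bar> \<le> K * h"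
      by (rule order.trans[OF bS mult_left_mono] order.trans[OF bw mult_left_mono]; use c kx K0 h in \<open>simp add: distrib_right\<close>)+
    have e2: "\<bar>LBINT y:{c + real k' * h..<x}. w y\<bar> \<le> K * (2 * h)"
      by (rule order.trans[OF bw mult_left_mono]) (use c kx kh K0 h le in \<open>auto simp: distrib_right\<close>)
    show ?thesis unfolding goal_eq S1 W1 mid mid' using e e2 by linarith
  qed
qed

context scheme_grid
begin

lemma time_steps:
  assumes "n \<le> m" "m \<le> Suc M"
  shows "h * (\<Sum>j\<le>N. \<bar>v m j - v n j\<bar>) \<le> real (m - n) * (D * \<tau>)"
  using assms
proof (induction m rule: dec_induct)
  case base then show ?case by simp
next
  case (step m)
  have "h * (\<Sum>j\<le>N. \<bar>v (Suc m) j - v n j\<bar>) \<le> h * (\<Sum>j\<le>N. \<bar>v (Suc m) j - v m j\<bar> + \<bar>v m j - v n j\<bar>)"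
    using h_pos by (intro mult_left_mono sum_mono) auto
  also have "\<dots> = h * (\<Sum>j\<le>N. \<bar>v (Suc m) j - v m j\<bar>) + h * (\<Sum>j\<le>N. \<bar>v m j - v n j\<bar>)"
    by (simp only: sum.distrib distrib_left)
  also have "\<dots> \<le> D * \<tau> + real (m - n) * (D * \<tau>)"
    using step time_step[of m] by (intro add_mono) auto
  also have "\<dots> = real (Suc m - n) * (D * \<tau>)" using step by (simp add: Suc_diff_le distrib_right del: times_divide_eq_right)
  finally show ?case .
qed

text \<open>Between two times there are at most \<open>\<bar>t - s\<bar> / \<tau> + 1\<close> time steps.\<close>
lemma time_lipschitz:
  assumes s: "s \<in> {0..T}" and t: "t \<in> {0..T}"
  shows "dist1 0 1 (\<lambda>x. v (idx \<tau> 0 (Suc M) t) (idx h (h / 2) N x)) (\<lambda>x. v (idx \<tau> 0 (Suc M) s) (idx h (h / 2) N x))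
     \<le> D * (\<bar>t - s\<bar> + \<tau>)"
proof -
  have D0: "D \<ge> 0"
  proof -
    have "0 \<le> h * (\<Sum>j\<le>N. \<bar>v (Suc 0) j - v 0 j\<bar>)" using h_pos by (intro mult_nonneg_nonneg sum_nonneg) auto
    then have "0 \<le> D * \<tau>" using time_step[of 0] by linarith
    then show ?thesis using \<tau>_pos by (metis mult_le_cancel_right_pos mult_zero_left)
  qed
  have main: "dist1 0 1 (\<lambda>x. v (idx \<tau> 0 (Suc M) t) (idx h (h / 2) N x)) (\<lambda>x. v (idx \<tau> 0 (Suc M) s) (idx h (h / 2) N x))
     \<le> D * ((t - s) + \<tau>)" if st: "s \<le> t" "s \<in> {0..T}" "t \<in> {0..T}" for s t
  proof -
    define n m where "n = idx \<tau> 0 (Suc M) s" and "m = idx \<tau> 0 (Suc M) t"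
    have nm: "n \<le> m" "m \<le> Suc M" unfolding n_def m_def using idx_mono[OF \<tau>_pos st(1)] idx_le by auto
    have lt: "y + 0 < real (Suc (Suc M)) * \<tau>" if "y \<in> {0..T}" for y
    proof -
      have "real (Suc (Suc M)) * \<tau> = (real M + 1) * \<tau> + \<tau>"
        by (simp add: distrib_right del: times_divide_eq_right)
      then show ?thesis using that \<tau>_pos unfolding T by simp
    qed
    have "real m * \<tau> \<le> t" "s < real (Suc n) * \<tau>"
      using idx_bounds[OF \<tau>_pos _ lt[OF st(2)]] idx_bounds[OF \<tau>_pos _ lt[OF st(3)]] st unfolding n_def m_def by auto
    then have d: "real (m - n) * \<tau> \<le> (t - s) + \<tau>" using nm by (simp add: of_nat_diff left_diff_distrib distrib_right del: times_divide_eq_right)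
    have "dist1 0 1 (\<lambda>x. v m (idx h (h / 2) N x)) (\<lambda>x. v n (idx h (h / 2) N x)) \<le> h * (\<Sum>j\<le>N. \<bar>v m j - v n j\<bar>)"
      unfolding dist1_def using integral_abs_step_le[of N "\<lambda>j. v m j - v n j"] N by simp
    also have "\<dots> \<le> real (m - n) * (D * \<tau>)" by (rule time_steps[OF nm])
    also have "\<dots> = D * (real (m - n) * \<tau>)" by (simp only: mult_ac)
    also have "\<dots> \<le> D * ((t - s) + \<tau>)" using d D0 by (rule mult_left_mono)
    finally show ?thesis unfolding n_def m_def .
  qed
  show ?thesis
  proof (cases "s \<le> t")
    case True then show ?thesis using main[OF True s t] by simp
  next
    case False then show ?thesis using main[OF _ t s] dist1_commute[of 0 1] by simp
  qed
qed

lemma bvr_space: "n \<le> Suc M \<Longrightarrow> bvr (K + V) (\<lambda>x. v n (idx h (h / 2) N x))"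
  by (rule bvr_step[OF h_pos]) (auto intro: bound variation)

lemma bvr_boundary:
  shows "bvr (R + W) (\<lambda>t. v (idx \<tau> 0 (Suc M) t) 0)" "bvr (R + W) (\<lambda>t. v (idx \<tau> 0 (Suc M) t) N)"
  using bvr_step[OF \<tau>_pos, of "Suc M" "\<lambda>n. v n 0" R W 0] bvr_step[OF \<tau>_pos, of "Suc M" "\<lambda>n. v n N" R W 0]
    bound_bdry var_bdry by auto

lemma constants_le: "R \<le> K" "W \<le> V" "0 \<le> W"
proof -
  have "0 \<le> \<gamma> * T" using \<gamma> T_pos by (intro mult_nonneg_nonneg) auto
  then have "1 \<le> exp (\<gamma> * T)" by simp
  then show "R \<le> K" using mult_left_mono[of 1 "exp (\<gamma> * T)" R] R_nonneg by (simp add: sup_bound_def)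
  show W0: "0 \<le> W" using var_init by (meson abs_ge_zero order_trans sum_nonneg)
  have "0 \<le> 3 * \<gamma> * T * K" using \<gamma> T_pos K_nonneg by (intro mult_nonneg_nonneg) auto
  then show "W \<le> V" using W0 by (simp add: variation_bound_def)
qed

end

section \<open>Convergence of the scheme\<close>

lemma dist1_eq_0_imp_AE:
  assumes "set_integrable lborel {a<..<b} f" "set_integrable lborel {a<..<b} g" "dist1 a b f g = 0"
  shows "AE x in lborel. x \<in> {a<..<b} \<longrightarrow> f x = g x"
proof -
  have i: "integrable lborel (\<lambda>x. indicator {a<..<b} x *\<^sub>R \<bar>f x - g x\<bar>)"
    using set_integrable_abs[OF set_integral_diff(1)[OF assms(1,2)]] by (simp add: set_integrable_def)
  have "AE x in lborel. indicator {a<..<b} x *\<^sub>R \<bar>f x - g x\<bar> = 0"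
    using integral_nonneg_eq_0_iff_AE[OF i] assms(3) by (auto simp: dist1_def set_lebesgue_integral_def)
  then show ?thesis by eventually_elim (auto simp: indicator_def split: if_splits)
qed

text \<open>The two half cells at the ends are the parts in the unit interval of full cells of \<open>idx\<close>.\<close>
lemma cell_eq:
  assumes N: "1 \<le> N" and x: "x \<in> {0<..<1}" and j: "j \<le> N"
  shows "x \<in> cell N j \<longleftrightarrow> idx (1 / real N) (1 / real N / 2) N x = j"
proof -
  define h where "h = 1 / real N"
  have "h > 0" "real N * h = 1" using N by (auto simp: h_def)
  then have "x + h / 2 < real (Suc N) * h" using x by (simp add: distrib_right)
  then have "x + 1 / real N / 2 < real (Suc N) * (1 / real N)" by (simp only: h_def)
  then have "idx (1 / real N) (1 / real N / 2) N x = j \<longleftrightarrow>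
      real j * (1 / real N) \<le> x + 1 / real N / 2 \<and> x + 1 / real N / 2 < real (Suc j) * (1 / real N)"
    using idx_eq_iff[of "1 / real N" x "1 / real N / 2" N j] N x j by auto
  also have "\<dots> \<longleftrightarrow> (real j - 1 / 2) / real N \<le> x \<and> x < (real j + 1 / 2) / real N"
  proof -
    have "(real j - 1 / 2) / real N = real j * h - h / 2" "(real j + 1 / 2) / real N = real j * h + h / 2"
      by (simp_all add: h_def diff_divide_distrib add_divide_distrib)
    then show ?thesis unfolding h_def[symmetric] by (auto simp: distrib_right)
  qed
  also have "\<dots> \<longleftrightarrow> x \<in> cell N j" using x by (auto simp: cell_def)
  finally show ?thesis by simp
qed

text \<open>The pair of indicators is nonzero for exactly one summand. The final time lies in the slab \<open>M + 1\<close>, which is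
  why indices in time range up to \<open>Suc M\<close>.\<close>
lemma interpolant_eq:
  assumes N: "1 \<le> N" and x: "x \<in> {0<..<1}" and t: "t \<in> {0..T}" and \<tau>: "\<tau> > 0" and T: "real (Suc M) * \<tau> = T"
  shows "interpolant \<tau> N M v x t = v (idx \<tau> 0 (Suc M) t) (idx (1 / real N) (1 / real N / 2) N x)"
proof -
  define J where "J = idx (1 / real N) (1 / real N / 2) N x"
  define I where "I = idx \<tau> 0 (Suc M) t"
  have I: "t \<in> {real n * \<tau>..<real (Suc n) * \<tau>} \<longleftrightarrow> I = n" if "n \<le> M + 1" for n
  proof -
    have "real (Suc (Suc M)) * \<tau> = real (Suc M) * \<tau> + \<tau>" by (simp add: distrib_right)
    then have "t + 0 < real (Suc (Suc M)) * \<tau>" using t \<tau> unfolding T by auto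
    then show ?thesis unfolding I_def using idx_eq_iff[of \<tau> t 0 "Suc M" n] that \<tau> t by auto
  qed
  have "interpolant \<tau> N M v x t = (\<Sum>n\<le>M + 1. \<Sum>j\<le>N. v n j * (if J = j then 1 else 0) * (if I = n then 1 else 0))"
    unfolding interpolant_def
    by (intro sum.cong refl) (use cell_eq[OF N x] I in \<open>auto simp: indicator_def J_def\<close>)
  also have "\<dots> = (\<Sum>n\<le>M + 1. if I = n then v n J else 0)"
  proof (rule sum.cong[OF refl])
    fix n
    have "(\<Sum>j\<le>N. v n j * (if J = j then 1 else 0) * (if I = n then 1 else 0)) = (\<Sum>j\<le>N. if J = j then (if I = n then v n j else 0) else 0)"
      by (rule sum.cong) auto
    then show "(\<Sum>j\<le>N. v n j * (if J = j then 1 else 0) * (if I = n then 1 else 0)) = (if I = n then v n J else 0)"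
      using idx_le[of "1 / real N" "1 / real N / 2" N x] by (simp add: J_def)
  qed
  also have "\<dots> = v I J" using idx_le[of \<tau> 0 "Suc M" t] by (simp add: I_def)
  finally show ?thesis by (simp add: I_def J_def)
qed

text \<open>Interior averages vary by at most \<open>C\<close>. The values in the two half cells are no averages, as they are
  normalised by the full width \<open>h\<close>; the increments next to them are estimated by \<open>2 * R\<close> each. Likewise the first
  increment in time at the boundary leads from an initial value to boundary data and
  costs \<open>2 * R\<close>. This explains the constant \<open>C + 4 * R\<close>.\<close>
lemma scheme_is_scheme_grid:
  assumes flux: "split_flux F1 F2 F1' F2' lam" and F: "\<And>x y. F x y = F1 x + F2 y"
    and N: "2 \<le> N" and \<gamma>: "\<gamma> > 0" and dt: "dt = T / (real M + 1)" "dt / (1 / real N) = lam"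
    and mu0: "set_borel_measurable lborel {0<..<1} u0" and m\<alpha>: "set_borel_measurable lborel {0<..<T} \<alpha>"
    and m\<beta>: "set_borel_measurable lborel {0<..<T} \<beta>"
    and w0: "w0 \<in> borel_measurable borel" "\<And>x. \<bar>w0 x\<bar> \<le> R" "AE x in lborel. x \<in> {0<..<1} \<longrightarrow> u0 x = w0 x"
    and wa: "wa \<in> borel_measurable borel" "\<And>x. \<bar>wa x\<bar> \<le> R" "AE x in lborel. x \<in> {0<..<T} \<longrightarrow> \<alpha> x = wa x"
    and wb: "wb \<in> borel_measurable borel" "\<And>x. \<bar>wb x\<bar> \<le> R" "AE x in lborel. x \<in> {0<..<T} \<longrightarrow> \<beta> x = wb x"
    and V0: "\<And>c h m. h > 0 \<Longrightarrow> 0 \<le> c \<Longrightarrow> c + (real m + 1) * h \<le> 1 \<Longrightarrow>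
       AE s in lborel. s \<in> {0<..<h} \<longrightarrow> (\<Sum>i<m. \<bar>w0 (c + real (Suc i) * h + s) - w0 (c + real i * h + s)\<bar>) \<le> C"
    and Va: "\<And>c h m. h > 0 \<Longrightarrow> 0 \<le> c \<Longrightarrow> c + (real m + 1) * h \<le> T \<Longrightarrow>
       AE s in lborel. s \<in> {0<..<h} \<longrightarrow> (\<Sum>i<m. \<bar>wa (c + real (Suc i) * h + s) - wa (c + real i * h + s)\<bar>) \<le> C"
    and Vb: "\<And>c h m. h > 0 \<Longrightarrow> 0 \<le> c \<Longrightarrow> c + (real m + 1) * h \<le> T \<Longrightarrow>
       AE s in lborel. s \<in> {0<..<h} \<longrightarrow> (\<Sum>i<m. \<bar>wb (c + real (Suc i) * h + s) - wb (c + real i * h + s)\<bar>) \<le> C"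
  defines "v \<equiv> scheme F \<gamma> dt N u0 \<alpha> \<beta>" and "h \<equiv> 1 / real N"
  shows "scheme_grid F1 F2 F1' F2' lam \<gamma> T R (C + 4 * R) N M v"
    and "\<And>j. Suc j < N \<Longrightarrow> v 0 (Suc j) = 1 / h * (LBINT x:{h / 2 + real j * h<..<h / 2 + real (Suc j) * h}. w0 x)"
    and "\<And>n. n \<le> M \<Longrightarrow> v (Suc n) 0 = 1 / dt * (LBINT x:{0 + real n * dt<..<0 + real (Suc n) * dt}. wa x)"
    and "\<And>n. n \<le> M \<Longrightarrow> v (Suc n) N = 1 / dt * (LBINT x:{0 + real n * dt<..<0 + real (Suc n) * dt}. wb x)"
proof -
  interpret split_flux F1 F2 F1' F2' lam by (rule flux)
  have h: "h > 0" "h \<le> 1 / 2" "real N * h = 1" using N by (auto simp: h_def field_simps)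
  have \<tau>: "dt = lam / real N" using dt(2) N by (auto simp: field_simps)
  have \<tau>: "dt = lam / real N" "dt > 0" using N lam by (auto simp: \<tau>)
  have MT: "(real M + 1) * dt = T" using dt(1) by simp
  have nT: "real (Suc n) * dt \<le> T" if "n \<le> M" for n
    using MT mult_right_mono[of "real (Suc n)" "real M + 1" dt] that \<tau>(2) by simp
  have n0: "0 \<le> real n * dt" for n using \<tau>(2) by simp
  have nS: "real n * dt \<le> real (Suc n) * dt" "real (Suc n) * dt - real n * dt \<le> dt" for n
    using \<tau>(2) by (auto simp: distrib_right)
  show va: "v (Suc n) 0 = 1 / dt * (LBINT x:{0 + real n * dt<..<0 + real (Suc n) * dt}. wa x)" if "n \<le> M" for n
  proof -
    have "(LBINT s:{real n * dt..real (Suc n) * dt}. \<alpha> s) = (LBINT x:{real n * dt<..<real (Suc n) * dt}. wa x)"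
      by (rule set_integral_representative[OF m\<alpha> wa(1,3)]) (use nT[OF that] n0[of n] in auto)
    then show ?thesis by (simp add: v_def Let_def del: of_nat_Suc)
  qed
  show vb: "v (Suc n) N = 1 / dt * (LBINT x:{0 + real n * dt<..<0 + real (Suc n) * dt}. wb x)" if "n \<le> M" for n
  proof -
    have "(LBINT s:{real n * dt..real (Suc n) * dt}. \<beta> s) = (LBINT x:{real n * dt<..<real (Suc n) * dt}. wb x)"
      by (rule set_integral_representative[OF m\<beta> wb(1,3)]) (use nT[OF that] n0[of n] in auto)
    then show ?thesis using N by (simp add: v_def Let_def del: of_nat_Suc)
  qed
  have v0: "\<exists>c d. v 0 j = 1 / h * (LBINT x:{c<..<d}. w0 x) \<and> c \<le> d \<and> d - c \<le> h \<and>
      (1 \<le> j \<longrightarrow> j < N \<longrightarrow> c = real j * h - h / 2 \<and> d = real j * h + h / 2)" if j: "j \<le> N" for j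
  proof -
    define c where "c = max 0 ((real j - 1/2) / real N)"
    define d where "d = min 1 ((real j + 1/2) / real N)"
    have c: "c = max 0 (real j * h - h / 2)" and d: "d = min 1 (real j * h + h / 2)"
      by (simp_all add: c_def d_def h_def diff_divide_distrib add_divide_distrib)
    have jh: "real j * h \<le> 1" "0 \<le> real j * h" using mult_right_mono[of "real j" "real N" h] h j by auto
    have "(LBINT x:cell N j. u0 x) = (LBINT x:{c<..<d}. w0 x)"
      by (rule set_integral_representative[OF mu0 w0(1,3)]) (auto simp: cell_def c_def d_def)
    moreover have "1 \<le> j \<longrightarrow> j < N \<longrightarrow> c = real j * h - h / 2 \<and> d = real j * h + h / 2"
    proof (intro impI)
      assume "1 \<le> j" "j < N"
      then have "1 * h \<le> real j * h" "(real j + 1) * h \<le> real N * h"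
        using h(1) mult_right_mono[of 1 "real j" h] mult_right_mono[of "real j + 1" "real N" h] by auto
      then show "c = real j * h - h / 2 \<and> d = real j * h + h / 2"
        unfolding c d using h by (auto simp: distrib_right)
    qed
    moreover have "c \<le> d" "d - c \<le> h" unfolding c d using jh h by auto
    ultimately show ?thesis by (intro exI[of _ c] exI[of _ d]) (simp add: v_def h_def)
  qed
  show v0_eq: "v 0 (Suc j) = 1 / h * (LBINT x:{h / 2 + real j * h<..<h / 2 + real (Suc j) * h}. w0 x)" if "Suc j < N" for j
  proof -
    from v0[OF less_imp_le[OF that]] obtain c d where cd': "v 0 (Suc j) = 1 / h * (LBINT x:{c<..<d}. w0 x)"
      "1 \<le> Suc j \<longrightarrow> Suc j < N \<longrightarrow> c = real (Suc j) * h - h / 2 \<and> d = real (Suc j) * h + h / 2" by blast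
    then have cd: "v 0 (Suc j) = 1 / h * (LBINT x:{c<..<d}. w0 x)" "c = real (Suc j) * h - h / 2" "d = real (Suc j) * h + h / 2"
      using that by simp_all
    have "c = h / 2 + real j * h" "d = h / 2 + real (Suc j) * h" unfolding cd by (simp_all add: distrib_right)
    then show ?thesis using cd(1) by simp
  qed
  have bi: "\<bar>v 0 j\<bar> \<le> R" if "j \<le> N" for j
    using v0[OF that] slab_average_bound[of w0 R _ _ h] w0(2) h by metis
  have ba: "\<bar>v n 0\<bar> \<le> R" if "n \<le> Suc M" for n
  proof (cases n)
    case 0 then show ?thesis using bi[of 0] by simp
  next
    case (Suc m)
    then show ?thesis using va[of m] slab_average_bound[of wa R "real m * dt" "real (Suc m) * dt" dt] wa(2) nS that \<tau>(2) by (simp del: of_nat_Suc)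
  qed
  have bb: "\<bar>v n N\<bar> \<le> R" if "n \<le> Suc M" for n
  proof (cases n)
    case 0 then show ?thesis using bi[of N] by simp
  next
    case (Suc m)
    then show ?thesis using vb[of m] slab_average_bound[of wb R "real m * dt" "real (Suc m) * dt" dt] wb(2) nS that \<tau>(2) by (simp del: of_nat_Suc)
  qed
  have R0: "0 \<le> R" using bi[of 0] by auto
  have time: "(\<Sum>n<Suc M. \<bar>f (Suc n) - f n\<bar>) \<le> C + 4 * R"
    if f: "\<And>n. n \<le> M \<Longrightarrow> f (Suc n) = 1 / dt * (LBINT x:{0 + real n * dt<..<0 + real (Suc n) * dt}. w x)"
      and fb: "\<And>n. n \<le> Suc M \<Longrightarrow> \<bar>f n\<bar> \<le> R" and w: "w \<in> borel_measurable borel" "\<And>x. \<bar>w x\<bar> \<le> R"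
      and V: "\<And>c h m. h > 0 \<Longrightarrow> 0 \<le> c \<Longrightarrow> c + (real m + 1) * h \<le> T \<Longrightarrow>
       AE s in lborel. s \<in> {0<..<h} \<longrightarrow> (\<Sum>i<m. \<bar>w (c + real (Suc i) * h + s) - w (c + real i * h + s)\<bar>) \<le> C"
    for f :: "nat \<Rightarrow> real" and w
  proof -
    have "(\<Sum>n<M. \<bar>f (Suc (Suc n)) - f (Suc n)\<bar>) \<le> C"
      using variation_of_averages[OF w \<tau>(2) V[OF \<tau>(2), of 0 M]] MT f by simp
    moreover have "\<bar>f (Suc 0) - f 0\<bar> \<le> 2 * R" using fb[of 0] fb[of "Suc 0"] by simp
    ultimately show ?thesis using R0 by (simp add: sum.lessThan_Suc_shift del: sum.lessThan_Suc)
  qed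
  have space: "(\<Sum>j<N. \<bar>v 0 (Suc j) - v 0 j\<bar>) \<le> C + 4 * R"
  proof -
    obtain m where m: "N = Suc (Suc m)" using N by (metis Suc_le_D numeral_2_eq_2 Suc_le_mono)
    have "h / 2 + (real m + 1) * h \<le> 1" using h unfolding m by (simp add: distrib_right)
    then have "(\<Sum>i<m. \<bar>v 0 (Suc (Suc i)) - v 0 (Suc i)\<bar>) \<le> C"
      using variation_of_averages[OF w0(1,2) h(1) V0[OF h(1), of "h / 2" m]] h v0_eq unfolding m by simp
    moreover have "\<bar>v 0 (Suc 0) - v 0 0\<bar> \<le> 2 * R" "\<bar>v 0 (Suc (Suc m)) - v 0 (Suc m)\<bar> \<le> 2 * R"
      using bi[of 0] bi[of "Suc 0"] bi[of "Suc m"] bi[of "Suc (Suc m)"] unfolding m by simp_all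
    moreover have "(\<Sum>j<N. \<bar>v 0 (Suc j) - v 0 j\<bar>) = \<bar>v 0 (Suc 0) - v 0 0\<bar> + (\<Sum>i<m. \<bar>v 0 (Suc (Suc i)) - v 0 (Suc i)\<bar>) + \<bar>v 0 (Suc (Suc m)) - v 0 (Suc m)\<bar>"
      unfolding m by (subst sum.lessThan_Suc, subst sum.lessThan_Suc_shift, simp)
    ultimately show ?thesis using R0 by linarith
  qed
  show "scheme_grid F1 F2 F1' F2' lam \<gamma> T R (C + 4 * R) N M v"
  proof
    show "(real M + 1) * (lam / real N) = T" using MT \<tau> by simp
    show "v (Suc n) j = v n j
       - lam * ((F1 (v n j) + F2 (v n (j + 1))) - (F1 (v n (j - 1)) + F2 (v n j)))
       + \<gamma> * (lam / real N) * P_disc N (v n) j" if "n \<le> M" "1 \<le> j" "j < N" for n j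
      using that dt(2) \<tau>(1) by (simp add: v_def Let_def F)
  qed (use N \<gamma> bi ba bb space time[of "\<lambda>n. v n 0" wa] time[of "\<lambda>n. v n N" wb] va vb wa wb Va Vb in auto)
qed

text \<open>The limits of the boundary and the initial values are identified first; they exist along the whole
  sequence. Compactness then provides the subsequence and the limit.\<close>
lemma convergence_on_fine_grids:
  fixes T \<gamma> lam :: real
    and f F1 F2 u0 \<alpha> \<beta> :: "real \<Rightarrow> real"
    and F :: "real \<Rightarrow> real \<Rightarrow> real"
    and dt :: "nat \<Rightarrow> real"
    and N M :: "nat \<Rightarrow> nat"
  assumes T: "T > 0" and \<gamma>: "\<gamma> > 0"
    and u0: "u0 \<in> BV 0 1" and \<alpha>: "\<alpha> \<in> BV 0 T" and \<beta>: "\<beta> \<in> BV 0 T"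
    and F1: "Ck 1 F1" and F2: "Ck 1 F2"
    and F: "\<And>v w. F v w = F1 v + F2 w" and Ff: "\<And>v. F v v = f v"
    and F1': "\<And>v. deriv F1 v \<ge> 0" and F2': "\<And>v. deriv F2 v \<le> 0"
    and cfl: "\<And>v. lam * (deriv F1 v - deriv F2 v) \<le> 1"
    and N: "\<And>n. N n \<ge> 2"
    and dt: "\<And>n. dt n = T / (real (M n) + 1)" "\<And>n. dt n / (1 / real (N n)) = lam"
    and dt0: "dt \<longlonglongrightarrow> 0"
  shows "\<exists>r :: nat \<Rightarrow> nat. strict_mono r \<and>
    (\<exists>u. entropy_solution T f \<gamma> u0 \<alpha> \<beta> u \<and>
      (\<lambda>k. SUP t\<in>{0..T}. L1_dist 0 1
          (\<lambda>x. interpolant (dt (r k)) (N (r k)) (M (r k))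
             (scheme F \<gamma> (dt (r k)) (N (r k)) u0 \<alpha> \<beta>) x t)
          (\<lambda>x. u x t)) \<longlonglongrightarrow> 0)"
proof -
  have dt_pos: "dt k > 0" for k using dt(1)[of k] T by simp
  have lam: "lam > 0" using dt(2)[of 0] dt_pos[of 0] N[of 0] by auto
  have dt_eq: "dt k = lam / real (N k)" for k using dt(2)[of k] N[of k] by (auto simp: field_simps)
  have MT: "real (Suc (M k)) * dt k = T" for k using dt(1)[of k] by (simp add: add.commute)
  have flux: "split_flux F1 F2 (deriv F1) (deriv F2) lam"
    by unfold_locales (use lam Ck_1_real[OF F1] Ck_1_real[OF F2] F1' F2' cfl in auto)
  have sbm: "set_borel_measurable lborel {a<..<b} g" if "g \<in> BV a b" for a b g
    using that unfolding BV_def set_integrable_def set_borel_measurable_def by auto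
  obtain w0 K0 C0 where w0: "w0 \<in> borel_measurable borel" "\<forall>x. \<bar>w0 x\<bar> \<le> K0" "AE x in lborel. x \<in> {0<..<1} \<longrightarrow> u0 x = w0 x"
    "\<forall>c h m. h > 0 \<longrightarrow> 0 \<le> c \<longrightarrow> c + (real m + 1) * h \<le> 1 \<longrightarrow>
       (AE s in lborel. s \<in> {0<..<h} \<longrightarrow> (\<Sum>i<m. \<bar>w0 (c + real (Suc i) * h + s) - w0 (c + real i * h + s)\<bar>) \<le> C0)"
    by (rule BV_representative[OF zero_less_one u0]) (rule that; assumption)
  obtain wa Ka Ca where wa: "wa \<in> borel_measurable borel" "\<forall>x. \<bar>wa x\<bar> \<le> Ka" "AE x in lborel. x \<in> {0<..<T} \<longrightarrow> \<alpha> x = wa x"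
    "\<forall>c h m. h > 0 \<longrightarrow> 0 \<le> c \<longrightarrow> c + (real m + 1) * h \<le> T \<longrightarrow>
       (AE s in lborel. s \<in> {0<..<h} \<longrightarrow> (\<Sum>i<m. \<bar>wa (c + real (Suc i) * h + s) - wa (c + real i * h + s)\<bar>) \<le> Ca)"
    by (rule BV_representative[OF T \<alpha>]) (rule that; assumption)
  obtain wb Kb Cb where wb: "wb \<in> borel_measurable borel" "\<forall>x. \<bar>wb x\<bar> \<le> Kb" "AE x in lborel. x \<in> {0<..<T} \<longrightarrow> \<beta> x = wb x"
    "\<forall>c h m. h > 0 \<longrightarrow> 0 \<le> c \<longrightarrow> c + (real m + 1) * h \<le> T \<longrightarrow>
       (AE s in lborel. s \<in> {0<..<h} \<longrightarrow> (\<Sum>i<m. \<bar>wb (c + real (Suc i) * h + s) - wb (c + real i * h + s)\<bar>) \<le> Cb)"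
    by (rule BV_representative[OF T \<beta>]) (rule that; assumption)
  define R where "R = max K0 (max Ka Kb)"
  define S where "S = max C0 (max Ca Cb)"
  have R: "\<bar>w0 x\<bar> \<le> R" "\<bar>wa x\<bar> \<le> R" "\<bar>wb x\<bar> \<le> R" for x
    using w0(2)[rule_format, of x] wa(2)[rule_format, of x] wb(2)[rule_format, of x] by (auto simp: R_def)
  have le_S: "C0 \<le> S" "Ca \<le> S" "Cb \<le> S" by (auto simp: S_def)
  have V0: "AE s in lborel. s \<in> {0<..<h} \<longrightarrow> (\<Sum>i<m. \<bar>w0 (c + real (Suc i) * h + s) - w0 (c + real i * h + s)\<bar>) \<le> S"
    if "h > 0" "0 \<le> c" "c + (real m + 1) * h \<le> 1" for c h m
    using w0(4)[rule_format, OF that] by eventually_elim (use le_S in auto)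
  have Va: "AE s in lborel. s \<in> {0<..<h} \<longrightarrow> (\<Sum>i<m. \<bar>wa (c + real (Suc i) * h + s) - wa (c + real i * h + s)\<bar>) \<le> S"
    if "h > 0" "0 \<le> c" "c + (real m + 1) * h \<le> T" for c h m
    using wa(4)[rule_format, OF that] by eventually_elim (use le_S in auto)
  have Vb: "AE s in lborel. s \<in> {0<..<h} \<longrightarrow> (\<Sum>i<m. \<bar>wb (c + real (Suc i) * h + s) - wb (c + real i * h + s)\<bar>) \<le> S"
    if "h > 0" "0 \<le> c" "c + (real m + 1) * h \<le> T" for c h m
    using wb(4)[rule_format, OF that] by eventually_elim (use le_S in auto)
  define W where "W = S + 4 * R"
  define v where "v k = scheme F \<gamma> (dt k) (N k) u0 \<alpha> \<beta>" for k
  note sg = scheme_is_scheme_grid[OF flux F N \<gamma> dt sbm[OF u0] sbm[OF \<alpha>] sbm[OF \<beta>] w0(1) R(1) w0(3) wa(1) R(2) wa(3) wb(1) R(3) wb(3) V0 Va Vb,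
      folded W_def v_def]
  have grid: "scheme_grid F1 F2 (deriv F1) (deriv F2) lam \<gamma> T R W (N k) (M k) (v k)" for k
    by (rule sg(1))
  define C where "C = sup_bound R \<gamma> T + variation_bound W R \<gamma> T"
  define D where "D = max 0 ((4 * sup_bound R \<gamma> T + 2 * variation_bound W R \<gamma> T + \<gamma> * lam * sup_bound R \<gamma> T) / lam)"
  define h where "h k = 1 / real (N k)" for k
  have h: "h k > 0" "real (N k) * h k = 1" for k using N[of k] by (auto simp: h_def)
  have h_lim: "h \<longlonglongrightarrow> 0"
  proof -
    have "h = (\<lambda>k. dt k / lam)" using lam by (simp add: fun_eq_iff h_def dt_eq)
    then show ?thesis using tendsto_divide[OF dt0 tendsto_const[of lam]] lam by simp
  qed
  have N_inf: "filterlim N at_top sequentially"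
    unfolding filterlim_at_top
  proof
    fix Z :: nat
    have "\<forall>\<^sub>F k in sequentially. h k < 1 / (real Z + 1)" using h_lim by (intro order_tendstoD(2)) auto
    then show "\<forall>\<^sub>F k in sequentially. Z \<le> N k"
    proof eventually_elim
      case (elim k)
      have "real (N k) * h k < real (N k) * (1 / (real Z + 1))" using elim N[of k] by (intro mult_strict_left_mono) auto
      then show ?case unfolding h(2) by (simp add: field_simps)
    qed
  qed
  have RC: "R \<le> sup_bound R \<gamma> T" "R + W \<le> C" "sup_bound R \<gamma> T \<le> C" "0 \<le> R" "0 \<le> sup_bound R \<gamma> T"
    using scheme_grid.constants_le[OF grid[of 0]] scheme_grid.R_nonneg[OF grid[of 0]] by (auto simp: C_def)
  define I where "I k t = idx (dt k) 0 (Suc (M k)) t" for k t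
  define J where "J k x = idx (h k) (h k / 2) (N k) x" for k x
  \<comment> \<open>The step functions of the boundary and the initial values converge to the data.\<close>
  have bvr_a: "bvr C (\<lambda>t. v k (I k t) 0)" and bvr_b: "bvr C (\<lambda>t. v k (I k t) (N k))" for k
    using scheme_grid.bvr_boundary[OF grid[of k]] RC(2) unfolding I_def dt_eq by (auto intro: bvr_mono)
  have prim: "(\<lambda>k. LBINT y:{0<..<x}. g k (idx (l k) (d k) (L k) y)) \<longlonglongrightarrow> (LBINT y:{0<..<x}. w y)"
    if "w \<in> borel_measurable borel" "\<And>x. \<bar>w x\<bar> \<le> R" "\<And>k j. j \<le> L k \<Longrightarrow> \<bar>g k j\<bar> \<le> R"
      "\<And>k. 0 < l k" "\<And>k. 0 \<le> c k" "\<And>k. 0 \<le> d k" "\<And>k. c k + d k \<le> l k"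
      "\<And>k i. Suc i < L k \<Longrightarrow> g k (Suc i) = 1 / l k * (LBINT x:{c k + real i * l k<..<c k + real (Suc i) * l k}. w x)"
      "0 < x" "\<And>k. x + d k < real (Suc (L k)) * l k" "l \<longlonglongrightarrow> 0"
    for w :: "real \<Rightarrow> real" and g :: "nat \<Rightarrow> nat \<Rightarrow> real" and l c d :: "nat \<Rightarrow> real" and L :: "nat \<Rightarrow> nat" and x
  proof -
    have "(\<lambda>k. 5 * R * l k) \<longlonglongrightarrow> 0" using tendsto_mult_left[OF that(11), of "5 * R"] by simp
    then have "(\<lambda>k. (LBINT y:{0<..<x}. g k (idx (l k) (d k) (L k) y)) - (LBINT y:{0<..<x}. w y)) \<longlonglongrightarrow> 0"
      by (rule Lim_null_comparison[rotated])
         (use primitive_of_averages_close[OF that(1-3) that(4-7) that(8-10)] in \<open>auto intro!: always_eventually\<close>)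
    then show ?thesis by (simp add: LIM_zero_iff)
  qed
  have scheme_bounds: "\<bar>v k n 0\<bar> \<le> R" "\<bar>v k n (N k)\<bar> \<le> R" if "n \<le> Suc (M k)" for k n
    using grid[of k] that by (auto simp: scheme_grid_def scheme_grid_axioms_def)
  have init_bound: "\<bar>v k 0 j\<bar> \<le> R" if "j \<le> N k" for k j
    using grid[of k] that by (auto simp: scheme_grid_def scheme_grid_axioms_def)
  have xT: "x + 0 < real (Suc (Suc (M k))) * dt k" if "x \<in> {0<..T}" for x k
  proof -
    have "real (Suc (Suc (M k))) * dt k = T + dt k" using MT[of k] by (simp add: distrib_right)
    then show ?thesis using that dt_pos[of k] by simp
  qed
  have wint: "set_integrable lborel {a<..<b} w" if "w \<in> borel_measurable borel" "\<And>x. \<bar>w x\<bar> \<le> R" for w :: "real \<Rightarrow> real" and a b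
    by (rule set_integrable_bounded_interval[OF that(1), where B=R]) (rule that(2))
  have "\<exists>g. bvr C g \<and> (AE x in lborel. x \<in> {0<..<T} \<longrightarrow> wa x = g x) \<and> (\<lambda>k. dist1 0 T (\<lambda>t. v k (I k t) 0) g) \<longlonglongrightarrow> 0"
    unfolding I_def
    by (rule L1_limit_from_primitives[OF T bvr_a[unfolded I_def] wint[OF wa(1) R(2)] prim[OF wa(1) R(2), where c="\<lambda>_. 0"]])
       (use scheme_bounds dt_pos less_imp_le[OF dt_pos] sg(3) xT dt0 in auto)
  then obtain a where a: "bvr C a" "AE x in lborel. x \<in> {0<..<T} \<longrightarrow> wa x = a x" "(\<lambda>k. dist1 0 T (\<lambda>t. v k (I k t) 0) a) \<longlonglongrightarrow> 0"
    by blast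
  have "\<exists>g. bvr C g \<and> (AE x in lborel. x \<in> {0<..<T} \<longrightarrow> wb x = g x) \<and> (\<lambda>k. dist1 0 T (\<lambda>t. v k (I k t) (N k)) g) \<longlonglongrightarrow> 0"
    unfolding I_def
    by (rule L1_limit_from_primitives[OF T bvr_b[unfolded I_def] wint[OF wb(1) R(3)] prim[OF wb(1) R(3), where c="\<lambda>_. 0"]])
       (use scheme_bounds dt_pos less_imp_le[OF dt_pos] sg(4) xT dt0 in auto)
  then obtain b where b: "bvr C b" "AE x in lborel. x \<in> {0<..<T} \<longrightarrow> wb x = b x" "(\<lambda>k. dist1 0 T (\<lambda>t. v k (I k t) (N k)) b) \<longlonglongrightarrow> 0"
    by blast
  \<comment> \<open>The time slab number 0 contains the time 0, so the initial values are the approximations at that time.\<close>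
  have U_bvr: "bvr C (\<lambda>x. v k (I k t) (J k x))" for k t
    unfolding C_def J_def h_def using scheme_grid.bvr_space[OF grid[of k], of "I k t"] by (simp add: I_def idx_le)
  have I0: "I k 0 = 0" for k
    unfolding I_def using dt_pos[of k] by (intro idx_eqI) auto
  have "\<exists>g. bvr C g \<and> (AE x in lborel. x \<in> {0<..<1} \<longrightarrow> w0 x = g x) \<and> (\<lambda>k. dist1 0 1 (\<lambda>x. v k 0 (J k x)) g) \<longlonglongrightarrow> 0"
    unfolding J_def
  proof (rule L1_limit_from_primitives[OF zero_less_one U_bvr[of _ 0, unfolded I0 J_def] wint[OF w0(1) R(1)] prim[OF w0(1) R(1), where c="\<lambda>k. h k / 2"]])
    show "x + h k / 2 < real (Suc (N k)) * h k" if "x \<in> {0<..1}" for x k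
      using that h[of k] by (simp add: distrib_right)
    show "v k 0 (Suc i) = 1 / h k * (LBINT x:{h k / 2 + real i * h k<..<h k / 2 + real (Suc i) * h k}. w0 x)" if "Suc i < N k" for k i
      unfolding h_def by (rule sg(2)) (assumption | rule that)+
  qed (use init_bound h h_lim in \<open>auto simp: less_imp_le\<close>)
  then obtain g0 where g0: "bvr C g0" "AE x in lborel. x \<in> {0<..<1} \<longrightarrow> w0 x = g0 x" "(\<lambda>k. dist1 0 1 (\<lambda>x. v k 0 (J k x)) g0) \<longlonglongrightarrow> 0"
    by blast
  have lip: "dist1 0 1 (\<lambda>x. v k (I k t) (J k x)) (\<lambda>x. v k (I k s) (J k x)) \<le> D * (\<bar>t - s\<bar> + dt k)"
    if "s \<in> {0..T}" "t \<in> {0..T}" for k s t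
  proof -
    have "dist1 0 1 (\<lambda>x. v k (I k t) (J k x)) (\<lambda>x. v k (I k s) (J k x))
       \<le> (4 * sup_bound R \<gamma> T + 2 * variation_bound W R \<gamma> T + \<gamma> * lam * sup_bound R \<gamma> T) / lam * (\<bar>t - s\<bar> + dt k)"
      using scheme_grid.time_lipschitz[OF grid that, of k] unfolding I_def J_def h_def dt_eq .
    also have "\<dots> \<le> D * (\<bar>t - s\<bar> + dt k)" using dt_pos[of k] by (intro mult_right_mono) (auto simp: D_def)
    finally show ?thesis .
  qed
  have D0: "0 \<le> D" by (simp add: D_def)
  obtain r u' where r: "strict_mono (r :: nat \<Rightarrow> nat)" and u': "\<And>t. t \<in> {0..T} \<Longrightarrow> bvr C (\<lambda>x. u' x t)"
    and unif: "\<And>e. e > 0 \<Longrightarrow> \<forall>\<^sub>F k in sequentially. \<forall>t\<in>{0..T}. dist1 0 1 (\<lambda>x. v (r k) (I (r k) t) (J (r k) x)) (\<lambda>x. u' x t) \<le> e"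
    using space_time_compactness[OF T D0 U_bvr lip dt0] by blast
  \<comment> \<open>The limit is set to zero outside \<open>[0,1) \<times> [0,T]\<close>; its value at \<open>x = 0\<close> is the right-hand
    limit, so that \<open>u 0\<close> is the left trace.\<close>
  define u where "u x t = (if x \<in> {0..<1} \<and> t \<in> {0..T} then u' x t else 0)" for x t
  have u_eq: "u x t = u' x t" if "x \<in> {0..<1}" "t \<in> {0..T}" for x t using that by (simp add: u_def)
  have dist_u: "dist1 0 1 g (\<lambda>x. u x t) = dist1 0 1 g (\<lambda>x. u' x t)" if "t \<in> {0..T}" for g t
    unfolding dist1_def by (rule set_lebesgue_integral_cong) (use u_eq that in auto)
  have U_lim: "(\<lambda>k. dist1 0 1 (\<lambda>x. v (r k) (I (r k) t) (J (r k) x)) (\<lambda>x. u' x t)) \<longlonglongrightarrow> 0" if "t \<in> {0..T}" for t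
  proof (rule tendstoI)
    fix e :: real assume "e > 0"
    then have "\<forall>\<^sub>F k in sequentially. \<forall>t\<in>{0..T}. dist1 0 1 (\<lambda>x. v (r k) (I (r k) t) (J (r k) x)) (\<lambda>x. u' x t) \<le> e / 2"
      by (intro unif) simp
    then show "\<forall>\<^sub>F k in sequentially. dist (dist1 0 1 (\<lambda>x. v (r k) (I (r k) t) (J (r k) x)) (\<lambda>x. u' x t)) 0 < e"
      by eventually_elim (use that \<open>e > 0\<close> in \<open>auto simp: dist1_nonneg dest!: bspec[of _ _ t]\<close>)
  qed
  have C0: "0 \<le> C" using RC by linarith
  have "\<forall>t\<in>{0..T}. \<exists>l. ((\<lambda>x. u' x t) \<longlongrightarrow> l) (at_left 1)"
    using bvr_left[OF u'] by blast
  from bchoice[OF this] obtain w1 where w1: "\<And>t. t \<in> {0..T} \<Longrightarrow> ((\<lambda>x. u' x t) \<longlongrightarrow> w1 t) (at_left 1)"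
    by blast
  define w where "w t = (if t \<in> {0..T} then w1 t else 0)" for t
  have sl: "scheme_limit F1 F2 (deriv F1) (deriv F2) lam \<gamma> T R W C (\<lambda>k. N (r k)) (\<lambda>k. M (r k)) (\<lambda>k. v (r k)) u a b w"
  proof (intro scheme_limit.intro flux scheme_limit_axioms.intro)
    show "filterlim (\<lambda>k. N (r k)) at_top sequentially"
      using filterlim_compose[OF N_inf filterlim_subseq[OF r]] .
    show "(\<lambda>(x, t). u x t) \<in> borel_measurable (borel \<Otimes>\<^sub>M borel)"
      unfolding u_def
    proof (rule joint_measurability_of_limit[OF _ U_bvr u' U_lim])
      fix k
      have "(\<lambda>z. v (r k) (I (r k) (snd z)) (J (r k) (fst z))) \<in> borel_measurable (borel \<Otimes>\<^sub>M borel)"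
        unfolding I_def J_def
        by (rule measurable_compose_countable[where f="\<lambda>i z. v (r k) i (idx (h (r k)) (h (r k) / 2) (N (r k)) (fst z))"]) measurable
      then show "(\<lambda>(x, t). v (r k) (I (r k) t) (J (r k) x)) \<in> borel_measurable (borel \<Otimes>\<^sub>M borel)"
        by (simp add: case_prod_unfold)
    qed
    show "\<bar>u x t\<bar> \<le> 2 * C" for x t
      using bvr_bounded[OF u', of t x] C0 by (simp add: u_def)
    show "((\<lambda>x. u x t) \<longlongrightarrow> u 0 t) (at_right 0)" for t
    proof (cases "t \<in> {0..T}")
      case True
      have "\<forall>\<^sub>F x in at_right 0. u' x t = u x t"
        using eventually_at_right_real[of 0 "1 :: real"] by (auto elim!: eventually_mono simp: u_def True[simplified])
      from Lim_transform_eventually[OF bvr_right[OF u'[OF True]] this]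
      show ?thesis using True by (simp add: u_def)
    next
      case False
      then have "u x t = 0" for x by (auto simp: u_def)
      then show ?thesis by simp
    qed
    show "((\<lambda>x. u x t) \<longlongrightarrow> w t) (at_left 1)" for t
    proof (cases "t \<in> {0..T}")
      case True
      have "\<forall>\<^sub>F x in at_left 1. u' x t = u x t"
        using eventually_at_left_real[of 0 "1 :: real"] by (auto elim!: eventually_mono simp: u_def True[simplified])
      from Lim_transform_eventually[OF w1[OF True] this]
      show ?thesis using True by (simp add: w_def)
    next
      case False
      then have "u x t = 0" "w t = 0" for x by (auto simp: u_def w_def)
      then show ?thesis by simp
    qed
    show "(\<lambda>k. dist1 0 1 (\<lambda>x. v (r k) (idx (lam / real (N (r k))) 0 (Suc (M (r k))) t) (idx (1 / real (N (r k))) (1 / real (N (r k)) / 2) (N (r k)) x)) (\<lambda>x. u x t)) \<longlonglongrightarrow> 0"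
      if "t \<in> {0..T}" for t
      using U_lim[OF that] unfolding dist_u[OF that] I_def J_def h_def dt_eq .
    show "(\<lambda>k. dist1 0 T (\<lambda>t. v (r k) (idx (lam / real (N (r k))) 0 (Suc (M (r k))) t) 0) a) \<longlonglongrightarrow> 0"
      using LIMSEQ_subseq_LIMSEQ[OF a(3) r] unfolding o_def I_def dt_eq .
    show "(\<lambda>k. dist1 0 T (\<lambda>t. v (r k) (idx (lam / real (N (r k))) 0 (Suc (M (r k))) t) (N (r k))) b) \<longlonglongrightarrow> 0"
      using LIMSEQ_subseq_LIMSEQ[OF b(3) r] unfolding o_def I_def dt_eq .
  qed (use grid Ck_1_real[OF F1] Ck_1_real[OF F2] RC a b in auto)
  have i': "set_integrable lborel {0<..<1} (\<lambda>x. u' x t)" if "t \<in> {0..T}" for t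
    by (rule set_integrable_bvr[OF u'[OF that]])
  have iU: "set_integrable lborel {0<..<1} (\<lambda>x. v k (I k t) (J k x))" for k t
    by (rule set_integrable_bvr[OF U_bvr])
  have u_lip: "dist1 0 1 (\<lambda>x. u x t) (\<lambda>x. u x s) \<le> D * \<bar>t - s\<bar>" if s: "s \<in> {0..T}" and t: "t \<in> {0..T}" for s t
  proof -
    let ?U = "\<lambda>k t x. v (r k) (I (r k) t) (J (r k) x)"
    have "(\<lambda>k. dist1 0 1 (?U k t) (\<lambda>x. u' x t) + D * (\<bar>t - s\<bar> + dt (r k)) + dist1 0 1 (?U k s) (\<lambda>x. u' x s))
        \<longlonglongrightarrow> 0 + D * (\<bar>t - s\<bar> + 0) + 0"
      using LIMSEQ_subseq_LIMSEQ[OF dt0 r] by (intro tendsto_intros U_lim s t) (simp add: o_def)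
    moreover have "dist1 0 1 (\<lambda>x. u' x t) (\<lambda>x. u' x s)
        \<le> dist1 0 1 (?U k t) (\<lambda>x. u' x t) + D * (\<bar>t - s\<bar> + dt (r k)) + dist1 0 1 (?U k s) (\<lambda>x. u' x s)" for k
      using dist1_triangle[OF i'[OF t] iU i'[OF s], of "r k" t] dist1_triangle[OF iU iU i'[OF s], of "r k" t "r k" s]
        lip[OF s t, of "r k"] dist1_commute[of 0 1 "\<lambda>x. u' x t" "?U k t"] by linarith
    ultimately have "dist1 0 1 (\<lambda>x. u' x t) (\<lambda>x. u' x s) \<le> D * \<bar>t - s\<bar>"
      using LIMSEQ_le_const by fastforce
    then show ?thesis using dist_u[OF s, of "\<lambda>x. u x t"] dist_u[OF t, of "\<lambda>x. u' x s"]
      by (simp add: dist1_commute)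
  qed
  have init: "AE x in lborel. x \<in> {0<..<1} \<longrightarrow> u0 x = u x 0"
  proof -
    have t0: "0 \<in> {0..T}" using T by simp
    have "dist1 0 1 g0 (\<lambda>x. u' x 0) \<le> dist1 0 1 (\<lambda>x. v (r k) 0 (J (r k) x)) g0 + dist1 0 1 (\<lambda>x. v (r k) 0 (J (r k) x)) (\<lambda>x. u' x 0)" for k
      using dist1_triangle[OF set_integrable_bvr[OF g0(1)] iU[of "r k" 0] i'[OF t0]] dist1_commute[of 0 1 g0] by (simp add: I0)
    moreover have "(\<lambda>k. dist1 0 1 (\<lambda>x. v (r k) 0 (J (r k) x)) g0 + dist1 0 1 (\<lambda>x. v (r k) 0 (J (r k) x)) (\<lambda>x. u' x 0)) \<longlonglongrightarrow> 0 + 0"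
      using LIMSEQ_subseq_LIMSEQ[OF g0(3) r] U_lim[OF t0] by (intro tendsto_add) (simp_all add: o_def I0)
    ultimately have "dist1 0 1 g0 (\<lambda>x. u' x 0) \<le> 0" using LIMSEQ_le_const by fastforce
    then have "dist1 0 1 g0 (\<lambda>x. u' x 0) = 0" using dist1_nonneg[of 0 1 g0 "\<lambda>x. u' x 0"] by linarith
    from dist1_eq_0_imp_AE[OF set_integrable_bvr[OF g0(1)] i'[OF t0] this] g0(2) w0(3)
    show ?thesis by eventually_elim (use u_eq t0 in auto)
  qed
  have sol: "entropy_solution T f \<gamma> u0 \<alpha> \<beta> u"
  proof (rule scheme_limit.limit_is_entropy_solution[OF sl _ init sbm[OF u0] _ _ u_lip])
    show "F1 x + F2 x = f x" for x using F Ff by metis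
    show "AE t in lborel. t \<in> {0<..<T} \<longrightarrow> \<alpha> t = a t" using wa(3) a(2) by eventually_elim auto
    show "AE t in lborel. t \<in> {0<..<T} \<longrightarrow> \<beta> t = b t" using wb(3) b(2) by eventually_elim auto
  qed
  have L1: "L1_dist 0 1 (\<lambda>x. interpolant (dt k) (N k) (M k) (scheme F \<gamma> (dt k) (N k) u0 \<alpha> \<beta>) x t) (\<lambda>x. u x t)
      = ennreal (dist1 0 1 (\<lambda>x. v k (I k t) (J k x)) (\<lambda>x. u' x t))" if t: "t \<in> {0..T}" for k t
  proof -
    have "interpolant (dt k) (N k) (M k) (scheme F \<gamma> (dt k) (N k) u0 \<alpha> \<beta>) x t = v k (I k t) (J k x)" if "x \<in> {0<..<1}" for x
      unfolding v_def[symmetric] I_def J_def h_def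
      by (rule interpolant_eq[OF _ that t dt_pos MT]) (use N[of k] in simp)
    then have "L1_dist 0 1 (\<lambda>x. interpolant (dt k) (N k) (M k) (scheme F \<gamma> (dt k) (N k) u0 \<alpha> \<beta>) x t) (\<lambda>x. u x t)
        = L1_dist 0 1 (\<lambda>x. v k (I k t) (J k x)) (\<lambda>x. u' x t)"
      unfolding L1_dist_def using u_eq t by (intro nn_integral_cong) (auto simp: indicator_def)
    then show ?thesis by (simp only: L1_dist_eq_dist1[OF iU i'[OF t]])
  qed
  have "(\<lambda>k. SUP t\<in>{0..T}. L1_dist 0 1 (\<lambda>x. interpolant (dt (r k)) (N (r k)) (M (r k))
             (scheme F \<gamma> (dt (r k)) (N (r k)) u0 \<alpha> \<beta>) x t) (\<lambda>x. u x t)) \<longlonglongrightarrow> 0"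
  proof (rule order_tendstoI)
    fix e :: ennreal assume "0 < e"
    then obtain c where c: "0 < c" "c < e" using dense by blast
    then have "c < top" by (meson less_top order_less_trans top_greatest order_less_le_trans)
    then obtain c' where c': "c = ennreal c'" "0 \<le> c'" by (cases c) auto
    then have "c' > 0" using c by (auto simp: less_le)
    from unif[OF this] show "\<forall>\<^sub>F k in sequentially. (SUP t\<in>{0..T}. L1_dist 0 1 (\<lambda>x. interpolant (dt (r k)) (N (r k)) (M (r k))
             (scheme F \<gamma> (dt (r k)) (N (r k)) u0 \<alpha> \<beta>) x t) (\<lambda>x. u x t)) < e"
    proof eventually_elim
      case (elim k)
      have "(SUP t\<in>{0..T}. L1_dist 0 1 (\<lambda>x. interpolant (dt (r k)) (N (r k)) (M (r k))
             (scheme F \<gamma> (dt (r k)) (N (r k)) u0 \<alpha> \<beta>) x t) (\<lambda>x. u x t)) \<le> c"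
        by (rule SUP_least) (use elim L1 in \<open>auto simp: c' intro!: ennreal_leI\<close>)
      then show ?case using c(2) by (rule le_less_trans)
    qed
  qed simp
  then show ?thesis using r sol by blast
qed

theorem theorem9:
  fixes T \<gamma> lam :: real
    and f F1 F2 u0 \<alpha> \<beta> :: "real \<Rightarrow> real"
    and F :: "real \<Rightarrow> real \<Rightarrow> real"
    and dt :: "nat \<Rightarrow> real"
    and N M :: "nat \<Rightarrow> nat"
  assumes "T > 0" and "\<gamma> > 0" and "Ck 2 f"
    and "u0 \<in> BV 0 1" and "\<alpha> \<in> BV 0 T" and "\<beta> \<in> BV 0 T"
    and "Ck 1 F1" and "Ck 1 F2"
    and "\<And>v w. F v w = F1 v + F2 w"
    and "\<exists>L. L-lipschitz_on UNIV (\<lambda>(v, w). F v w)"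
    and "\<And>v. F v v = f v"
    and "\<And>v. deriv F1 v \<ge> 0" and "\<And>v. deriv F2 v \<le> 0"
    and "\<And>v. lam * (deriv F1 v - deriv F2 v) \<le> 1"
    and "\<And>n. N n > 0"
    and "\<And>n. dt n = T / (real (M n) + 1)"
    and "\<And>n. dt n / (1 / real (N n)) = lam"
    and "dt \<longlonglongrightarrow> 0"
  shows "\<exists>r :: nat \<Rightarrow> nat. strict_mono r \<and>
    (\<exists>u. entropy_solution T f \<gamma> u0 \<alpha> \<beta> u \<and>
      (\<lambda>k. SUP t\<in>{0..T}. L1_dist 0 1
          (\<lambda>x. interpolant (dt (r k)) (N (r k)) (M (r k))
             (scheme F \<gamma> (dt (r k)) (N (r k)) u0 \<alpha> \<beta>) x t)
          (\<lambda>x. u x t)) \<longlonglongrightarrow> 0)"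
proof -
  have lam: "lam = dt n * real (N n)" for n using assms(17)[of n] by simp
  have "dt n > 0" for n using assms(1) assms(16)[of n] by simp
  then have "lam > 0" using lam[of 0] assms(15)[of 0] by simp
  then have "\<forall>\<^sub>F n in sequentially. dt n < lam" using assms(18) by (intro order_tendstoD(2)) auto
  then obtain m where m: "\<And>n. n \<ge> m \<Longrightarrow> dt n < lam" unfolding eventually_sequentially by blast
  \<comment> \<open>With \<open>N n = 1\<close> there would be no interior cell; as \<open>lam\<close> is fixed, this excludes only finitely many grids
    from the start of the sequence.\<close>
  have "N n \<ge> 2" if "n \<ge> m" for n
  proof (rule ccontr)
    assume "\<not> N n \<ge> 2"
    then have "N n = 1" using assms(15)[of n] by simp
    then show False using m[OF that] lam[of n] by simp
  qed
  then have "\<exists>r :: nat \<Rightarrow> nat. strict_mono r \<and>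
    (\<exists>u. entropy_solution T f \<gamma> u0 \<alpha> \<beta> u \<and>
      (\<lambda>k. SUP t\<in>{0..T}. L1_dist 0 1
          (\<lambda>x. interpolant (dt (r k + m)) (N (r k + m)) (M (r k + m))
             (scheme F \<gamma> (dt (r k + m)) (N (r k + m)) u0 \<alpha> \<beta>) x t)
          (\<lambda>x. u x t)) \<longlonglongrightarrow> 0)"
    by (intro convergence_on_fine_grids[where dt="\<lambda>n. dt (n + m)" and N="\<lambda>n. N (n + m)" and M="\<lambda>n. M (n + m)",
          OF assms(1,2,4-9,11-14) _ assms(16,17) LIMSEQ_ignore_initial_segment[OF assms(18)]]) simp
  then obtain r u where r: "strict_mono (r :: nat \<Rightarrow> nat)" and u: "entropy_solution T f \<gamma> u0 \<alpha> \<beta> u"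
      "(\<lambda>k. SUP t\<in>{0..T}. L1_dist 0 1
          (\<lambda>x. interpolant (dt (r k + m)) (N (r k + m)) (M (r k + m))
             (scheme F \<gamma> (dt (r k + m)) (N (r k + m)) u0 \<alpha> \<beta>) x t)
          (\<lambda>x. u x t)) \<longlonglongrightarrow> 0"
    by blast
  have "strict_mono (\<lambda>k. r k + m)" using r by (simp add: strict_mono_def)
  then show ?thesis using u by (intro exI[of _ "\<lambda>k. r k + m"] exI[of _ u] conjI)
qed

end
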